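(* Let $\Psi(s,t)=\alpha(s)+\beta(t)$ be a minimal translation surface in $\mathbb R^3$, where $\alpha$ and $\beta$ are parameterized by arc length. Suppose that the curvatures $\kappa_\alpha$ and $\kappa_\beta$ are positive everywhere and the torsions $\tau_\alpha$, $\tau_\beta$ are non-zero everywhere. Then, up to a rigid motion, the curve $\beta$ coincides with $\alpha$ and $$\kappa_\alpha^2\tau_\alpha=c_1,\qquad \frac{1}{\tau_\alpha}\left(\frac{\kappa_\alpha'}{\kappa_\alpha}\right)'+\frac{\kappa_\alpha^2}{\tau_\alpha}-2\tau_\alpha=c_2,$$ where $c_1\neq 0$ and $c_2$ are two constants. Furthermore, $\kappa_\alpha$ is a positive solution of the autonomous ODE $$(y')^2+y^4+c_3y^2+\frac{c_1^2}{y^{2}}+c_1c_2=0$$ for some constant $c_3$, and the curve $\alpha$ can be expressed as $$\alpha(s)=\left(A\int^s\cos w(s),\; B\int^s\sin w(s),\; \int^s\sqrt{1-A^2\cos^2 w(s)-B^2\sin^2w(s)}\right).$$ Here $A=\sqrt{\lambda_3/(\lambda_3-\lambda_1)}$ and $B=\sqrt{\lambda_3/(\lambda_3-\lambda_2)}$, where $\lambda_i$, $1\le i\le 3$, are the three real roots of the cubic equation $$-\lambda^3+c_2\lambda^2-c_3\lambda+c_1=0,$$ and the function $w$ is $w(s)=\int^s\sqrt{\kappa_\alpha(s)^2+\lambda_1\lambda_2}$. Conversely, any minimal translation surface of $\mathbb R^3$ of non-planar type is constructed by this process. Exactly: let $c_1\neq 0$, $c_2$ and $c_3$ be three constants such that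 the cubic equation $-\lambda^3+c_2\lambda^2-c_3\lambda+c_1=0$ has three real roots $\lambda_1,\lambda_2,\lambda_3$. Let $\kappa(s)$ be a positive and non-constant solution of the ODE $(y')^2+y^4+c_3y^2+\frac{c_1^2}{y^{2}}+c_1c_2=0$. If $\alpha(s)$ is a curve parameterized by arc length $s$ with curvature $\kappa(s)$ and torsion $c_1/\kappa(s)^2$, then the translation surface $\Psi(s,t)=\alpha(s)+\alpha(t)$ is minimal.
   Context: All curves and surfaces are of class $C^\infty$. A surface in $\mathbb R^3$ is called a translation surface if it can be locally written as the sum $\Psi(s,t)=\alpha(s)+\beta(t)$ of two space curves $\alpha:I\subset\mathbb R\to\mathbb R^3$ and $\beta:J\subset\mathbb R\to\mathbb R^3$, called its generating curves. If $\alpha$ and $\beta$ are plane curves, the surface is said to be of planar type; otherwise it is of non-planar type. It is assumed throughout that the parameterization is regular, i.e. $\alpha'(s)\times\beta'(t)\neq0$ for all parameters $(s,t)$ considered. A surface is minimal if its mean curvature is zero everywhere. For a curve parameterized by arc length with curvature $\kappa>0$ and Frenet trihedron $\{\mathbf t,\mathbf n,\mathbf b\}$, the torsion $\tau$ is given by the Frenet equations $\mathbf t'=\kappa\mathbf n$, $\mathbf n'=-\kappa\mathbf t+\tau\mathbf b$, $\mathbf b'=-\tau\mathbf n$. The subscripts $\alpha$, $\beta$ on $\kappa$ and $\tau$ indicate the curve. The notation $\int^s f(s)$ denotes an antiderivative of $f$ with respect to $s$.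
   Formalization: The formula for α holds up to an isometry, orientation-reversing if c_1<0 (the displayed curve has positive torsion); "any minimal translation surface of non-planar type is constructed by this process" allows constant κ (helicoid), with the c_2-equation added. *)

theory Defs
  imports "HOL-Analysis.Analysis"
begin

section \<open>Smooth curves in space\<close>

definition open_interval :: "real set \<Rightarrow> bool" where
  "open_interval I \<longleftrightarrow> open I \<and> is_interval I \<and> I \<noteq> {}"

abbreviation vderiv :: "(real \<Rightarrow> 'a::real_normed_vector) \<Rightarrow> real \<Rightarrow> 'a" where
  "vderiv f \<equiv> (\<lambda>s. vector_derivative f (at s))"

text \<open>Class \<open>C\<close>-infinity on an open set \<open>I\<close>: every iterated derivative exists at every point of
  \<open>I\<close>. The values of \<open>f\<close> outside \<open>I\<close> are irrelevant because \<open>I\<close> is open.\<close>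

definition smooth_on :: "real set \<Rightarrow> (real \<Rightarrow> 'a::real_normed_vector) \<Rightarrow> bool" where
  "smooth_on I f \<longleftrightarrow> (\<forall>n. \<forall>s\<in>I. (vderiv ^^ n) f differentiable (at s))"

definition arc_length_curve :: "real set \<Rightarrow> (real \<Rightarrow> real^3) \<Rightarrow> bool" where
  "arc_length_curve I \<alpha> \<longleftrightarrow>
     open_interval I \<and> smooth_on I \<alpha> \<and> (\<forall>s\<in>I. norm (vderiv \<alpha> s) = 1)"

definition plane_curve :: "real set \<Rightarrow> (real \<Rightarrow> real^3) \<Rightarrow> bool" where
  "plane_curve I \<alpha> \<longleftrightarrow> (\<exists>n d. n \<noteq> 0 \<and> (\<forall>s\<in>I. n \<bullet> \<alpha> s = d))"

text \<open>Frenet apparatus of a curve parameterized by arc length (with positive curvature). The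
  torsion is the coefficient in the third Frenet equation \<open>b' = - \<tau> n\<close>.\<close>

definition curvature :: "(real \<Rightarrow> real^3) \<Rightarrow> real \<Rightarrow> real" where
  "curvature \<alpha> s = norm (vderiv (vderiv \<alpha>) s)"

definition frenet_t :: "(real \<Rightarrow> real^3) \<Rightarrow> real \<Rightarrow> real^3" where
  "frenet_t \<alpha> s = vderiv \<alpha> s"

definition frenet_n :: "(real \<Rightarrow> real^3) \<Rightarrow> real \<Rightarrow> real^3" where
  "frenet_n \<alpha> s = (1 / curvature \<alpha> s) *\<^sub>R vderiv (frenet_t \<alpha>) s"

definition frenet_b :: "(real \<Rightarrow> real^3) \<Rightarrow> real \<Rightarrow> real^3" where
  "frenet_b \<alpha> s = cross3 (frenet_t \<alpha> s) (frenet_n \<alpha> s)"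

definition torsion :: "(real \<Rightarrow> real^3) \<Rightarrow> real \<Rightarrow> real" where
  "torsion \<alpha> s = - (vderiv (frenet_b \<alpha>) s \<bullet> frenet_n \<alpha> s)"


section \<open>Parameterized surfaces and mean curvature\<close>

definition partial1 :: "(real \<Rightarrow> real \<Rightarrow> real^3) \<Rightarrow> real \<Rightarrow> real \<Rightarrow> real^3" where
  "partial1 X s t = vector_derivative (\<lambda>u. X u t) (at s)"

definition partial2 :: "(real \<Rightarrow> real \<Rightarrow> real^3) \<Rightarrow> real \<Rightarrow> real \<Rightarrow> real^3" where
  "partial2 X s t = vector_derivative (\<lambda>v. X s v) (at t)"

definition unit_normal :: "(real \<Rightarrow> real \<Rightarrow> real^3) \<Rightarrow> real \<Rightarrow> real \<Rightarrow> real^3" where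
  "unit_normal X s t = sgn (cross3 (partial1 X s t) (partial2 X s t))"

text \<open>\<open>H = (e G - 2 f F + g E) / (2 (E G - F\<^sup>2))\<close>, where \<open>E, F, G\<close> and \<open>e, f, g\<close> are the
  coefficients of the first and second fundamental forms. Meaningful only at regular points.\<close>

definition mean_curvature :: "(real \<Rightarrow> real \<Rightarrow> real^3) \<Rightarrow> real \<Rightarrow> real \<Rightarrow> real" where
  "mean_curvature X s t =
    (let E = partial1 X s t \<bullet> partial1 X s t;
         F = partial1 X s t \<bullet> partial2 X s t;
         G = partial2 X s t \<bullet> partial2 X s t;
         e = partial1 (partial1 X) s t \<bullet> unit_normal X s t;
         f = partial2 (partial1 X) s t \<bullet> unit_normal X s t;
         g = partial2 (partial2 X) s t \<bullet> unit_normal X s t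
     in (e * G - 2 * f * F + g * E) / (2 * (E * G - F\<^sup>2)))"

definition translation_surface ::
  "(real \<Rightarrow> real^3) \<Rightarrow> (real \<Rightarrow> real^3) \<Rightarrow> real \<Rightarrow> real \<Rightarrow> real^3" where
  "translation_surface \<alpha> \<beta> s t = \<alpha> s + \<beta> t"

definition regular_at :: "(real \<Rightarrow> real^3) \<Rightarrow> (real \<Rightarrow> real^3) \<Rightarrow> real \<Rightarrow> real \<Rightarrow> bool" where
  "regular_at \<alpha> \<beta> s t \<longleftrightarrow> cross3 (vderiv \<alpha> s) (vderiv \<beta> t) \<noteq> 0"

definition minimal_translation_surface ::
  "real set \<Rightarrow> real set \<Rightarrow> (real \<Rightarrow> real^3) \<Rightarrow> (real \<Rightarrow> real^3) \<Rightarrow> bool" where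
  "minimal_translation_surface I J \<alpha> \<beta> \<longleftrightarrow>
     open_interval I \<and> open_interval J \<and> smooth_on I \<alpha> \<and> smooth_on J \<beta> \<and>
     (\<forall>s\<in>I. \<forall>t\<in>J. regular_at \<alpha> \<beta> s t) \<and>
     (\<forall>s\<in>I. \<forall>t\<in>J. mean_curvature (translation_surface \<alpha> \<beta>) s t = 0)"


section \<open>Isometries of space\<close>

text \<open>Isometries whose linear part has determinant \<open>d\<close> (necessarily \<open>1\<close> or \<open>-1\<close>).\<close>

definition isometry_with_det :: "real \<Rightarrow> (real^3 \<Rightarrow> real^3) \<Rightarrow> bool" where
  "isometry_with_det d f \<longleftrightarrow>
     (\<exists>p Q. orthogonal_transformation Q \<and> det (matrix Q) = d \<and> (\<forall>x. f x = p + Q x))"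

definition rigid_motion :: "(real^3 \<Rightarrow> real^3) \<Rightarrow> bool" where
  "rigid_motion f \<longleftrightarrow> isometry_with_det 1 f"


section \<open>Equations for the generating curve\<close>

definition ode_solution :: "real \<Rightarrow> real \<Rightarrow> real \<Rightarrow> real set \<Rightarrow> (real \<Rightarrow> real) \<Rightarrow> bool" where
  "ode_solution c1 c2 c3 I y \<longleftrightarrow>
     (\<forall>s\<in>I. y differentiable (at s) \<and>
        (deriv y s)\<^sup>2 + (y s)^4 + c3 * (y s)\<^sup>2 + c1\<^sup>2 / (y s)\<^sup>2 + c1 * c2 = 0)"

definition curvature_torsion_equations ::
  "real \<Rightarrow> real \<Rightarrow> real set \<Rightarrow> (real \<Rightarrow> real^3) \<Rightarrow> bool" where
  "curvature_torsion_equations c1 c2 I \<alpha> \<longleftrightarrow>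
     (\<forall>s\<in>I. (curvature \<alpha> s)\<^sup>2 * torsion \<alpha> s = c1 \<and>
        1 / torsion \<alpha> s * deriv (\<lambda>u. deriv (curvature \<alpha>) u / curvature \<alpha> u) s
          + (curvature \<alpha> s)\<^sup>2 / torsion \<alpha> s - 2 * torsion \<alpha> s = c2)"

text \<open>\<open>l1, l2, l3\<close> are the roots, listed with multiplicity.\<close>

definition cubic_roots :: "real \<Rightarrow> real \<Rightarrow> real \<Rightarrow> real \<Rightarrow> real \<Rightarrow> real \<Rightarrow> bool" where
  "cubic_roots c1 c2 c3 l1 l2 l3 \<longleftrightarrow>
     (\<forall>x. - (x^3) + c2 * x\<^sup>2 - c3 * x + c1 = - ((x - l1) * (x - l2) * (x - l3)))"

definition antiderivative_on :: "real set \<Rightarrow> (real \<Rightarrow> real) \<Rightarrow> (real \<Rightarrow> real) \<Rightarrow> bool" where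
  "antiderivative_on I f F \<longleftrightarrow> (\<forall>s\<in>I. (F has_real_derivative f s) (at s))"

text \<open>The explicit form of a curve, up to an isometry. Since the right-hand side has
  \<open>w' > 0\<close> and a nonnegative third component of the velocity, its torsion is positive, hence
  the isometry has to reverse the orientation exactly when the torsion of \<open>\<alpha>\<close>
  (that is, \<open>c1\<close>) is negative. The parameter \<open>d\<close> records this sign.\<close>

definition explicit_form ::
  "real \<Rightarrow> real \<Rightarrow> real \<Rightarrow> real \<Rightarrow> real set \<Rightarrow> (real \<Rightarrow> real^3) \<Rightarrow> bool" where
  "explicit_form d l1 l2 l3 I \<alpha> \<longleftrightarrow>
     (let A = sqrt (l3 / (l3 - l1)); B = sqrt (l3 / (l3 - l2)) in
      \<exists>w X1 X2 X3 f.
        antiderivative_on I (\<lambda>s. sqrt ((curvature \<alpha> s)\<^sup>2 + l1 * l2)) w \<and>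
        antiderivative_on I (\<lambda>s. cos (w s)) X1 \<and>
        antiderivative_on I (\<lambda>s. sin (w s)) X2 \<and>
        antiderivative_on I (\<lambda>s. sqrt (1 - A\<^sup>2 * (cos (w s))\<^sup>2 - B\<^sup>2 * (sin (w s))\<^sup>2)) X3 \<and>
        isometry_with_det d f \<and>
        (\<forall>s\<in>I. \<alpha> s = f (vector [A * X1 s, B * X2 s, X3 s])))"

end

theory Submission
  imports Defs
begin

text \<open>
  For a translation surface with generating curves \<open>\<alpha>\<close> and \<open>\<beta>\<close>, let \<open>T\<close>, \<open>U\<close> be the unit tangents and
  \<open>K = \<kappa> b\<close>, \<open>L\<close> the curvature binormals. The mixed second derivative of \<open>\<alpha> s + \<beta> t\<close> is zero, and vanishing
  mean curvature means \<open>K s \<bullet> U t = T s \<bullet> L t\<close> for all \<open>s\<close>, \<open>t\<close> (\<open>minimal_iff_orthogonality\<close>). This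
  relation is bilinear and separates the variables. If the tangents of both curves span space, it forces
  \<open>K = f T\<close> and \<open>L = f\<^sup>T U\<close> for a constant linear operator \<open>f\<close>. Since \<open>T' = K \<times> T\<close> for unit
  speed, the tangent solves the autonomous equation \<open>T' = f T \<times> T\<close> on the spherical conic
  \<open>|T| = 1\<close>, \<open>f T \<bullet> T = 0\<close>. A nonplanar solution exists only if \<open>f\<close> is symmetric and injective
  (\<open>turning_operator_symmetric_injective\<close>), so that both curves solve the same equation. A planar curve
  can only be paired with another planar curve (\<open>full_direction_of_partner\<close>).

  In the principal axes of \<open>f\<close>, two eigenvalues \<open>l1\<close>, \<open>l2\<close> have one sign and \<open>l3\<close> has the other. The conic is
  a pair of antipodal ovals around the third axis, and one of them is parameterized as
  \<open>(A cos w, B sin w, sqrt (1 - A^2 cos^2 w - B^2 sin^2 w))\<close>. The equation becomes an autonomous scalar equation for \<open>w\<close>,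
  whose solution exists for all times and passes through every point of the oval. This yields the explicit formula
  (\<open>unit_speed_curve_explicit_form\<close>) and one complete curve of which \<open>\<alpha>\<close> and \<open>\<beta>\<close> are pieces; a curve
  with tangents on the other oval is obtained by reversing the parameter, or by a half turn about the first axis.
  The curvature is the length of \<open>f T\<close>, and the constants \<open>c1\<close>, \<open>c2\<close>, \<open>c3\<close> are the coefficients of the
  characteristic polynomial of \<open>f\<close> (\<open>unit_speed_curve_equations\<close>).

  For the converse, a matrix written down in the Frenet frame from \<open>\<kappa>\<close>, \<open>\<tau>\<close> and \<open>\<kappa>' / \<kappa>\<close> is constant in space along
  the curve precisely by the equations for \<open>\<kappa>\<close> and \<open>\<tau>\<close> (\<open>frenet_form_constant\<close>). It is the symmetric operator
  \<open>f\<close>, and its symmetry is the orthogonality relation for the surface \<open>\<alpha> s + \<alpha> t\<close>. The first-order equation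
  for \<open>\<kappa>\<close> alone does not exclude that a solution rests at a stationary value; this is excluded by
  smoothness of the curve (\<open>nonconstant_solution_second_derivative\<close>).
\<close>

section \<open>Smooth functions of one real variable\<close>

lemmas real_derivative_iff = has_real_derivative_iff_has_vector_derivative
  and inner_right_derivative = bounded_linear.has_vector_derivative[OF bounded_linear_inner_right]

text \<open>Coinduction for smoothness: a class of functions closed under differentiation consists of smooth
functions. It replaces a calculus of iterated derivatives, which would need Leibniz and chain rules
of every order.\<close>

lemma smooth_on_coinduct:
  assumes "X f"
    and step: "\<And>f. X f \<Longrightarrow> \<exists>g. X g \<and> (\<forall>s\<in>I. (f has_vector_derivative g s) (at s))"
    and I: "open I"
  shows "smooth_on I f"
proof -
  have "\<exists>g. X g \<and> (\<forall>s\<in>I. (vderiv ^^ n) f s = g s)" for n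
  proof (induction n)
    case 0
    then show ?case using \<open>X f\<close> by auto
  next
    case (Suc n)
    then obtain g where g: "X g" "\<And>s. s \<in> I \<Longrightarrow> (vderiv ^^ n) f s = g s" by blast
    from step[OF g(1)] obtain h where h: "X h" "\<And>s. s \<in> I \<Longrightarrow> (g has_vector_derivative h s) (at s)"
      by blast
    have "(vderiv ^^ Suc n) f s = h s" if "s \<in> I" for s
    proof -
      have "((vderiv ^^ n) f has_vector_derivative h s) (at s)"
        by (rule has_vector_derivative_transform_within_open[OF h(2)[OF that] I that]) (simp add: g)
      then show ?thesis by (simp add: vector_derivative_at)
    qed
    then show ?case using h(1) by blast
  qed
  note it = this
  show ?thesis unfolding smooth_on_def
  proof (intro allI ballI)
    fix n s assume s: "s \<in> I"
    from it[of n] obtain g where g: "X g" "\<And>s. s \<in> I \<Longrightarrow> (vderiv ^^ n) f s = g s" by blast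
    from step[OF g(1)] obtain h where h: "\<And>s. s \<in> I \<Longrightarrow> (g has_vector_derivative h s) (at s)"
      by blast
    have "((vderiv ^^ n) f has_vector_derivative h s) (at s)"
      by (rule has_vector_derivative_transform_within_open[OF h[OF s] I s]) (simp add: g)
    then show "(vderiv ^^ n) f differentiable (at s)" by (rule differentiableI_vector)
  qed
qed

lemma smooth_on_vderiv:
  assumes "smooth_on I f"
  shows "smooth_on I (vderiv f)"
  using assms unfolding smooth_on_def
  by (metis comp_apply funpow_Suc_right)

lemma smooth_on_has_vderiv:
  assumes "smooth_on I f" "s \<in> I"
  shows "(f has_vector_derivative vderiv f s) (at s)"
proof -
  have "(vderiv ^^ 0) f differentiable (at s)" using assms unfolding smooth_on_def by blast
  then show ?thesis by (simp add: vector_derivative_works)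
qed

lemma smooth_on_continuous:
  assumes "smooth_on I f"
  shows "continuous_on I f"
  using smooth_on_has_vderiv[OF assms] has_vector_derivative_continuous
  by (blast intro: continuous_at_imp_continuous_on)

lemma has_vector_derivative_vec_iff:
  fixes f :: "real \<Rightarrow> real^'n"
  shows "(f has_vector_derivative d) F \<longleftrightarrow> (\<forall>i. ((\<lambda>s. f s $ i) has_vector_derivative d $ i) F)"
proof
  assume "(f has_vector_derivative d) F"
  then show "\<forall>i. ((\<lambda>s. f s $ i) has_vector_derivative d $ i) F"
    by (auto intro: bounded_linear.has_vector_derivative[OF bounded_linear_vec_nth])
next
  assume *: "\<forall>i. ((\<lambda>s. f s $ i) has_vector_derivative d $ i) F"
  have sum: "((\<lambda>s. \<Sum>i\<in>UNIV. f s $ i *\<^sub>R axis i (1::real)) has_vector_derivative (\<Sum>i\<in>UNIV. d $ i *\<^sub>R axis i (1::real))) F"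
    by (intro has_vector_derivative_sum bounded_linear.has_vector_derivative[OF bounded_linear_scaleR_left])
      (use * in auto)
  have expand: "(\<Sum>i\<in>UNIV. x $ i *\<^sub>R axis i (1::real)) = x" for x :: "real^'n"
    using basis_expansion[of x] by (simp add: scalar_mult_eq_scaleR)
  show "(f has_vector_derivative d) F" using sum unfolding expand .
qed

text \<open>The functions obtained from \<open>B\<close> by ring operations and \<open>f \<mapsto> 1 / sqrt f\<close>. The square root enters
through its reciprocal because the derivative \<open>- f' (1 / sqrt f)^3 / 2\<close> stays inside the class; if
the derivatives of the members of \<open>B\<close> do so too, the class is closed under differentiation and
smoothness follows. The two choices of \<open>B\<close> made below are all smooth functions, and the components
of a solution of a polynomial differential equation.\<close>

inductive_set generated_functions :: "real set \<Rightarrow> (real \<Rightarrow> real) set \<Rightarrow> (real \<Rightarrow> real) set"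
  for I B where
  base: "b \<in> B \<Longrightarrow> b \<in> generated_functions I B"
| const: "(\<lambda>s. c) \<in> generated_functions I B"
| plus: "f \<in> generated_functions I B \<Longrightarrow> g \<in> generated_functions I B \<Longrightarrow>
    (\<lambda>s. f s + g s) \<in> generated_functions I B"
| times: "f \<in> generated_functions I B \<Longrightarrow> g \<in> generated_functions I B \<Longrightarrow>
    (\<lambda>s. f s * g s) \<in> generated_functions I B"
| inverse_sqrt: "f \<in> generated_functions I B \<Longrightarrow> (\<And>s. s \<in> I \<Longrightarrow> f s > 0) \<Longrightarrow>
    (\<lambda>s. 1 / sqrt (f s)) \<in> generated_functions I B"

lemma generated_functions_diff:
  assumes "f \<in> generated_functions I B" "g \<in> generated_functions I B"
  shows "(\<lambda>s. f s - g s) \<in> generated_functions I B"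
proof -
  have "(\<lambda>s. f s + (-1) * g s) \<in> generated_functions I B"
    by (intro generated_functions.plus generated_functions.times generated_functions.const assms)
  then show ?thesis by simp
qed

lemma generated_functions_derivative:
  assumes B: "\<And>b. b \<in> B \<Longrightarrow> \<exists>g\<in>generated_functions I B. \<forall>s\<in>I. (b has_vector_derivative g s) (at s)"
    and "f \<in> generated_functions I B"
  shows "\<exists>g\<in>generated_functions I B. \<forall>s\<in>I. (f has_vector_derivative g s) (at s)"
  using assms(2)
proof induction
  case (base b)
  then show ?case by (rule B)
next
  case (const c)
  show ?case by (rule bexI[of _ "\<lambda>s. 0"]) (auto intro: generated_functions.const)
next
  case (plus f g)
  then obtain f' g' where *: "f' \<in> generated_functions I B" "g' \<in> generated_functions I B"
    "\<forall>s\<in>I. (f has_vector_derivative f' s) (at s)" "\<forall>s\<in>I. (g has_vector_derivative g' s) (at s)" by blast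
  show ?case
    by (rule bexI[of _ "\<lambda>s. f' s + g' s"])
      (use * in \<open>auto intro!: has_vector_derivative_add generated_functions.plus\<close>)
next
  case (times f g)
  then obtain f' g' where *: "f' \<in> generated_functions I B" "g' \<in> generated_functions I B"
    "\<forall>s\<in>I. (f has_vector_derivative f' s) (at s)" "\<forall>s\<in>I. (g has_vector_derivative g' s) (at s)" by blast
  show ?case
    by (rule bexI[of _ "\<lambda>s. f s * g' s + f' s * g s"])
      (use * times.hyps in \<open>auto intro!: has_vector_derivative_mult generated_functions.plus generated_functions.times\<close>)
next
  case (inverse_sqrt f)
  then obtain f' where *: "f' \<in> generated_functions I B"
    "\<forall>s\<in>I. (f has_vector_derivative f' s) (at s)" by blast
  let ?r = "\<lambda>s. 1 / sqrt (f s)"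
  have r: "?r \<in> generated_functions I B"
    by (rule generated_functions.inverse_sqrt) (use inverse_sqrt in auto)
  have d: "(?r has_vector_derivative (- 1 / 2) * (f' s * (?r s * (?r s * ?r s)))) (at s)" if "s \<in> I" for s
  proof -
    have pos: "f s > 0" using inverse_sqrt.hyps that by blast
    have f: "(f has_real_derivative f' s) (at s)"
      using * that by (simp add: real_derivative_iff)
    have "((\<lambda>s. inverse (sqrt (f s))) has_real_derivative
        - (inverse (sqrt (f s)) * (inverse (sqrt (f s)) / 2 * f' s) * inverse (sqrt (f s)))) (at s)"
      by (rule DERIV_inverse' DERIV_chain2[OF DERIV_real_sqrt f] | use pos in simp)+
    moreover have "- (i * (i / 2 * d) * i) = (- 1 / 2) * (d * (i * (i * i)))" for i d :: real
      by simp
    ultimately have "(?r has_real_derivative (- 1 / 2) * (f' s * (?r s * (?r s * ?r s)))) (at s)"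
      unfolding inverse_eq_divide by (simp only:)
    then show ?thesis by (simp add: real_derivative_iff)
  qed
  have m: "(\<lambda>s. (- 1 / 2) * (f' s * (?r s * (?r s * ?r s)))) \<in> generated_functions I B"
    by (intro generated_functions.times generated_functions.const * r)
  show ?case by (rule bexI[OF _ m]) (use d in blast)
qed

lemma generated_functions_smooth:
  assumes "open I"
    and "\<And>b. b \<in> B \<Longrightarrow> \<exists>g\<in>generated_functions I B. \<forall>s\<in>I. (b has_vector_derivative g s) (at s)"
    and "f \<in> generated_functions I B"
  shows "smooth_on I f"
  by (rule smooth_on_coinduct[where X = "\<lambda>f. f \<in> generated_functions I B"])
    (use assms generated_functions_derivative[OF assms(2)] in \<open>simp_all add: Bex_def\<close>)

lemma smooth_on_vec_nth:
  fixes f :: "real \<Rightarrow> real^'n"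
  assumes "open I" "smooth_on I f"
  shows "smooth_on I (\<lambda>s. f s $ i)"
proof (rule smooth_on_coinduct[where X = "\<lambda>g. \<exists>f :: real \<Rightarrow> real^'n. smooth_on I f \<and> g = (\<lambda>s. f s $ i)"])
  show "\<exists>fa :: real \<Rightarrow> real^'n. smooth_on I fa \<and> (\<lambda>s. f s $ i) = (\<lambda>s. fa s $ i)" using assms by blast
  fix g assume "\<exists>f :: real \<Rightarrow> real^'n. smooth_on I f \<and> g = (\<lambda>s. f s $ i)"
  then obtain f :: "real \<Rightarrow> real^'n" where f: "smooth_on I f" "g = (\<lambda>s. f s $ i)" by blast
  show "\<exists>h. (\<exists>f :: real \<Rightarrow> real^'n. smooth_on I f \<and> h = (\<lambda>s. f s $ i)) \<and> (\<forall>s\<in>I. (g has_vector_derivative h s) (at s))"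
    by (rule exI[of _ "\<lambda>s. vderiv f s $ i"])
      (use f smooth_on_vderiv smooth_on_has_vderiv[OF f(1)] in \<open>auto simp: has_vector_derivative_vec_iff\<close>)
qed (rule assms)

lemma smooth_on_antiderivative:
  assumes I: "open I" and F: "\<And>s. s \<in> I \<Longrightarrow> (F has_vector_derivative f s) (at s)" and f: "smooth_on I f"
  shows "smooth_on I F"
proof (rule smooth_on_coinduct[where X = "\<lambda>h. h = F \<or> smooth_on I h"])
  fix h assume "h = F \<or> smooth_on I h"
  then show "\<exists>g. (g = F \<or> smooth_on I g) \<and> (\<forall>s\<in>I. (h has_vector_derivative g s) (at s))"
    using F f smooth_on_vderiv smooth_on_has_vderiv by metis
qed (use I in auto)

text \<open>Used for the speed and for the curvature of a curve, hence the exclusion of zeros.\<close>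

lemma smooth_on_norm:
  fixes f :: "real \<Rightarrow> real^3"
  assumes I: "open I" and f: "smooth_on I f" and nz: "\<And>s. s \<in> I \<Longrightarrow> f s \<noteq> 0"
  shows "smooth_on I (\<lambda>s. norm (f s))"
proof -
  let ?B = "{h :: real \<Rightarrow> real. smooth_on I h}"
  let ?G = "generated_functions I ?B"
  have c: "(\<lambda>s. f s $ i) \<in> ?G" for i
    by (rule generated_functions.base) (use smooth_on_vec_nth[OF I f] in simp)
  have q: "(\<lambda>s. f s \<bullet> f s) \<in> ?G"
    unfolding inner_vec_def sum_3 inner_real_def
    by (intro generated_functions.plus generated_functions.times c)
  have "(\<lambda>s. (f s \<bullet> f s) * (1 / sqrt (f s \<bullet> f s))) \<in> ?G"
    by (intro generated_functions.times generated_functions.inverse_sqrt q) (use nz in simp)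
  moreover have "(\<lambda>s. (f s \<bullet> f s) * (1 / sqrt (f s \<bullet> f s))) = (\<lambda>s. norm (f s))"
    by (simp add: norm_eq_sqrt_inner real_div_sqrt)
  ultimately have mem: "(\<lambda>s. norm (f s)) \<in> ?G" by simp
  show ?thesis
  proof (rule generated_functions_smooth[OF I _ mem])
    fix b assume "b \<in> ?B"
    then have b: "smooth_on I b" by simp
    have "vderiv b \<in> ?G"
      by (rule generated_functions.base) (simp add: smooth_on_vderiv[OF b])
    then show "\<exists>g\<in>?G. \<forall>s\<in>I. (b has_vector_derivative g s) (at s)"
      using smooth_on_has_vderiv[OF b] by (intro bexI[of _ "vderiv b"]) auto
  qed
qed

section \<open>Differential equations on an interval\<close>

text \<open>The interval is open and possibly unbounded, so it is first brought into the form of an interval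
with extended real end points.\<close>

lemma antiderivative_exists:
  fixes f :: "real \<Rightarrow> 'a::euclidean_space"
  assumes I: "open_interval I" and f: "continuous_on I f"
  obtains F where "\<And>s. s \<in> I \<Longrightarrow> (F has_vector_derivative f s) (at s)"
proof -
  have op: "open I" and iv: "is_interval I" and ne: "I \<noteq> {}" using I by (auto simp: open_interval_def)
  obtain s0 where s0: "s0 \<in> I" using ne by blast
  obtain a b where ab: "I = einterval a b" "a < b"
  proof -
    let ?a = "Inf (ereal ` I)" and ?b = "Sup (ereal ` I)"
    have "I = einterval ?a ?b"
    proof (intro equalityI subsetI)
      fix s assume s: "s \<in> I"
      then obtain e where e: "e > 0" "ball s e \<subseteq> I" using op openE by blast
      have "s - e/2 \<in> I" "s + e/2 \<in> I" using e by (auto simp: dist_real_def subset_iff)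
      then have "?a \<le> ereal (s - e/2)" "ereal (s + e/2) \<le> ?b"
        by (auto intro: Inf_lower Sup_upper)
      moreover have "ereal (s - e/2) < ereal s" "ereal s < ereal (s + e/2)" using e(1) by auto
      ultimately have "?a < ereal s" "ereal s < ?b"
        by (blast intro: le_less_trans less_le_trans)+
      then show "s \<in> einterval ?a ?b" by (simp add: einterval_def)
    next
      fix s assume "s \<in> einterval ?a ?b"
      then have "?a < ereal s" "ereal s < ?b" by (auto simp: einterval_def)
      then obtain x y where "x \<in> I" "y \<in> I" "x < s" "s < y"
        by (auto simp: Inf_less_iff less_Sup_iff)
      then show "s \<in> I" using iv unfolding is_interval_1 by (meson less_imp_le)
    qed
    moreover from this s0 have "?a < ?b" by (force simp: einterval_def)
    ultimately show ?thesis using that by blast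
  qed
  have "isCont f s" if "a < ereal s" "ereal s < b" for s
    using f op that ab by (simp add: continuous_on_eq_continuous_at einterval_def)
  then obtain F where "\<forall>x. a < ereal x \<longrightarrow> ereal x < b \<longrightarrow> (F has_vector_derivative f x) (at x)"
    using einterval_antiderivative[OF ab(2)] by blast
  then show ?thesis using that ab by (auto simp: einterval_def)
qed

lemma interval_segment_subset:
  assumes "open_interval I" "a \<in> I" "b \<in> I" "a \<le> x" "x \<le> b"
  shows "x \<in> (I :: real set)"
  using assms unfolding open_interval_def is_interval_1 by blast

text \<open>Uniqueness for linear equations in the form of Gronwall: with \<open>\<phi>' = 2 c\<close>, the function
\<open>|D|^2 exp (- \<phi>)\<close> decreases to the right of \<open>s0\<close> and \<open>|D|^2 exp \<phi>\<close> increases to its left. All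
uniqueness statements below, and all arguments that a direction remains in a plane, are instances.\<close>

lemma linear_differential_inequality_zero:
  fixes D :: "real \<Rightarrow> 'a::real_inner"
  assumes I: "open_interval I" and c: "continuous_on I c"
    and D: "\<And>s. s \<in> I \<Longrightarrow> (D has_vector_derivative D' s) (at s)"
    and bound: "\<And>s. s \<in> I \<Longrightarrow> norm (D' s) \<le> c s * norm (D s)"
    and s0: "s0 \<in> I" "D s0 = 0" and s: "s \<in> I"
  shows "D s = 0"
proof -
  obtain \<phi> where \<phi>: "\<And>s. s \<in> I \<Longrightarrow> (\<phi> has_vector_derivative 2 * c s) (at s)"
    by (rule antiderivative_exists[OF I continuous_on_mult[OF continuous_on_const c]]) blast
  define y where "y = (\<lambda>s. D s \<bullet> D s)"
  have y: "(y has_real_derivative 2 * (D u \<bullet> D' u)) (at u)" if "u \<in> I" for u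
    unfolding y_def real_derivative_iff
    using bounded_bilinear.has_vector_derivative[OF bounded_bilinear_inner D[OF that] D[OF that]]
    by (simp add: inner_commute)
  have bd: "\<bar>2 * (D u \<bullet> D' u)\<bar> \<le> 2 * c u * y u" if "u \<in> I" for u
  proof -
    have "\<bar>D u \<bullet> D' u\<bar> \<le> norm (D u) * norm (D' u)" by (rule Cauchy_Schwarz_ineq2)
    also have "\<dots> \<le> norm (D u) * (c u * norm (D u))"
      by (rule mult_left_mono[OF bound[OF that]]) simp
    also have "\<dots> = c u * y u" by (simp add: y_def dot_square_norm power2_eq_square)
    finally show ?thesis by simp
  qed
  have \<phi>': "(\<phi> has_real_derivative 2 * c u) (at u)" if "u \<in> I" for u
    using \<phi>[OF that] by (simp add: real_derivative_iff)
  have "y s \<le> 0"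
  proof (cases "s0 \<le> s")
    case True
    have "y s * exp (- \<phi> s) \<le> y s0 * exp (- \<phi> s0)"
    proof (rule DERIV_nonpos_imp_nonincreasing[OF True])
      fix x assume "s0 \<le> x" "x \<le> s"
      then have x: "x \<in> I" by (rule interval_segment_subset[OF I s0(1) s])
      have "((\<lambda>s. y s * exp (- \<phi> s)) has_real_derivative
          (2 * (D x \<bullet> D' x) - 2 * c x * y x) * exp (- \<phi> x)) (at x)"
        by (rule derivative_eq_intros y[OF x] \<phi>'[OF x] refl)+ (simp add: algebra_simps)
      moreover have "(2 * (D x \<bullet> D' x) - 2 * c x * y x) * exp (- \<phi> x) \<le> 0"
        using bd[OF x] by (simp add: mult_le_0_iff)
      ultimately show "\<exists>d. ((\<lambda>s. y s * exp (- \<phi> s)) has_real_derivative d) (at x) \<and> d \<le> 0" by blast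
    qed
    then show ?thesis using s0(2) by (simp add: y_def mult_le_0_iff)
  next
    case False
    then have le: "s \<le> s0" by simp
    have "y s * exp (\<phi> s) \<le> y s0 * exp (\<phi> s0)"
    proof (rule DERIV_nonneg_imp_nondecreasing[OF le])
      fix x assume "s \<le> x" "x \<le> s0"
      then have x: "x \<in> I" by (rule interval_segment_subset[OF I s s0(1)])
      have "((\<lambda>s. y s * exp (\<phi> s)) has_real_derivative
          (2 * (D x \<bullet> D' x) + 2 * c x * y x) * exp (\<phi> x)) (at x)"
        by (rule derivative_eq_intros y[OF x] \<phi>'[OF x] refl)+ (simp add: algebra_simps)
      moreover have "(2 * (D x \<bullet> D' x) + 2 * c x * y x) * exp (\<phi> x) \<ge> 0"
        using bd[OF x] by (simp add: zero_le_mult_iff)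
      ultimately show "\<exists>d. ((\<lambda>s. y s * exp (\<phi> s)) has_real_derivative d) (at x) \<and> 0 \<le> d" by blast
    qed
    then show ?thesis using s0(2) by (simp add: y_def mult_le_0_iff)
  qed
  then have "D s \<bullet> D s \<le> 0" unfolding y_def .
  then show ?thesis by (metis inner_eq_zero_iff inner_ge_zero order_antisym)
qed

lemma constant_of_zero_derivative:
  fixes D :: "real \<Rightarrow> 'a::real_inner"
  assumes I: "open_interval I" and D: "\<And>s. s \<in> I \<Longrightarrow> (D has_vector_derivative 0) (at s)"
    and s0: "s0 \<in> I" and s: "s \<in> I"
  shows "D s = D s0"
proof -
  have "D s - D s0 = 0"
  proof (rule linear_differential_inequality_zero[OF I, of "\<lambda>_. 0" "\<lambda>s. D s - D s0" "\<lambda>_. 0"])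
    fix u assume "u \<in> I"
    from has_vector_derivative_diff[OF D[OF this] has_vector_derivative_const[of "D s0"]]
    show "((\<lambda>s. D s - D s0) has_vector_derivative 0) (at u)" by simp
  qed (use s0 s in auto)
  then show ?thesis by simp
qed

lemma zero_derivative_of_constant_on:
  assumes "open I" "s \<in> I" "(f has_vector_derivative d) (at s)" "\<And>u. u \<in> I \<Longrightarrow> f u = c"
  shows "d = 0"
proof -
  have "(f has_vector_derivative 0) (at s)"
    by (rule has_vector_derivative_transform_within_open[OF has_vector_derivative_const[of c] assms(1,2)])
      (simp add: assms(4))
  then show ?thesis using assms(3) vector_derivative_unique_at by blast
qed

lemma translate_of_equal_derivative:
  fixes D :: "real \<Rightarrow> 'a::real_inner"
  assumes I: "open_interval I" and D: "\<And>s. s \<in> I \<Longrightarrow> (D has_vector_derivative d s) (at s)"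
    and E: "\<And>s. s \<in> I \<Longrightarrow> (E has_vector_derivative d s) (at s)" and s0: "s0 \<in> I" and s: "s \<in> I"
  shows "D s = (D s0 - E s0) + E s"
proof -
  have "D s - E s = D s0 - E s0"
    by (rule constant_of_zero_derivative[OF I _ s0 s])
      (use has_vector_derivative_diff[OF D E] in fastforce)
  then show ?thesis by (simp add: algebra_simps)
qed

section \<open>Minimality as an orthogonality relation between the generating curves\<close>

text \<open>The curvature binormal is \<open>\<kappa> b\<close> for a curve of arbitrary speed and, unlike \<open>b\<close>, is defined at
points of vanishing curvature as well. It is the angular velocity of the unit tangent per arc length.\<close>

definition unit_tangent :: "(real \<Rightarrow> real^3) \<Rightarrow> real \<Rightarrow> real^3" where
  "unit_tangent \<alpha> s = inverse (norm (vderiv \<alpha> s)) *\<^sub>R vderiv \<alpha> s"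

definition curvature_binormal :: "(real \<Rightarrow> real^3) \<Rightarrow> real \<Rightarrow> real^3" where
  "curvature_binormal \<alpha> s =
     (inverse (norm (vderiv \<alpha> s)))^3 *\<^sub>R cross3 (vderiv \<alpha> s) (vderiv (vderiv \<alpha>) s)"

lemma cross3_cross3_left: "cross3 (cross3 x y) z = (x \<bullet> z) *\<^sub>R y - (y \<bullet> z) *\<^sub>R x"
  by (subst cross_skew) (simp add: Lagrange inner_commute algebra_simps)

lemma unit_tangent_derivative:
  assumes I: "open I" and \<alpha>: "smooth_on I \<alpha>" and s: "s \<in> I" and nz: "vderiv \<alpha> s \<noteq> 0"
  shows "(unit_tangent \<alpha> has_vector_derivative
      norm (vderiv \<alpha> s) *\<^sub>R cross3 (curvature_binormal \<alpha> s) (unit_tangent \<alpha> s)) (at s)"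
proof -
  define a where "a = vderiv \<alpha> s"
  define b where "b = vderiv (vderiv \<alpha>) s"
  define v where "v = norm a"
  have v: "v > 0" "v * v = a \<bullet> a" using nz by (simp_all add: v_def a_def dot_square_norm power2_eq_square)
  have d: "(vderiv \<alpha> has_vector_derivative b) (at s)"
    unfolding b_def by (rule smooth_on_has_vderiv[OF smooth_on_vderiv[OF \<alpha>] s])
  have "((\<lambda>s. vderiv \<alpha> s \<bullet> vderiv \<alpha> s) has_real_derivative 2 * (a \<bullet> b)) (at s)"
    unfolding real_derivative_iff
    using bounded_bilinear.has_vector_derivative[OF bounded_bilinear_inner d d]
    by (simp add: a_def inner_commute)
  note square = this
  have "((\<lambda>s. norm (vderiv \<alpha> s)) has_real_derivative inverse v / 2 * (2 * (a \<bullet> b))) (at s)"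
    unfolding norm_eq_sqrt_inner v_def a_def
    by (rule DERIV_chain2[OF DERIV_real_sqrt square[unfolded a_def]]) (use nz in simp)
  then have "((\<lambda>s. inverse (norm (vderiv \<alpha> s))) has_real_derivative
      - (inverse v * (inverse v / 2 * (2 * (a \<bullet> b))) * inverse v)) (at s)"
    using DERIV_inverse'[of "\<lambda>s. norm (vderiv \<alpha> s)"] nz by (simp add: v_def a_def)
  from has_vector_derivative_scaleR[OF this d]
  have "(unit_tangent \<alpha> has_vector_derivative
      inverse v *\<^sub>R b + (- (inverse v * (inverse v / 2 * (2 * (a \<bullet> b))) * inverse v)) *\<^sub>R a) (at s)"
    unfolding unit_tangent_def v_def a_def by simp
  moreover have "inverse v *\<^sub>R b + (- (inverse v * (inverse v / 2 * (2 * (a \<bullet> b))) * inverse v)) *\<^sub>R a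
      = v *\<^sub>R cross3 (inverse v ^ 3 *\<^sub>R cross3 a b) (inverse v *\<^sub>R a)"
    using v by (simp add: cross_mult_left cross_mult_right cross3_cross3_left scaleR_diff_right
        inner_commute[of b a] flip: v(2)) (simp add: field_simps power3_eq_cube)
  ultimately show ?thesis unfolding curvature_binormal_def unit_tangent_def a_def b_def v_def by simp
qed

lemma translation_surface_partials:
  fixes \<alpha> \<beta> :: "real \<Rightarrow> real^3"
  assumes I: "open I" and J: "open J" and \<alpha>: "smooth_on I \<alpha>" and \<beta>: "smooth_on J \<beta>"
    and s: "s \<in> I" and t: "t \<in> J"
  defines "X \<equiv> translation_surface \<alpha> \<beta>"
  shows "partial1 X s t = vderiv \<alpha> s" "partial2 X s t = vderiv \<beta> t"
    "partial1 (partial1 X) s t = vderiv (vderiv \<alpha>) s"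
    "partial2 (partial1 X) s t = 0"
    "partial2 (partial2 X) s t = vderiv (vderiv \<beta>) t"
proof -
  have p1: "partial1 X u v = vderiv \<alpha> u" if "u \<in> I" for u v
    unfolding partial1_def X_def translation_surface_def
    by (rule vector_derivative_at) (use has_vector_derivative_add_const smooth_on_has_vderiv[OF \<alpha> that] in auto)
  have p2: "partial2 X u v = vderiv \<beta> v" if "v \<in> J" for u v
    unfolding partial2_def X_def translation_surface_def
    by (rule vector_derivative_at)
      (use has_vector_derivative_add[OF has_vector_derivative_const smooth_on_has_vderiv[OF \<beta> that]] in simp)
  show "partial1 X s t = vderiv \<alpha> s" "partial2 X s t = vderiv \<beta> t" using p1 p2 s t by auto
  have "((\<lambda>u. partial1 X u t) has_vector_derivative vderiv (vderiv \<alpha>) s) (at s)"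
    by (rule has_vector_derivative_transform_within_open[OF
          smooth_on_has_vderiv[OF smooth_on_vderiv[OF \<alpha>] s] I s]) (simp add: p1)
  then show "partial1 (partial1 X) s t = vderiv (vderiv \<alpha>) s"
    unfolding partial1_def[of "partial1 X"] by (rule vector_derivative_at)
  have "((\<lambda>v. partial2 X s v) has_vector_derivative vderiv (vderiv \<beta>) t) (at t)"
    by (rule has_vector_derivative_transform_within_open[OF
          smooth_on_has_vderiv[OF smooth_on_vderiv[OF \<beta>] t] J t]) (simp add: p2)
  then show "partial2 (partial2 X) s t = vderiv (vderiv \<beta>) t"
    unfolding partial2_def[of "partial2 X"] by (rule vector_derivative_at)
  show "partial2 (partial1 X) s t = 0"
  proof -
    have "partial1 X s = (\<lambda>v. vderiv \<alpha> s)" using p1[OF s] by blast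
    then show ?thesis unfolding partial2_def[of "partial1 X"] by simp
  qed
qed

text \<open>The mixed second derivative of \<open>\<alpha> s + \<beta> t\<close> vanishes, so the numerator of the mean curvature
reduces to two triple products, one per curve.\<close>

lemma minimal_iff_orthogonality:
  fixes \<alpha> \<beta> :: "real \<Rightarrow> real^3"
  assumes I: "open I" and J: "open J" and \<alpha>: "smooth_on I \<alpha>" and \<beta>: "smooth_on J \<beta>"
    and s: "s \<in> I" and t: "t \<in> J" and reg: "regular_at \<alpha> \<beta> s t"
  shows "mean_curvature (translation_surface \<alpha> \<beta>) s t = 0 \<longleftrightarrow>
    curvature_binormal \<alpha> s \<bullet> unit_tangent \<beta> t = unit_tangent \<alpha> s \<bullet> curvature_binormal \<beta> t"
proof -
  define a where "a = vderiv \<alpha> s"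
  define b where "b = vderiv \<beta> t"
  define a' where "a' = vderiv (vderiv \<alpha>) s"
  define b' where "b' = vderiv (vderiv \<beta>) t"
  define N where "N = cross3 a b"
  have N: "N \<noteq> 0" using reg unfolding regular_at_def N_def a_def b_def .
  then have nz: "a \<noteq> 0" "b \<noteq> 0" by (auto simp: N_def)
  then have pos: "norm a > 0" "norm b > 0" by auto
  have tri: "a' \<bullet> N = - (cross3 a a' \<bullet> b)" "b' \<bullet> N = a \<bullet> cross3 b b'"
    by (simp_all add: N_def cross3_simps)
  have area: "(a \<bullet> a) * (b \<bullet> b) - (a \<bullet> b)\<^sup>2 = (norm N)\<^sup>2"
    unfolding N_def norm_cross by (simp add: dot_square_norm)
  have "mean_curvature (translation_surface \<alpha> \<beta>) s t =
    ((norm b)\<^sup>2 * (a' \<bullet> N) + (norm a)\<^sup>2 * (b' \<bullet> N)) / (norm N * (2 * (norm N)\<^sup>2))"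
    unfolding mean_curvature_def Let_def unit_normal_def translation_surface_partials[OF I J \<alpha> \<beta> s t]
      a_def[symmetric] b_def[symmetric] a'_def[symmetric] b'_def[symmetric] N_def[symmetric] area
    using N by (simp add: sgn_div_norm dot_square_norm divide_simps)
  then have "mean_curvature (translation_surface \<alpha> \<beta>) s t = 0 \<longleftrightarrow>
    (norm b)\<^sup>2 * (a' \<bullet> N) + (norm a)\<^sup>2 * (b' \<bullet> N) = 0" using N by simp
  also have "\<dots> \<longleftrightarrow> (norm b)\<^sup>2 * (cross3 a a' \<bullet> b) = (norm a)\<^sup>2 * (a \<bullet> cross3 b b')"
    unfolding tri by auto
  also have "\<dots> \<longleftrightarrow> curvature_binormal \<alpha> s \<bullet> unit_tangent \<beta> t = unit_tangent \<alpha> s \<bullet> curvature_binormal \<beta> t"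
    unfolding curvature_binormal_def unit_tangent_def
      a_def[symmetric] b_def[symmetric] a'_def[symmetric] b'_def[symmetric]
    using pos by (simp add: field_simps power2_eq_square power3_eq_cube)
  finally show ?thesis .
qed

section \<open>Unit directions turning in space\<close>

text \<open>A unit vector \<open>T\<close> with angular velocity \<open>v K\<close>, where \<open>K\<close> is orthogonal to \<open>T\<close>. For a curve,
\<open>T\<close> is the unit tangent, \<open>K\<close> the curvature binormal and \<open>v\<close> the speed. The factor \<open>v\<close> may have any
sign, so that reversing a curve stays within the notion.\<close>

definition turning_direction ::
  "real set \<Rightarrow> (real \<Rightarrow> real) \<Rightarrow> (real \<Rightarrow> real^3) \<Rightarrow> (real \<Rightarrow> real^3) \<Rightarrow> bool" where
  "turning_direction I v T K \<longleftrightarrow> open_interval I \<and> continuous_on I v \<and>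
     (\<forall>s\<in>I. norm (T s) = 1 \<and> K s \<bullet> T s = 0 \<and>
        (T has_vector_derivative v s *\<^sub>R cross3 (K s) (T s)) (at s))"

definition full_direction :: "real set \<Rightarrow> (real \<Rightarrow> real^3) \<Rightarrow> bool" where
  "full_direction I T \<longleftrightarrow> (\<forall>q. (\<forall>s\<in>I. q \<bullet> T s = 0) \<longrightarrow> q = 0)"

lemma turning_directionD:
  assumes "turning_direction I v T K"
  shows "open_interval I" "open I" "continuous_on I v" "s \<in> I \<Longrightarrow> norm (T s) = 1" "s \<in> I \<Longrightarrow> T s \<bullet> T s = 1"
    "s \<in> I \<Longrightarrow> K s \<bullet> T s = 0"
    "s \<in> I \<Longrightarrow> (T has_vector_derivative v s *\<^sub>R cross3 (K s) (T s)) (at s)"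
    "continuous_on I T"
proof -
  show *: "s \<in> I \<Longrightarrow> (T has_vector_derivative v s *\<^sub>R cross3 (K s) (T s)) (at s)" for s
    using assms unfolding turning_direction_def by blast
  show "continuous_on I T"
    by (rule continuous_at_imp_continuous_on) (use has_vector_derivative_continuous[OF *] in blast)
qed (use assms in \<open>auto simp: turning_direction_def open_interval_def dot_square_norm\<close>)

lemma turning_direction_of_curve:
  assumes I: "open_interval I" and \<alpha>: "smooth_on I \<alpha>" and nz: "\<And>s. s \<in> I \<Longrightarrow> vderiv \<alpha> s \<noteq> 0"
  shows "turning_direction I (\<lambda>s. norm (vderiv \<alpha> s)) (unit_tangent \<alpha>) (curvature_binormal \<alpha>)"
  unfolding turning_direction_def
proof (intro conjI ballI)
  have op: "open I" using I by (simp add: open_interval_def)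
  show "continuous_on I (\<lambda>s. norm (vderiv \<alpha> s))"
    by (intro continuous_on_norm smooth_on_continuous smooth_on_vderiv \<alpha>)
  fix s assume s: "s \<in> I"
  show "norm (unit_tangent \<alpha> s) = 1" using nz[OF s] by (simp add: unit_tangent_def)
  show "curvature_binormal \<alpha> s \<bullet> unit_tangent \<alpha> s = 0"
    by (simp add: unit_tangent_def curvature_binormal_def dot_cross_self)
  show "(unit_tangent \<alpha> has_vector_derivative
      norm (vderiv \<alpha> s) *\<^sub>R cross3 (curvature_binormal \<alpha> s) (unit_tangent \<alpha> s)) (at s)"
    by (rule unit_tangent_derivative[OF op \<alpha> s nz[OF s]])
qed (rule I)

lemma full_direction_of_nonplanar:
  assumes I: "open_interval I" and \<alpha>: "smooth_on I \<alpha>" and nz: "\<And>s. s \<in> I \<Longrightarrow> vderiv \<alpha> s \<noteq> 0"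
    and np: "\<not> plane_curve I \<alpha>"
  shows "full_direction I (unit_tangent \<alpha>)"
  unfolding full_direction_def
proof (intro allI impI, rule ccontr)
  fix q assume q: "\<forall>s\<in>I. q \<bullet> unit_tangent \<alpha> s = 0" "q \<noteq> 0"
  obtain s0 where s0: "s0 \<in> I" using I by (auto simp: open_interval_def)
  have "q \<bullet> \<alpha> s = q \<bullet> \<alpha> s0" if "s \<in> I" for s
  proof (rule constant_of_zero_derivative[OF I _ s0 that])
    fix u assume u: "u \<in> I"
    have "q \<bullet> vderiv \<alpha> u = 0" using bspec[OF q(1) u] nz[OF u] by (simp add: unit_tangent_def)
    then show "((\<lambda>s. q \<bullet> \<alpha> s) has_vector_derivative 0) (at u)"
      using inner_right_derivative[OF smooth_on_has_vderiv[OF \<alpha> u], of q] by simp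
  qed
  then show False using np q(2) unfolding plane_curve_def by blast
qed

text \<open>The component of \<open>T\<close> along \<open>q\<close> satisfies a homogeneous linear differential inequality, so it
vanishes identically as soon as it vanishes once. This is the device by which a curve is shown to be
planar without assuming analyticity.\<close>

lemma not_full_if_invariant_plane:
  assumes T: "turning_direction I v T K" and c: "continuous_on I c"
    and q: "q \<noteq> 0" and s0: "s0 \<in> I" "q \<bullet> T s0 = 0"
    and bound: "\<And>s. s \<in> I \<Longrightarrow> \<bar>q \<bullet> cross3 (K s) (T s)\<bar> \<le> c s * \<bar>q \<bullet> T s\<bar>"
  shows "\<not> full_direction I T"
proof -
  note T' = turning_directionD[OF T]
  have "q \<bullet> T s = 0" if s: "s \<in> I" for s
  proof (rule linear_differential_inequality_zero[OF T'(1), of "\<lambda>s. \<bar>v s\<bar> * c s" "\<lambda>s. q \<bullet> T s"])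
    show "continuous_on I (\<lambda>s. \<bar>v s\<bar> * c s)" by (intro continuous_intros T'(3) c)
    fix s assume s: "s \<in> I"
    show "((\<lambda>s. q \<bullet> T s) has_vector_derivative q \<bullet> (v s *\<^sub>R cross3 (K s) (T s))) (at s)"
      by (rule inner_right_derivative[OF T'(7)[OF s]])
    show "norm (q \<bullet> (v s *\<^sub>R cross3 (K s) (T s))) \<le> \<bar>v s\<bar> * c s * norm (q \<bullet> T s)"
      using mult_left_mono[OF bound[OF s], of "\<bar>v s\<bar>"] by (simp add: abs_mult mult.assoc)
  qed (use s s0 in auto)
  then show ?thesis using q unfolding full_direction_def by blast
qed

lemma nonzero_orthogonal_to_two:
  obtains q :: "real^3" where "q \<noteq> 0" "q \<bullet> a = 0" "q \<bullet> b = 0"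
proof -
  have "dim {a, b} \<le> card {a, b}" by (rule dim_le_card) (auto simp: span_base)
  also have "\<dots> \<le> 2" by (simp add: card_insert_if)
  finally have "dim {a, b} < DIM(real^3)" by simp
  then obtain q where q: "q \<noteq> 0" "\<And>y. y \<in> span {a, b} \<Longrightarrow> orthogonal q y"
    using orthogonal_to_subspace_exists by blast
  show ?thesis by (rule that[of q]) (use q in \<open>auto simp: orthogonal_def span_base\<close>)
qed

text \<open>The case in which the other generating curve is a straight line in direction \<open>u\<close>: then \<open>K\<close> is a
multiple of \<open>T \<times> u\<close>, so \<open>T\<close> turns inside the plane spanned by \<open>T\<close> and \<open>u\<close>, which
is therefore constant.\<close>

lemma not_full_if_binormal_orthogonal_to_line:
  assumes T: "turning_direction I v T K" and K: "continuous_on I K"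
    and u: "\<And>s. s \<in> I \<Longrightarrow> K s \<bullet> u = 0" and reg: "\<And>s. s \<in> I \<Longrightarrow> cross3 (T s) u \<noteq> 0"
  shows "\<not> full_direction I T"
proof -
  note T' = turning_directionD[OF T]
  obtain s0 where s0: "s0 \<in> I" using T'(1) by (auto simp: open_interval_def)
  define q where "q = cross3 (T s0) u"
  define w where "w = (\<lambda>s. cross3 (T s) u)"
  define k where "k = (\<lambda>s. K s \<bullet> w s / (w s \<bullet> w s))"
  have w: "continuous_on I w" unfolding w_def by (intro continuous_on_cross T'(8) continuous_on_const)
  have wnz: "w s \<noteq> 0" if "s \<in> I" for s using reg[OF that] by (simp add: w_def)
  have Kw: "K s = k s *\<^sub>R w s" if s: "s \<in> I" for s
  proof -
    have "cross3 (K s) (w s) = 0" unfolding w_def Lagrange using u[OF s] T'(6)[OF s] by simp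
    then have "cross3 (w s) (cross3 (K s) (w s)) = 0" by simp
    then have "(w s \<bullet> w s) *\<^sub>R K s = (K s \<bullet> w s) *\<^sub>R w s" unfolding Lagrange by (simp add: inner_commute)
    then have "(1 / (w s \<bullet> w s)) *\<^sub>R ((w s \<bullet> w s) *\<^sub>R K s) = (1 / (w s \<bullet> w s)) *\<^sub>R ((K s \<bullet> w s) *\<^sub>R w s)" by simp
    then show ?thesis using wnz[OF s] by (simp add: k_def)
  qed
  show ?thesis
  proof (rule not_full_if_invariant_plane[OF T _ _ s0, of "\<lambda>s. \<bar>k s\<bar> * \<bar>T s \<bullet> u\<bar>" q])
    show "continuous_on I (\<lambda>s. \<bar>k s\<bar> * \<bar>T s \<bullet> u\<bar>)"
      unfolding k_def by (intro continuous_intros K w T'(8)) (use wnz in auto)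
    show "q \<noteq> 0" using reg[OF s0] by (simp add: q_def)
    show "q \<bullet> T s0 = 0" by (simp add: q_def dot_cross_self)
    fix s assume s: "s \<in> I"
    have "q \<bullet> u = 0" by (simp add: q_def dot_cross_self)
    then have "q \<bullet> cross3 (K s) (T s) = - (k s * ((T s \<bullet> u) * (q \<bullet> T s)))"
      unfolding Kw[OF s] unfolding w_def
      by (simp add: cross_mult_left cross3_cross3_left inner_diff_right T'(5)[OF s] inner_commute[of u])
    then show "\<bar>q \<bullet> cross3 (K s) (T s)\<bar> \<le> \<bar>k s\<bar> * \<bar>T s \<bullet> u\<bar> * \<bar>q \<bullet> T s\<bar>"
      by (simp add: abs_mult)
  qed
qed

lemma orthogonal_to_basis_zero:
  fixes x :: "real^3"
  assumes "cross3 a b \<noteq> 0" "x \<bullet> a = 0" "x \<bullet> b = 0" "x \<bullet> cross3 a b = 0"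
  shows "x = 0"
  using assms norm_and_cross_eq_0[of x "cross3 a b"] by (simp add: Lagrange)

lemma orthonormal_expansion:
  fixes a b c x :: "real^3"
  assumes o: "a \<bullet> a = 1" "b \<bullet> b = 1" "c \<bullet> c = 1" "a \<bullet> b = 0" "a \<bullet> c = 0" "b \<bullet> c = 0"
  shows "x = (a \<bullet> x) *\<^sub>R a + (b \<bullet> x) *\<^sub>R b + (c \<bullet> x) *\<^sub>R c"
    and "cross3 a b = (c \<bullet> cross3 a b) *\<^sub>R c"
proof -
  have "cross3 a b \<bullet> cross3 a b = 1" unfolding dot_cross using o by (simp add: inner_commute)
  then have nz: "cross3 a b \<noteq> 0" by auto
  have "cross3 c (cross3 c (cross3 a b)) = 0" unfolding Lagrange[of c a b] using o by (simp add: inner_commute)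
  then show cr: "cross3 a b = (c \<bullet> cross3 a b) *\<^sub>R c" unfolding Lagrange[of c c] using o by simp
  define y where "y = x - ((a \<bullet> x) *\<^sub>R a + (b \<bullet> x) *\<^sub>R b + (c \<bullet> x) *\<^sub>R c)"
  have y: "y \<bullet> a = 0" "y \<bullet> b = 0" "y \<bullet> c = 0"
    unfolding y_def using o by (simp_all add: inner_diff_left inner_add_left inner_commute[of x]
        inner_commute[of b a] inner_commute[of c a] inner_commute[of c b])
  have "y \<bullet> cross3 a b = 0" by (subst cr) (simp add: y)
  from orthogonal_to_basis_zero[OF nz y(1,2) this]
  show "x = (a \<bullet> x) *\<^sub>R a + (b \<bullet> x) *\<^sub>R b + (c \<bullet> x) *\<^sub>R c" by (simp add: y_def)
qed

text \<open>The case in which the other generating curve is a bent plane curve, with two independent tangents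
\<open>a\<close> and \<open>b\<close>. The two equations determine \<open>K\<close> up to its component along \<open>n = a \<times> b\<close>.
If \<open>T\<close> is orthogonal to \<open>n\<close> once, it is so forever. Otherwise \<open>K\<close> being orthogonal to \<open>T\<close> forces
\<open>K = T \<times> p\<close> with a constant vector \<open>p\<close>, and \<open>T\<close> moves along a great circle towards \<open>p\<close>.\<close>

lemma not_full_if_binormal_along_plane:
  assumes T: "turning_direction I v T K"
    and n: "cross3 a b \<noteq> 0"
    and a: "\<And>s. s \<in> I \<Longrightarrow> K s \<bullet> a = l * (T s \<bullet> cross3 a b)"
    and b: "\<And>s. s \<in> I \<Longrightarrow> K s \<bullet> b = m * (T s \<bullet> cross3 a b)"
  shows "\<not> full_direction I T"
proof -
  note T' = turning_directionD[OF T]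
  define n where "n = cross3 a b"
  have n0: "n \<noteq> 0" "n \<bullet> n > 0" "n \<bullet> n \<noteq> 0" using n by (auto simp: n_def)
  have na: "n \<bullet> a = 0" "n \<bullet> b = 0"
    by (simp_all add: n_def dot_cross_self)
  \<comment> \<open>the vector of the plane of \<open>a\<close> and \<open>b\<close> with inner products \<open>l\<close> and \<open>m\<close> against them\<close>
  define k where "k = (1 / (n \<bullet> n)) *\<^sub>R (l *\<^sub>R cross3 b n + m *\<^sub>R cross3 n a)"
  have "cross3 b n \<bullet> a = n \<bullet> n" "cross3 b n \<bullet> b = 0" "cross3 n a \<bullet> a = 0" "cross3 n a \<bullet> b = n \<bullet> n"
    by (simp_all add: n_def cross3_simps)
  then have k: "k \<bullet> a = l" "k \<bullet> b = m" "k \<bullet> n = 0"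
    using n0 by (auto simp: k_def inner_add_left dot_cross_self)
  define \<mu> where "\<mu> = (\<lambda>s. K s \<bullet> n / (n \<bullet> n))"
  have K: "K s = (T s \<bullet> n) *\<^sub>R k + \<mu> s *\<^sub>R n" if s: "s \<in> I" for s
  proof -
    have "K s - (T s \<bullet> n) *\<^sub>R k - \<mu> s *\<^sub>R n = 0"
      by (rule orthogonal_to_basis_zero[OF n])
        (use a[OF s] b[OF s] k na n0 in
          \<open>simp_all add: inner_diff_left n_def[symmetric] \<mu>_def\<close>)
    then show ?thesis by (simp add: algebra_simps)
  qed
  have nK: "n \<bullet> cross3 (K s) (T s) = (T s \<bullet> n) * (n \<bullet> cross3 k (T s))" if s: "s \<in> I" for s
    unfolding K[OF s] by (simp add: cross_add_left cross_mult_left inner_add_right dot_cross_self)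
  show ?thesis
  proof (cases "\<exists>s\<in>I. T s \<bullet> n = 0")
    case True
    then obtain s0 where s0: "s0 \<in> I" "n \<bullet> T s0 = 0" by (auto simp: inner_commute)
    show ?thesis
      by (rule not_full_if_invariant_plane[OF T _ n0(1) s0, of "\<lambda>s. \<bar>n \<bullet> cross3 k (T s)\<bar>"])
        (auto intro!: continuous_intros continuous_on_cross T'(8) simp: nK abs_mult inner_commute)
  next
    case False
    obtain s0 where s0: "s0 \<in> I" using T'(1) by (auto simp: open_interval_def)
    define p where "p = cross3 k n"
    obtain q where q: "q \<noteq> 0" "q \<bullet> T s0 = 0" "q \<bullet> p = 0" by (rule nonzero_orthogonal_to_two)
    have KT: "q \<bullet> cross3 (K s) (T s) = - ((T s \<bullet> p) * (q \<bullet> T s))" if s: "s \<in> I" for s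
    proof -
      have "(T s \<bullet> n) * (k \<bullet> T s) + \<mu> s * (n \<bullet> T s) = 0"
        using T'(6)[OF s] unfolding K[OF s] by (simp add: inner_add_left)
      then have "(T s \<bullet> n) * (k \<bullet> T s + \<mu> s) = 0" by (simp add: inner_commute[of n] algebra_simps)
      then have "\<mu> s = - (T s \<bullet> k)" using False s by (simp add: inner_commute)
      then have "K s = cross3 (T s) p" unfolding K[OF s] p_def Lagrange by simp
      then show ?thesis
        using q(3) by (simp add: cross3_cross3_left inner_diff_right T'(5)[OF s] inner_commute[of p])
    qed
    show ?thesis
      by (rule not_full_if_invariant_plane[OF T _ q(1) s0 q(2), of "\<lambda>s. \<bar>T s \<bullet> p\<bar>"])
        (auto intro!: continuous_intros T'(8) simp: KT abs_mult)
  qed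
qed

lemma full_direction_nonparallel:
  assumes "full_direction I T" "e \<noteq> 0"
  obtains s where "s \<in> I" "cross3 e (T s) \<noteq> 0"
proof -
  obtain q where q: "q \<noteq> 0" "q \<bullet> e = 0" "q \<bullet> e = 0" by (rule nonzero_orthogonal_to_two)
  obtain s where s: "s \<in> I" "q \<bullet> T s \<noteq> 0" using assms(1) q(1) unfolding full_direction_def by blast
  have "cross3 e (T s) \<noteq> 0"
  proof
    assume "cross3 e (T s) = 0"
    then have "cross3 q (cross3 e (T s)) = 0" by simp
    then have "(q \<bullet> T s) *\<^sub>R e = 0" unfolding Lagrange using q by simp
    then show False using s assms(2) by simp
  qed
  then show ?thesis using that s by blast
qed

text \<open>Take \<open>q = e \<times> T\<close> at one parameter. The operator maps the plane orthogonal to \<open>q\<close>, which is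
spanned by \<open>e\<close> and that \<open>T\<close>, into the line of \<open>q\<close>: its values there are orthogonal to \<open>e\<close> because
the transposed operator kills \<open>e\<close>, and to \<open>T\<close> because \<open>T\<close> is isotropic. Hence the rate of change
of \<open>q \<bullet> T\<close> is a multiple of \<open>q \<bullet> T\<close>.\<close>

lemma not_full_if_common_kernel:
  fixes M :: "real^3^3"
  assumes T: "turning_direction I v T (\<lambda>s. M *v T s)"
    and e: "e \<noteq> 0" "M *v e = 0" "transpose M *v e = 0"
  shows "\<not> full_direction I T"
proof
  assume full: "full_direction I T"
  note T' = turning_directionD[OF T]
  obtain s0 where s0: "s0 \<in> I" "cross3 e (T s0) \<noteq> 0" by (rule full_direction_nonparallel[OF full e(1)])
  define q where "q = cross3 e (T s0)"
  have q: "q \<noteq> 0" "q \<bullet> T s0 = 0" "q \<bullet> e = 0" "q \<bullet> q > 0"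
    using s0 by (auto simp: q_def dot_cross_self)
  have adj: "(M *v x) \<bullet> y = x \<bullet> (transpose M *v y)" for x y
    by (metis dot_lmul_matrix inner_commute transpose_transpose vector_transpose_matrix)
  have "(transpose M *v T s0) \<bullet> e = 0" "(transpose M *v T s0) \<bullet> T s0 = 0"
    using adj[of e "T s0"] adj[of "T s0" "T s0"] T'(6)[OF s0(1)] e(2)
    by (simp_all add: inner_commute del: transpose_matrix_vector)
  then have "cross3 (transpose M *v T s0) q = 0" unfolding q_def Lagrange by simp
  then have "cross3 q (cross3 (transpose M *v T s0) q) = 0" by simp
  then have MtT: "(q \<bullet> q) *\<^sub>R (transpose M *v T s0) = (q \<bullet> (transpose M *v T s0)) *\<^sub>R q"
    unfolding Lagrange by simp
  have Mq: "q \<bullet> cross3 (M *v T s) (T s) = (q \<bullet> T s) * ((q \<bullet> cross3 (M *v q) (T s)) / (q \<bullet> q))"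
    if s: "s \<in> I" for s
  proof -
    define r where "r = (q \<bullet> T s) / (q \<bullet> q)"
    define y where "y = T s - r *\<^sub>R q"
    have yq: "y \<bullet> q = 0" using q(4) by (simp add: y_def r_def inner_diff_left inner_commute[of q "T s"])
    have Ty: "T s = y + r *\<^sub>R q" by (simp add: y_def)
    have "(q \<bullet> q) * ((M *v y) \<bullet> T s0) = y \<bullet> ((q \<bullet> q) *\<^sub>R (transpose M *v T s0))" by (simp add: adj)
    also have "\<dots> = 0" unfolding MtT using yq by simp
    finally have "(M *v y) \<bullet> T s0 = 0" using q(4) by simp
    moreover have "(M *v y) \<bullet> e = 0" unfolding adj e(3) by simp
    ultimately have par: "cross3 (M *v y) q = 0" unfolding q_def Lagrange by simp
    have "q \<bullet> cross3 (M *v y) z = - (cross3 (M *v y) q \<bullet> z)" for z by (simp add: cross3_simps)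
    then have z: "q \<bullet> cross3 (M *v y) (T s) = 0" using par by simp
    have MT: "M *v T s = M *v y + r *\<^sub>R (M *v q)"
      by (subst Ty) (simp only: matrix_vector_right_distrib matrix_vector_mult_scaleR)
    have "q \<bullet> cross3 (M *v T s) (T s) = r * (q \<bullet> cross3 (M *v q) (T s))"
      unfolding MT by (simp add: cross_add_left cross_mult_left inner_add_right z)
    then show ?thesis by (simp add: r_def)
  qed
  have "\<not> full_direction I T"
  proof (rule not_full_if_invariant_plane[OF T _ q(1) s0(1) q(2)])
    show "continuous_on I (\<lambda>s. \<bar>(q \<bullet> cross3 (M *v q) (T s)) / (q \<bullet> q)\<bar>)"
      by (intro continuous_intros continuous_on_cross T'(8)) (use q in auto)
  qed (simp add: Mq abs_mult mult.commute)
  then show False using full by blast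
qed

text \<open>The skew part of \<open>M\<close> is \<open>x \<mapsto> a \<times> x\<close> up to a factor. Differentiating the relation
\<open>M T \<bullet> T = 0\<close> gives \<open>M T \<bullet> a = 0\<close>, so the transposed operator kills \<open>a\<close>, and then so does \<open>M\<close>.
A nonzero \<open>a\<close>, and after that any nonzero kernel vector of the symmetric \<open>M\<close>, would be a common
kernel vector of both.\<close>

lemma turning_operator_symmetric_injective:
  fixes M :: "real^3^3"
  assumes T: "turning_direction I v T (\<lambda>s. M *v T s)" and v: "\<And>s. s \<in> I \<Longrightarrow> v s \<noteq> 0"
    and full: "full_direction I T"
  shows "transpose M = M" and "\<And>x. M *v x = 0 \<Longrightarrow> x = 0"
proof -
  note T' = turning_directionD[OF T]
  have adj: "(M *v x) \<bullet> y = x \<bullet> (transpose M *v y)" for x y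
    by (metis dot_lmul_matrix inner_commute transpose_transpose vector_transpose_matrix)
  define a :: "real^3" where "a = vector [M$3$2 - M$2$3, M$1$3 - M$3$1, M$2$1 - M$1$2]"
  have a: "M *v x - transpose M *v x = cross3 a x" for x
    by (simp add: a_def vec_eq_iff forall_3 cross_components matrix_vector_mult_def sum_3 transpose_def algebra_simps)
  have Ma: "(transpose M *v a) = 0"
  proof -
    have "(transpose M *v a) \<bullet> T s = 0" if s: "s \<in> I" for s
    proof -
      have op: "open I" by (rule T'(2))
      have d: "(T has_vector_derivative v s *\<^sub>R cross3 (M *v T s) (T s)) (at s)" by (rule T'(7)[OF s])
      have dM: "((\<lambda>s. M *v T s) has_vector_derivative M *v (v s *\<^sub>R cross3 (M *v T s) (T s))) (at s)"
        by (rule bounded_linear.has_vector_derivative[OF matrix_vector_mul_bounded_linear d])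
      have "(M *v T s) \<bullet> (v s *\<^sub>R cross3 (M *v T s) (T s)) +
          (M *v (v s *\<^sub>R cross3 (M *v T s) (T s))) \<bullet> T s = 0"
        by (rule zero_derivative_of_constant_on[OF op s
              bounded_bilinear.has_vector_derivative[OF bounded_bilinear_inner dM d] T'(6)])
      then have "v s * (cross3 (M *v T s) (T s) \<bullet> (transpose M *v T s)) = 0"
        unfolding adj[of "v s *\<^sub>R _"] by (simp add: dot_cross_self del: transpose_matrix_vector)
      then have "cross3 (M *v T s) (T s) \<bullet> (transpose M *v T s) = 0" using v[OF s] by simp
      moreover have "transpose M *v T s = M *v T s - cross3 a (T s)" using a[of "T s"] by (simp add: algebra_simps)
      ultimately have "cross3 (M *v T s) (T s) \<bullet> cross3 a (T s) = 0"
        by (simp add: inner_diff_right dot_cross_self inner_commute[of "cross3 (M *v T s) (T s)" "M *v T s"])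
      then have "(M *v T s) \<bullet> a = 0"
        unfolding dot_cross by (simp add: T'(5)[OF s] T'(6)[OF s])
      then show ?thesis using adj[of "T s" a] by (simp only: inner_commute)
    qed
    then show ?thesis using full unfolding full_direction_def by blast
  qed
  have "a = 0"
  proof (rule ccontr)
    assume "a \<noteq> 0"
    moreover have "M *v a = 0" using a[of a] Ma by simp
    ultimately show False using not_full_if_common_kernel[OF T _ _ Ma] full by blast
  qed
  then have "M *v x = transpose M *v x" for x using a[of x] by simp
  then show sym: "transpose M = M" by (metis matrix_eq)
  fix x assume "M *v x = 0"
  then show "x = 0" using not_full_if_common_kernel[OF T, of x] full sym by auto
qed

section \<open>The common operator of the two generating curves\<close>

text \<open>Every coordinate vector is a linear combination of values of \<open>T\<close>, and the relation expresses the
inner product of \<open>L t\<close> with a value of \<open>T\<close> linearly in \<open>U t\<close>.\<close>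

lemma linear_relation_of_full_direction:
  fixes T :: "'a \<Rightarrow> real^3"
  assumes full: "\<And>q. (\<And>s. s \<in> I \<Longrightarrow> q \<bullet> T s = 0) \<Longrightarrow> q = 0"
    and rel: "\<And>s t. s \<in> I \<Longrightarrow> t \<in> J \<Longrightarrow> K s \<bullet> U t = T s \<bullet> L t"
  obtains N :: "real^3^3" where "\<And>t. t \<in> J \<Longrightarrow> L t = N *v U t"
proof -
  have "span (T ` I) = UNIV"
  proof (rule ccontr)
    assume "span (T ` I) \<noteq> UNIV"
    then have "dim (T ` I) < DIM(real^3)" by (metis dim_eq_full dim_subset_UNIV nat_less_le)
    then obtain q where "q \<noteq> 0" "\<And>y. y \<in> span (T ` I) \<Longrightarrow> orthogonal q y"
      using orthogonal_to_subspace_exists by blast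
    then show False using full[of q] by (auto simp: orthogonal_def span_base)
  qed
  then have "\<forall>i. \<exists>r. \<forall>t\<in>J. axis i 1 \<bullet> L t = r \<bullet> U t"
  proof -
    have "\<exists>r. \<forall>t\<in>J. x \<bullet> L t = r \<bullet> U t" if "x \<in> span (T ` I)" for x
      using that
    proof (induction rule: span_induct_alt)
      case base
      show ?case by (rule exI[of _ 0]) simp
    next
      case (step c x y)
      then obtain s r where "s \<in> I" "x = T s" "\<forall>t\<in>J. y \<bullet> L t = r \<bullet> U t" by blast
      then show ?case by (intro exI[of _ "c *\<^sub>R K s + r"]) (simp add: inner_add_left rel)
    qed
    then show ?thesis using \<open>span (T ` I) = UNIV\<close> by simp
  qed
  then obtain r where r: "\<And>i t. t \<in> J \<Longrightarrow> axis i 1 \<bullet> L t = r i \<bullet> U t" by metis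
  have "L t = (\<chi> i. r i) *v U t" if "t \<in> J" for t
    using r[OF that] by (simp add: vec_eq_iff inner_axis' matrix_vector_mul_component)
  then show ?thesis by (rule that)
qed

text \<open>A minimal translation surface with one planar generating curve is of planar type. If \<open>U\<close> stays
orthogonal to \<open>n\<close>, then \<open>L\<close> is parallel to \<open>n\<close>; it either vanishes identically or not, and these
are the two planar cases excluded above.\<close>

lemma full_direction_of_partner:
  assumes T: "turning_direction I v T K" and K: "continuous_on I K"
    and U: "turning_direction J w U L" and w: "\<And>t. t \<in> J \<Longrightarrow> w t \<noteq> 0"
    and rel: "\<And>s t. s \<in> I \<Longrightarrow> t \<in> J \<Longrightarrow> K s \<bullet> U t = T s \<bullet> L t"
    and reg: "\<And>s t. s \<in> I \<Longrightarrow> t \<in> J \<Longrightarrow> cross3 (T s) (U t) \<noteq> 0"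
    and full: "full_direction I T"
  shows "full_direction J U"
proof (rule ccontr)
  note U' = turning_directionD[OF U]
  assume "\<not> full_direction J U"
  then obtain n where n: "n \<noteq> 0" "\<And>t. t \<in> J \<Longrightarrow> n \<bullet> U t = 0" unfolding full_direction_def by blast
  have Ln: "cross3 (L t) n = 0" if t: "t \<in> J" for t
  proof -
    have "n \<bullet> (w t *\<^sub>R cross3 (L t) (U t)) = 0"
      by (rule zero_derivative_of_constant_on[OF U'(2) t inner_right_derivative[OF U'(7)[OF t]] n(2)])
    then have "n \<bullet> cross3 (L t) (U t) = 0" using w[OF t] by simp
    then have "L t \<bullet> cross3 (U t) n = 0" by (simp add: cross3_simps)
    then have "cross3 (L t) (cross3 (U t) (cross3 (U t) n)) = 0"
      unfolding Lagrange[of "L t"] using U'(6)[OF t] by simp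
    moreover have "cross3 (U t) (cross3 (U t) n) = - n"
      unfolding Lagrange using n(2)[OF t] U'(5)[OF t] by (simp add: inner_commute)
    ultimately show ?thesis by simp
  qed
  have LU: "L t \<bullet> U t' = 0" if t: "t \<in> J" and t': "t' \<in> J" for t t'
  proof -
    have "cross3 n (cross3 (L t) n) = 0" using Ln[OF t] by simp
    then have "(n \<bullet> n) *\<^sub>R L t = (n \<bullet> L t) *\<^sub>R n" unfolding Lagrange by simp
    then have "(n \<bullet> n) *\<^sub>R L t \<bullet> U t' = (n \<bullet> L t) *\<^sub>R n \<bullet> U t'" by simp
    then show ?thesis using n t' by simp
  qed
  show False
  proof (cases "\<exists>t\<in>J. L t \<noteq> 0")
    case False
    obtain t0 where t0: "t0 \<in> J" using U'(1) by (auto simp: open_interval_def)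
    have "\<not> full_direction I T"
      by (rule not_full_if_binormal_orthogonal_to_line[OF T K, of "U t0"])
        (use rel reg t0 False in auto)
    then show False using full by blast
  next
    case True
    then obtain t0 where t0: "t0 \<in> J" "L t0 \<noteq> 0" by blast
    have "\<exists>t1\<in>J. cross3 (U t0) (U t1) \<noteq> 0"
    proof (rule ccontr)
      assume "\<not> (\<exists>t1\<in>J. cross3 (U t0) (U t1) \<noteq> 0)"
      then have z: "\<And>t. t \<in> J \<Longrightarrow> cross3 (U t0) (U t) = 0" by blast
      have bl: "bounded_linear (cross3 (U t0))"
        using bilinear_cross by (simp add: bilinear_def linear_conv_bounded_linear)
      have "cross3 (U t0) (w t0 *\<^sub>R cross3 (L t0) (U t0)) = 0"
        by (rule zero_derivative_of_constant_on[OF U'(2) t0(1)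
              bounded_linear.has_vector_derivative[OF bl U'(7)[OF t0(1)]] z])
      then have "w t0 *\<^sub>R L t0 = 0"
        by (simp add: cross_mult_right Lagrange U'(5)[OF t0(1)] LU[OF t0(1) t0(1)] inner_commute[of "U t0" "L t0"])
      then show False using w[OF t0(1)] t0 by simp
    qed
    then obtain t1 where t1: "t1 \<in> J" "cross3 (U t0) (U t1) \<noteq> 0" by blast
    define m where "m = cross3 (U t0) (U t1)"
    have along: "\<exists>l. \<forall>s\<in>I. K s \<bullet> U t = l * (T s \<bullet> m)" if t: "t \<in> J" for t
    proof -
      have "cross3 (L t) m = 0" unfolding m_def Lagrange using LU t t0 t1 by simp
      then have "cross3 m (cross3 (L t) m) = 0" by simp
      then have e: "(m \<bullet> m) *\<^sub>R L t = (m \<bullet> L t) *\<^sub>R m" unfolding Lagrange by simp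
      have mm: "m \<bullet> m \<noteq> 0" using t1 by (simp add: m_def)
      have "K s \<bullet> U t = (m \<bullet> L t) / (m \<bullet> m) * (T s \<bullet> m)" if s: "s \<in> I" for s
      proof -
        have "(m \<bullet> m) * (K s \<bullet> U t) = T s \<bullet> ((m \<bullet> m) *\<^sub>R L t)" using rel[OF s t] by simp
        also have "\<dots> = (m \<bullet> L t) * (T s \<bullet> m)" unfolding e by simp
        finally show ?thesis using mm by (simp add: field_simps)
      qed
      then show ?thesis by blast
    qed
    obtain l l' where "\<forall>s\<in>I. K s \<bullet> U t0 = l * (T s \<bullet> m)" "\<forall>s\<in>I. K s \<bullet> U t1 = l' * (T s \<bullet> m)"
      using along t0 t1 by blast
    then have "\<not> full_direction I T"
      using not_full_if_binormal_along_plane[OF T t1(2), of l l'] by (simp add: m_def)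
    then show False using full by blast
  qed
qed

text \<open>Both curves are spanning, so the orthogonality relation makes \<open>K\<close> and \<open>L\<close> linear in \<open>T\<close> and \<open>U\<close>,
by mutually transposed operators. Symmetry of one of them makes the two operators equal: this is
why the two generating curves solve the same equation.\<close>

lemma common_turning_operator:
  assumes T: "turning_direction I v T K" and K: "continuous_on I K" and v: "\<And>s. s \<in> I \<Longrightarrow> v s \<noteq> 0"
    and U: "turning_direction J w U L" and w: "\<And>t. t \<in> J \<Longrightarrow> w t \<noteq> 0"
    and rel: "\<And>s t. s \<in> I \<Longrightarrow> t \<in> J \<Longrightarrow> K s \<bullet> U t = T s \<bullet> L t"
    and reg: "\<And>s t. s \<in> I \<Longrightarrow> t \<in> J \<Longrightarrow> cross3 (T s) (U t) \<noteq> 0"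
    and full: "full_direction I T"
  obtains f where "linear f" "\<And>x y. f x \<bullet> y = x \<bullet> f y" "\<And>x. f x = 0 \<Longrightarrow> x = 0"
    "\<And>s. s \<in> I \<Longrightarrow> K s = f (T s)" "\<And>t. t \<in> J \<Longrightarrow> L t = f (U t)"
proof -
  have fullU: "full_direction J U" by (rule full_direction_of_partner[OF T K U w rel reg full])
  obtain N :: "real^3^3" where N: "\<And>t. t \<in> J \<Longrightarrow> L t = N *v U t"
    using linear_relation_of_full_direction[of I T J K U L] full rel unfolding full_direction_def by blast
  define M where "M = transpose N"
  have adj: "(N *v x) \<bullet> y = x \<bullet> (M *v y)" for x y
    unfolding M_def by (metis dot_lmul_matrix inner_commute transpose_transpose vector_transpose_matrix)
  have KM: "K s = M *v T s" if s: "s \<in> I" for s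
  proof -
    have "(K s - M *v T s) \<bullet> U t = 0" if t: "t \<in> J" for t
    proof -
      have "K s \<bullet> U t = (N *v U t) \<bullet> T s" using rel[OF s t] N[OF t] by (simp add: inner_commute)
      also have "\<dots> = (M *v T s) \<bullet> U t" unfolding adj by (rule inner_commute)
      finally show ?thesis by (simp add: inner_diff_left)
    qed
    then show ?thesis using fullU unfolding full_direction_def by (metis eq_iff_diff_eq_0)
  qed
  have T': "turning_direction I v T (\<lambda>s. M *v T s)"
    using T KM unfolding turning_direction_def by simp
  note M = turning_operator_symmetric_injective[OF T' v full]
  have NM: "N = M" using M(1) unfolding M_def by simp
  show ?thesis
    by (rule that[of "\<lambda>x. M *v x"]) (use M(2) KM N adj in \<open>auto simp: NM\<close>)
qed

section \<open>Principal axes of the operator\<close>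

text \<open>A maximum point of the quadratic form on the unit sphere of \<open>S\<close>. The residual \<open>f e - l e\<close> lies
in \<open>S\<close>, and moving from \<open>e\<close> in its direction would increase the form to first order.\<close>

lemma symmetric_has_eigenvector:
  fixes f :: "'a::euclidean_space \<Rightarrow> 'a"
  assumes f: "linear f" and sym: "\<And>x y. f x \<bullet> y = x \<bullet> f y"
    and S: "subspace S" "\<And>x. x \<in> S \<Longrightarrow> f x \<in> S" and x0: "x0 \<in> S" "x0 \<noteq> 0"
  obtains e l where "e \<in> S" "norm e = 1" "f e = l *\<^sub>R e"
proof -
  let ?C = "S \<inter> sphere 0 1"
  have "(1 / norm x0) *\<^sub>R x0 \<in> ?C" using x0 S(1) by (auto simp: subspace_scale)
  moreover have "compact ?C" using closed_subspace[OF S(1)] by (simp add: closed_Int_compact)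
  moreover have "continuous_on ?C (\<lambda>x. x \<bullet> f x)"
    by (intro continuous_intros linear_continuous_on) (simp add: f linear_conv_bounded_linear[symmetric])
  ultimately obtain e where e: "e \<in> ?C" "\<And>x. x \<in> ?C \<Longrightarrow> x \<bullet> f x \<le> e \<bullet> f e"
    using continuous_attains_sup[of ?C "\<lambda>x. x \<bullet> f x"] by blast
  define l where "l = e \<bullet> f e"
  have le: "x \<bullet> f x \<le> l * (x \<bullet> x)" if x: "x \<in> S" for x
  proof (cases "x = 0")
    case True
    then show ?thesis by (simp add: linear_0[OF f])
  next
    case False
    have "(1 / norm x) *\<^sub>R x \<in> ?C" using x False S(1) by (auto simp: subspace_scale)
    then have "((1 / norm x) *\<^sub>R x) \<bullet> f ((1 / norm x) *\<^sub>R x) \<le> l" unfolding l_def by (rule e(2))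
    then show ?thesis using False
      by (simp add: linear_scale[OF f] dot_square_norm field_simps power2_eq_square)
  qed
  define r where "r = f e - l *\<^sub>R e"
  have rS: "r \<in> S" unfolding r_def using S e by (simp add: subspace_diff subspace_scale)
  have ee: "e \<bullet> e = 1" using e(1) by (simp add: dot_square_norm)
  have er: "e \<bullet> r = 0" unfolding r_def by (simp add: inner_diff_right ee l_def)
  have fer: "f e \<bullet> r = r \<bullet> r"
    using er by (simp add: r_def[symmetric] inner_diff_left[of "f e" "l *\<^sub>R e" r, folded r_def])
  have "r \<bullet> r = 0"
  proof (rule ccontr)
    assume "r \<bullet> r \<noteq> 0"
    then have A: "r \<bullet> r > 0" by simp
    define A where "A = r \<bullet> r"
    define B where "B = r \<bullet> f r - l * A"
    define t where "t = A / (\<bar>B\<bar> + 1)"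
    have t: "t > 0" using A by (simp add: t_def A_def)
    have ineq: "(e + t *\<^sub>R r) \<bullet> f (e + t *\<^sub>R r) \<le> l * ((e + t *\<^sub>R r) \<bullet> (e + t *\<^sub>R r))"
      by (rule le) (use e rS S in \<open>simp add: subspace_add subspace_scale\<close>)
    have q1: "(e + t *\<^sub>R r) \<bullet> f (e + t *\<^sub>R r) = l + 2 * t * A + t * t * (r \<bullet> f r)"
      using fer by (simp add: linear_add[OF f] linear_scale[OF f] inner_add_left inner_add_right
          sym[of e r, symmetric] inner_commute[of r "f e"] l_def[symmetric] A_def algebra_simps)
    have q2: "(e + t *\<^sub>R r) \<bullet> (e + t *\<^sub>R r) = 1 + t * t * A"
      using er ee by (simp add: inner_add_left inner_add_right inner_commute[of r e] A_def)
    have "t * (2 * A + t * B) \<le> 0" using ineq[unfolded q1 q2] by (simp add: B_def algebra_simps)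
    then have "2 * A + t * B \<le> 0" using t by (simp add: mult_le_0_iff)
    moreover have "\<bar>t * B\<bar> \<le> A"
    proof -
      have "\<bar>t * B\<bar> = A * (\<bar>B\<bar> / (\<bar>B\<bar> + 1))" using A by (simp add: t_def A_def abs_mult)
      also have "\<dots> \<le> A * 1" by (rule mult_left_mono) (use A in \<open>simp_all add: A_def\<close>)
      finally show ?thesis by simp
    qed
    ultimately show False using A unfolding A_def by linarith
  qed
  then have "f e = l *\<^sub>R e" by (simp add: r_def)
  then show ?thesis using that e by auto
qed

definition orthonormal_eigenvectors ::
  "(real^3 \<Rightarrow> real^3) \<Rightarrow> real^3 \<Rightarrow> real^3 \<Rightarrow> real^3 \<Rightarrow> real \<Rightarrow> real \<Rightarrow> real \<Rightarrow> bool" where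
  "orthonormal_eigenvectors f e1 e2 e3 l1 l2 l3 \<longleftrightarrow>
     e1 \<bullet> e1 = 1 \<and> e2 \<bullet> e2 = 1 \<and> e3 \<bullet> e3 = 1 \<and> e1 \<bullet> e2 = 0 \<and> e1 \<bullet> e3 = 0 \<and> e2 \<bullet> e3 = 0 \<and>
     f e1 = l1 *\<^sub>R e1 \<and> f e2 = l2 *\<^sub>R e2 \<and> f e3 = l3 *\<^sub>R e3"

lemma orthonormal_eigenvectors_exist:
  fixes f :: "real^3 \<Rightarrow> real^3"
  assumes f: "linear f" and sym: "\<And>x y. f x \<bullet> y = x \<bullet> f y"
  obtains e1 e2 e3 l1 l2 l3 where "orthonormal_eigenvectors f e1 e2 e3 l1 l2 l3"
proof -
  obtain e1 l1 where e1: "norm e1 = 1" "f e1 = l1 *\<^sub>R e1"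
    using symmetric_has_eigenvector[OF f sym subspace_UNIV, of "axis 1 1"] by (auto simp: axis_eq_0_iff)
  let ?S = "{x. e1 \<bullet> x = 0}"
  obtain q where q: "q \<noteq> 0" "q \<bullet> e1 = 0" "q \<bullet> e1 = 0" by (rule nonzero_orthogonal_to_two)
  have inv: "f x \<in> ?S" if "x \<in> ?S" for x
    using that sym[of e1 x] e1(2) by simp
  obtain e2 l2 where e2: "e1 \<bullet> e2 = 0" "norm e2 = 1" "f e2 = l2 *\<^sub>R e2"
    using symmetric_has_eigenvector[OF f sym subspace_hyperplane[of e1] inv, of q] q
    by (auto simp: inner_commute)
  define e3 where "e3 = cross3 e1 e2"
  define l3 where "l3 = e3 \<bullet> f e3"
  have n: "e1 \<bullet> e1 = 1" "e2 \<bullet> e2 = 1" using e1 e2 by (simp_all add: dot_square_norm)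
  have e3: "e3 \<bullet> e3 = 1" "e1 \<bullet> e3 = 0" "e2 \<bullet> e3 = 0"
    using n e2(1) by (simp_all add: e3_def dot_cross dot_cross_self inner_commute)
  have "e3 \<noteq> 0" using e3(1) by auto
  moreover have "e3 \<bullet> e1 = 0" "e3 \<bullet> e2 = 0" using e3 by (simp_all add: inner_commute)
  moreover from this have "f e3 \<bullet> e1 = 0" "f e3 \<bullet> e2 = 0" unfolding sym e1(2) e2(3) by simp_all
  moreover have "f e3 \<bullet> e3 = l3" unfolding l3_def by (rule inner_commute)
  ultimately have "f e3 - l3 *\<^sub>R e3 = 0"
    using orthogonal_to_basis_zero[of e1 e2 "f e3 - l3 *\<^sub>R e3", folded e3_def] e3
    by (simp add: inner_diff_left)
  then have "orthonormal_eigenvectors f e1 e2 e3 l1 l2 l3"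
    unfolding orthonormal_eigenvectors_def using n e3 e1 e2 by simp
  then show ?thesis by (rule that)
qed

text \<open>The eigenvector \<open>e3\<close> belongs to the eigenvalue whose sign differs from that of the other two, so
that the cone \<open>f x \<bullet> x = 0\<close> surrounds the axis \<open>e3\<close>. The frame is left-handed when
\<open>l3 < 0\<close>: with this choice the motion \<open>T' = f T \<times> T\<close> on the half \<open>e3 \<bullet> T > 0\<close>
of the cone always turns from \<open>e1\<close> towards \<open>e2\<close>.\<close>

locale principal_axes =
  fixes f :: "real^3 \<Rightarrow> real^3" and e1 e2 e3 :: "real^3" and l1 l2 l3 :: real
  assumes lin: "linear f"
    and eigen: "orthonormal_eigenvectors f e1 e2 e3 l1 l2 l3"
    and orientation: "cross3 e1 e2 = sgn l3 *\<^sub>R e3"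
    and sign1: "l1 * l3 < 0" and sign2: "l2 * l3 < 0"

lemma isotropic_odd_coordinate:
  fixes k1 k2 k3 x y z :: real
  assumes k: "k1 * k3 < 0" "k2 * k3 < 0" and iso: "k1 * x\<^sup>2 + k2 * y\<^sup>2 + k3 * z\<^sup>2 = 0"
    and nz: "x \<noteq> 0 \<or> y \<noteq> 0 \<or> z \<noteq> 0"
  shows "z \<noteq> 0"
proof
  assume z: "z = 0"
  have "k3 * (k1 * x\<^sup>2 + k2 * y\<^sup>2) = 0" using iso z by simp
  then have "k1 * k3 * x\<^sup>2 + k2 * k3 * y\<^sup>2 = 0" by (simp add: algebra_simps)
  moreover have "k1 * k3 * x\<^sup>2 \<le> 0" "k2 * k3 * y\<^sup>2 \<le> 0" using k by (auto intro: mult_nonpos_nonneg)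
  ultimately have "k1 * k3 * x\<^sup>2 = 0" "k2 * k3 * y\<^sup>2 = 0" by linarith+
  then show False using k nz z by auto
qed

text \<open>An isotropic unit vector forces eigenvalues of both signs, so after a permutation the third one is
the odd one. The signs of \<open>e3\<close> and \<open>e1\<close> are then adjusted.\<close>

lemma principal_axes_exist:
  fixes f :: "real^3 \<Rightarrow> real^3"
  assumes f: "linear f" and sym: "\<And>x y. f x \<bullet> y = x \<bullet> f y" and inj: "\<And>x. f x = 0 \<Longrightarrow> x = 0"
    and T: "norm T = 1" "f T \<bullet> T = 0"
  obtains e1 e2 e3 l1 l2 l3 where "principal_axes f e1 e2 e3 l1 l2 l3" "e3 \<bullet> T > 0"
proof -
  obtain a1 a2 a3 m1 m2 m3 where a: "orthonormal_eigenvectors f a1 a2 a3 m1 m2 m3"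
    by (rule orthonormal_eigenvectors_exist[OF f sym])
  have nz: "m1 \<noteq> 0 \<and> m2 \<noteq> 0 \<and> m3 \<noteq> 0 \<and>
      m1 * (a1 \<bullet> T)\<^sup>2 + m2 * (a2 \<bullet> T)\<^sup>2 + m3 * (a3 \<bullet> T)\<^sup>2 = 0 \<and>
      (a1 \<bullet> T \<noteq> 0 \<or> a2 \<bullet> T \<noteq> 0 \<or> a3 \<bullet> T \<noteq> 0)"
    if a: "orthonormal_eigenvectors f a1 a2 a3 m1 m2 m3" for a1 a2 a3 m1 m2 m3
  proof -
    note o = a[unfolded orthonormal_eigenvectors_def]
    have Tx: "T = (a1 \<bullet> T) *\<^sub>R a1 + (a2 \<bullet> T) *\<^sub>R a2 + (a3 \<bullet> T) *\<^sub>R a3"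
      by (rule orthonormal_expansion(1)) (use o in auto)
    have "f T \<bullet> T = m1 * (a1 \<bullet> T)\<^sup>2 + m2 * (a2 \<bullet> T)\<^sup>2 + m3 * (a3 \<bullet> T)\<^sup>2"
      by (subst Tx) (use o in \<open>simp add: linear_add[OF f] linear_scale[OF f] inner_add_left power2_eq_square algebra_simps\<close>)
    moreover have "a1 \<bullet> T \<noteq> 0 \<or> a2 \<bullet> T \<noteq> 0 \<or> a3 \<bullet> T \<noteq> 0"
      using Tx T(1) by auto
    moreover have "m1 \<noteq> 0" "m2 \<noteq> 0" "m3 \<noteq> 0" using inj o by force+
    ultimately show ?thesis using T(2) by simp
  qed
  have perm: "orthonormal_eigenvectors f a2 a3 a1 m2 m3 m1" "orthonormal_eigenvectors f a3 a1 a2 m3 m1 m2"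
    using a unfolding orthonormal_eigenvectors_def by (auto simp: inner_commute)
  have "\<exists>b1 b2 b3 k1 k2 k3. orthonormal_eigenvectors f b1 b2 b3 k1 k2 k3 \<and> k1 * k3 < 0 \<and> k2 * k3 < 0"
  proof -
    have "\<not> (r * m1 > 0 \<and> r * m2 > 0 \<and> r * m3 > 0)" for r :: real
    proof
      assume p: "r * m1 > 0 \<and> r * m2 > 0 \<and> r * m3 > 0"
      have "r * m1 * (a1 \<bullet> T)\<^sup>2 + r * m2 * (a2 \<bullet> T)\<^sup>2 + r * m3 * (a3 \<bullet> T)\<^sup>2 = r * 0"
        using nz[OF a] by (simp only: mult.assoc flip: distrib_left)
      moreover have "r * m1 * (a1 \<bullet> T)\<^sup>2 \<ge> 0" "r * m2 * (a2 \<bullet> T)\<^sup>2 \<ge> 0" "r * m3 * (a3 \<bullet> T)\<^sup>2 \<ge> 0"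
        using p by simp_all
      ultimately have "r * m1 * (a1 \<bullet> T)\<^sup>2 = 0" "r * m2 * (a2 \<bullet> T)\<^sup>2 = 0" "r * m3 * (a3 \<bullet> T)\<^sup>2 = 0"
        by linarith+
      then show False using nz[OF a] p by auto
    qed
    from this[of 1] this[of "-1"]
    have "\<not> (m1 > 0 \<and> m2 > 0 \<and> m3 > 0)" "\<not> (m1 < 0 \<and> m2 < 0 \<and> m3 < 0)" by simp_all
    moreover have "m1 < 0 \<or> 0 < m1" "m2 < 0 \<or> 0 < m2" "m3 < 0 \<or> 0 < m3"
      using nz[OF a] by (simp_all add: linorder_neq_iff)
    ultimately have "(m1 * m3 < 0 \<and> m2 * m3 < 0) \<or> (m2 * m1 < 0 \<and> m3 * m1 < 0) \<or> (m3 * m2 < 0 \<and> m1 * m2 < 0)"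
      by (auto simp: mult_less_0_iff)
    then show ?thesis using a perm by blast
  qed
  then obtain b1 b2 b3 k1 k2 k3 where b: "orthonormal_eigenvectors f b1 b2 b3 k1 k2 k3"
    "k1 * k3 < 0" "k2 * k3 < 0" by blast
  have b3: "b3 \<bullet> T \<noteq> 0" using isotropic_odd_coordinate[OF b(2,3)] nz[OF b(1)] by blast
  define e3 where "e3 = sgn (b3 \<bullet> T) *\<^sub>R b3"
  have sg: "sgn (b3 \<bullet> T) * sgn (b3 \<bullet> T) = 1" using b3 by (simp add: sgn_mult_self_eq)
  have o: "orthonormal_eigenvectors f b1 b2 e3 k1 k2 k3"
    using b(1) sg unfolding orthonormal_eigenvectors_def e3_def by (simp add: linear_scale[OF f])
  note oo = o[unfolded orthonormal_eigenvectors_def]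
  have pos: "e3 \<bullet> T > 0" using b3 by (simp add: e3_def sgn_mult_self_eq abs_sgn_eq zero_less_mult_iff sgn_if)
  define \<epsilon> where "\<epsilon> = e3 \<bullet> cross3 b1 b2"
  have cr: "cross3 b1 b2 = \<epsilon> *\<^sub>R e3"
    unfolding \<epsilon>_def by (rule orthonormal_expansion(2)) (use oo in auto)
  have "\<epsilon> * \<epsilon> = cross3 b1 b2 \<bullet> cross3 b1 b2" unfolding cr using oo by simp
  also have "\<dots> = 1" unfolding dot_cross using oo by (simp add: inner_commute)
  finally have \<epsilon>: "\<epsilon> * \<epsilon> = 1" .
  define \<delta> where "\<delta> = sgn k3 * \<epsilon>"
  have \<delta>: "\<delta> * \<delta> = 1" using \<epsilon> b(2) by (auto simp: \<delta>_def sgn_if)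
  have o': "orthonormal_eigenvectors f (\<delta> *\<^sub>R b1) b2 e3 k1 k2 k3"
    using o \<delta> unfolding orthonormal_eigenvectors_def by (simp add: linear_scale[OF f])
  have "cross3 (\<delta> *\<^sub>R b1) b2 = (sgn k3 * (\<epsilon> * \<epsilon>)) *\<^sub>R e3"
    by (simp add: cross_mult_left cr \<delta>_def)
  then have "cross3 (\<delta> *\<^sub>R b1) b2 = sgn k3 *\<^sub>R e3" unfolding \<epsilon> by simp
  then have "principal_axes f (\<delta> *\<^sub>R b1) b2 e3 k1 k2 k3"
    unfolding principal_axes_def using f o' b by simp
  then show ?thesis using that pos by blast
qed

text \<open>The two curves enter the orthogonality relation symmetrically, so either of them may be the nonplanar
one.\<close>

lemma minimal_translation_surface_axes:
  assumes min: "minimal_translation_surface I J \<alpha> \<beta>" and np: "\<not> (plane_curve I \<alpha> \<and> plane_curve J \<beta>)"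
    and s0: "s0 \<in> I"
  obtains f e1 e2 e3 l1 l2 l3 where "principal_axes f e1 e2 e3 l1 l2 l3" "e3 \<bullet> unit_tangent \<alpha> s0 > 0"
    "\<And>s. s \<in> I \<Longrightarrow> vderiv \<alpha> s \<noteq> 0" "\<And>t. t \<in> J \<Longrightarrow> vderiv \<beta> t \<noteq> 0"
    "turning_direction I (\<lambda>s. norm (vderiv \<alpha> s)) (unit_tangent \<alpha>) (\<lambda>s. f (unit_tangent \<alpha> s))"
    "turning_direction J (\<lambda>t. norm (vderiv \<beta> t)) (unit_tangent \<beta>) (\<lambda>t. f (unit_tangent \<beta> t))"
proof -
  have I: "open_interval I" and J: "open_interval J" and \<alpha>: "smooth_on I \<alpha>" and \<beta>: "smooth_on J \<beta>"
    and reg: "\<And>s t. s \<in> I \<Longrightarrow> t \<in> J \<Longrightarrow> regular_at \<alpha> \<beta> s t"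
    and H: "\<And>s t. s \<in> I \<Longrightarrow> t \<in> J \<Longrightarrow> mean_curvature (translation_surface \<alpha> \<beta>) s t = 0"
    using min unfolding minimal_translation_surface_def by auto
  have op: "open I" "open J" and ne: "I \<noteq> {}" "J \<noteq> {}" using I J by (auto simp: open_interval_def)
  have nz\<alpha>: "vderiv \<alpha> s \<noteq> 0" if "s \<in> I" for s using reg[OF that] ne unfolding regular_at_def by auto
  have nz\<beta>: "vderiv \<beta> t \<noteq> 0" if "t \<in> J" for t using reg[OF _ that] ne unfolding regular_at_def by auto
  note T = turning_direction_of_curve[OF I \<alpha> nz\<alpha>] and U = turning_direction_of_curve[OF J \<beta> nz\<beta>]
  have cont: "continuous_on I (curvature_binormal \<alpha>)"
    if "open_interval I" "smooth_on I \<alpha>" "\<And>s. s \<in> I \<Longrightarrow> vderiv \<alpha> s \<noteq> 0" for I \<alpha>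
    unfolding curvature_binormal_def
    by (intro continuous_intros continuous_on_cross smooth_on_continuous[OF smooth_on_vderiv]
        smooth_on_vderiv that(2)) (use that(3) in auto)
  have rel: "curvature_binormal \<alpha> s \<bullet> unit_tangent \<beta> t = unit_tangent \<alpha> s \<bullet> curvature_binormal \<beta> t"
    if "s \<in> I" "t \<in> J" for s t
    using H[OF that] minimal_iff_orthogonality[OF op \<alpha> \<beta> that reg[OF that]] by simp
  have rg: "cross3 (unit_tangent \<alpha> s) (unit_tangent \<beta> t) \<noteq> 0" if "s \<in> I" "t \<in> J" for s t
    using reg[OF that] nz\<alpha>[OF that(1)] nz\<beta>[OF that(2)] unfolding regular_at_def unit_tangent_def
    by (simp add: cross_mult_left cross_mult_right)
  have "\<exists>f. linear f \<and> (\<forall>x y. f x \<bullet> y = x \<bullet> f y) \<and> (\<forall>x. f x = 0 \<longrightarrow> x = 0) \<and>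
    (\<forall>s\<in>I. curvature_binormal \<alpha> s = f (unit_tangent \<alpha> s)) \<and>
    (\<forall>t\<in>J. curvature_binormal \<beta> t = f (unit_tangent \<beta> t))"
  proof (cases "plane_curve I \<alpha>")
    case False
    note full = full_direction_of_nonplanar[OF I \<alpha> nz\<alpha> False]
    show ?thesis
      by (rule common_turning_operator[OF T cont[OF I \<alpha> nz\<alpha>] _ U _ rel rg full])
        (use nz\<alpha> nz\<beta> in auto)
  next
    case True
    then have full: "full_direction J (unit_tangent \<beta>)"
      using full_direction_of_nonplanar[OF J \<beta> nz\<beta>] np by blast
    have rel': "curvature_binormal \<beta> t \<bullet> unit_tangent \<alpha> s = unit_tangent \<beta> t \<bullet> curvature_binormal \<alpha> s"
      if "t \<in> J" "s \<in> I" for s t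
      using rel[OF that(2,1)] by (simp add: inner_commute)
    have rg': "cross3 (unit_tangent \<beta> t) (unit_tangent \<alpha> s) \<noteq> 0" if "t \<in> J" "s \<in> I" for s t
      using rg[OF that(2,1)] cross_skew[of "unit_tangent \<beta> t"] by simp
    show ?thesis
      by (rule common_turning_operator[OF U cont[OF J \<beta> nz\<beta>] _ T _ rel' rg' full])
        (use nz\<alpha> nz\<beta> in auto)
  qed
  then obtain f where f: "linear f" "\<And>x y. f x \<bullet> y = x \<bullet> f y" "\<And>x. f x = 0 \<Longrightarrow> x = 0"
    "\<And>s. s \<in> I \<Longrightarrow> curvature_binormal \<alpha> s = f (unit_tangent \<alpha> s)"
    "\<And>t. t \<in> J \<Longrightarrow> curvature_binormal \<beta> t = f (unit_tangent \<beta> t)" by blast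
  have Ta: "turning_direction I (\<lambda>s. norm (vderiv \<alpha> s)) (unit_tangent \<alpha>) (\<lambda>s. f (unit_tangent \<alpha> s))"
    and Tb: "turning_direction J (\<lambda>t. norm (vderiv \<beta> t)) (unit_tangent \<beta>) (\<lambda>t. f (unit_tangent \<beta> t))"
    using T U f(4,5) by (auto simp: turning_direction_def)
  obtain e1 e2 e3 l1 l2 l3 where "principal_axes f e1 e2 e3 l1 l2 l3" "e3 \<bullet> unit_tangent \<alpha> s0 > 0"
    by (rule principal_axes_exist[OF f(1,2,3) turning_directionD(4,6)[OF Ta s0]]) (assumption, rule that)
  then show ?thesis by (rule that[OF _ _ nz\<alpha> nz\<beta> Ta Tb])
qed

section \<open>The flow on the spherical conic\<close>

text \<open>The solution is the inverse of an antiderivative of \<open>1 / g\<close>, whose slope is at least \<open>1 / c\<close> and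
which therefore is a bijection of the real line.\<close>

lemma autonomous_solution_exists:
  fixes g :: "real \<Rightarrow> real"
  assumes g: "continuous_on UNIV g" and pos: "\<And>w. 0 < g w" and bound: "\<And>w. g w \<le> c"
  obtains W where "\<And>t. (W has_real_derivative g (W t)) (at t)" "surj W"
proof -
  have c: "c > 0" using pos[of 0] bound[of 0] by linarith
  obtain G where "\<And>x. x \<in> UNIV \<Longrightarrow> (G has_vector_derivative 1 / g x) (at x)"
  proof (rule antiderivative_exists)
    show "open_interval (UNIV :: real set)" by (simp add: open_interval_def)
    show "continuous_on UNIV (\<lambda>x. 1 / g x)"
      by (intro continuous_intros g) (use pos in \<open>auto simp: less_imp_neq[symmetric]\<close>)
  qed blast
  then have G: "(G has_real_derivative 1 / g x) (at x)" for x
    by (simp add: real_derivative_iff)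
  have incr: "G x + (y - x) / c \<le> G y" if "x \<le> y" for x y
  proof -
    have "G x - x / c \<le> G y - y / c"
    proof (rule DERIV_nonneg_imp_nondecreasing[OF that])
      fix z
      have "((\<lambda>x. G x - x / c) has_real_derivative 1 / g z - 1 / c) (at z)"
        by (rule DERIV_diff[OF G DERIV_cdivide[OF DERIV_ident]])
      moreover have "1 / c \<le> 1 / g z" using pos bound by (simp add: frac_le)
      ultimately show "\<exists>d. ((\<lambda>x. G x - x / c) has_real_derivative d) (at z) \<and> 0 \<le> d" by fastforce
    qed
    then show ?thesis by (simp add: diff_divide_distrib)
  qed
  have inj: "inj G"
  proof (rule linorder_injI)
    fix x y :: real assume xy: "x < y"
    then have "(y - x) / c > 0" using c by simp
    then show "G x \<noteq> G y" using incr[of x y] xy by linarith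
  qed
  have cont: "isCont G x" for x using G DERIV_isCont by blast
  have sur: "\<exists>x. G x = y" for y
  proof -
    define h where "h = c * \<bar>y - G 0\<bar>"
    have h: "h \<ge> 0" "h / c = \<bar>y - G 0\<bar>" using c by (simp_all add: h_def)
    have "G (- h) \<le> y" "y \<le> G h" using incr[of "- h" 0] incr[of 0 h] h by auto
    then show ?thesis using IVT[of G "- h" y h] cont h by auto
  qed
  define W where "W = inv G"
  have GW: "G (W y) = y" for y unfolding W_def using sur by (metis f_inv_into_f rangeI)
  have WG: "W (G x) = x" for x unfolding W_def by (rule inv_f_f[OF inj])
  have "(W has_real_derivative g (W t)) (at t)" for t
  proof -
    have "isCont W (G (W t))"
      by (rule isCont_inverse_function[of 1]) (auto simp: WG cont)
    then have "isCont W t" by (simp add: GW)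
    then have "(W has_real_derivative inverse (1 / g (W t))) (at t)"
      using DERIV_inverse_function[OF G, of W t "t - 1" "t + 1"] pos[of "W t"] GW by simp
    then show ?thesis by simp
  qed
  moreover have "surj W" using WG by (metis surjI)
  ultimately show ?thesis using that by blast
qed

context principal_axes
begin

lemma ortho: "e1 \<bullet> e1 = 1" "e2 \<bullet> e2 = 1" "e3 \<bullet> e3 = 1" "e1 \<bullet> e2 = 0" "e1 \<bullet> e3 = 0" "e2 \<bullet> e3 = 0"
    "e2 \<bullet> e1 = 0" "e3 \<bullet> e1 = 0" "e3 \<bullet> e2 = 0"
  and eig: "f e1 = l1 *\<^sub>R e1" "f e2 = l2 *\<^sub>R e2" "f e3 = l3 *\<^sub>R e3"
  using eigen unfolding orthonormal_eigenvectors_def by (auto simp: inner_commute)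

lemma l3_nonzero: "l3 \<noteq> 0" using sign1 by auto

lemma sg_square: "sgn l3 * sgn l3 = 1" "sgn l3 * l3 = \<bar>l3\<bar>"
  using l3_nonzero by (auto simp: sgn_if)

lemma orientations: "cross3 e2 e3 = sgn l3 *\<^sub>R e1" "cross3 e3 e1 = sgn l3 *\<^sub>R e2"
proof -
  have e3: "e3 = sgn l3 *\<^sub>R cross3 e1 e2" unfolding orientation by (simp add: sg_square l3_nonzero)
  show "cross3 e2 e3 = sgn l3 *\<^sub>R e1" "cross3 e3 e1 = sgn l3 *\<^sub>R e2"
    by (subst e3, simp add: cross_mult_right cross_mult_left Lagrange cross3_cross3_left ortho)+
qed

definition from_axes :: "real^3 \<Rightarrow> real^3" where
  "from_axes x = x$1 *\<^sub>R e1 + x$2 *\<^sub>R e2 + x$3 *\<^sub>R e3"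

lemma linear_from_axes: "linear from_axes"
  by (rule linearI) (simp_all add: from_axes_def algebra_simps)

lemma inner_from_axes: "from_axes x \<bullet> from_axes y = x \<bullet> y"
proof -
  have "from_axes x \<bullet> from_axes y = x$1 * y$1 + x$2 * y$2 + x$3 * y$3"
    by (simp add: from_axes_def inner_add_left inner_add_right ortho)
  then show ?thesis by (simp add: inner_vec_def sum_3)
qed

lemma orthogonal_from_axes: "orthogonal_transformation from_axes"
  unfolding orthogonal_transformation_def using linear_from_axes inner_from_axes by blast

lemma det_from_axes: "det (matrix from_axes) = sgn l3"
proof -
  have "from_axes (axis 1 1) = e1" "from_axes (axis 2 1) = e2" "from_axes (axis 3 1) = e3"
    by (simp_all add: from_axes_def axis_def)
  then have "cross3 e1 e2 = det (matrix from_axes) *\<^sub>R e3"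
    using cross_orthogonal_transformation[OF orthogonal_from_axes, of "axis 1 1" "axis 2 1"]
    by (simp add: cross_basis)
  then have "sgn l3 *\<^sub>R e3 = det (matrix from_axes) *\<^sub>R e3" by (simp add: orientation)
  moreover have "e3 \<noteq> 0" using ortho(3) by auto
  ultimately show ?thesis by (metis scaleR_cancel_right)
qed

lemma expand: "x = (e1 \<bullet> x) *\<^sub>R e1 + (e2 \<bullet> x) *\<^sub>R e2 + (e3 \<bullet> x) *\<^sub>R e3"
  by (rule orthonormal_expansion(1)[OF ortho(1-6)])

lemma inner_axes: "x \<bullet> y = (e1 \<bullet> x) * (e1 \<bullet> y) + (e2 \<bullet> x) * (e2 \<bullet> y) + (e3 \<bullet> x) * (e3 \<bullet> y)"
  by (subst expand[of x]) (simp add: inner_add_left)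

lemma eq_axesI:
  assumes "e1 \<bullet> x = e1 \<bullet> y" "e2 \<bullet> x = e2 \<bullet> y" "e3 \<bullet> x = e3 \<bullet> y" shows "x = y"
  by (subst expand[of x], subst expand[of y]) (simp add: assms)

lemma f_axes: "e1 \<bullet> f x = l1 * (e1 \<bullet> x)" "e2 \<bullet> f x = l2 * (e2 \<bullet> x)" "e3 \<bullet> f x = l3 * (e3 \<bullet> x)"
  by (subst (1) expand[of x], simp add: linear_add[OF lin] linear_scale[OF lin] eig inner_add_right ortho)+

lemma cross_axes:
  "e1 \<bullet> cross3 x y = sgn l3 * ((e2 \<bullet> x) * (e3 \<bullet> y) - (e2 \<bullet> y) * (e3 \<bullet> x))"
  "e2 \<bullet> cross3 x y = sgn l3 * ((e3 \<bullet> x) * (e1 \<bullet> y) - (e3 \<bullet> y) * (e1 \<bullet> x))"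
  "e3 \<bullet> cross3 x y = sgn l3 * ((e1 \<bullet> x) * (e2 \<bullet> y) - (e1 \<bullet> y) * (e2 \<bullet> x))"
proof -
  have "e1 = sgn l3 *\<^sub>R cross3 e2 e3" "e2 = sgn l3 *\<^sub>R cross3 e3 e1" "e3 = sgn l3 *\<^sub>R cross3 e1 e2"
    by (simp_all add: orientation orientations sg_square l3_nonzero)
  then show
    "e1 \<bullet> cross3 x y = sgn l3 * ((e2 \<bullet> x) * (e3 \<bullet> y) - (e2 \<bullet> y) * (e3 \<bullet> x))"
    "e2 \<bullet> cross3 x y = sgn l3 * ((e3 \<bullet> x) * (e1 \<bullet> y) - (e3 \<bullet> y) * (e1 \<bullet> x))"
    "e3 \<bullet> cross3 x y = sgn l3 * ((e1 \<bullet> x) * (e2 \<bullet> y) - (e1 \<bullet> y) * (e2 \<bullet> x))"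
    by (metis dot_cross inner_scaleR_left mult.commute)+
qed

lemma turning_axes:
  "e1 \<bullet> cross3 (f x) x = sgn l3 * (l2 - l3) * (e2 \<bullet> x) * (e3 \<bullet> x)"
  "e2 \<bullet> cross3 (f x) x = sgn l3 * (l3 - l1) * (e3 \<bullet> x) * (e1 \<bullet> x)"
  "e3 \<bullet> cross3 (f x) x = sgn l3 * (l1 - l2) * (e1 \<bullet> x) * (e2 \<bullet> x)"
  by (simp_all add: cross_axes f_axes algebra_simps)

text \<open>The squared semiaxes of the projection of the spherical conic \<open>|x| = 1\<close>, \<open>f x \<bullet> x = 0\<close> to the
plane of \<open>e1\<close> and \<open>e2\<close>: eliminating the third coordinate leaves
\<open>(l3 - l1) x1^2 + (l3 - l2) x2^2 = l3\<close>.\<close>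

definition cone_A where "cone_A = sqrt (l3 / (l3 - l1))"
definition cone_B where "cone_B = sqrt (l3 / (l3 - l2))"

lemma l_diff: "l3 - l1 \<noteq> 0" "l3 - l2 \<noteq> 0"
  using sign1 sign2 by (auto simp: mult_less_0_iff)

lemma ratio_bounds:
  assumes "l * l3 < 0"
  shows "0 < l3 / (l3 - l)" "l3 / (l3 - l) < 1"
  using assms by (auto simp: mult_less_0_iff zero_less_divide_iff divide_simps)

lemma cone_AB:
  "cone_A > 0" "cone_B > 0" "cone_A\<^sup>2 = l3 / (l3 - l1)" "cone_B\<^sup>2 = l3 / (l3 - l2)"
  "cone_A\<^sup>2 < 1" "cone_B\<^sup>2 < 1" "cone_A\<^sup>2 * (l3 - l1) = l3" "cone_B\<^sup>2 * (l3 - l2) = l3"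
proof -
  note r = ratio_bounds[OF sign1] ratio_bounds[OF sign2]
  show "cone_A > 0" "cone_B > 0" using r by (simp_all add: cone_A_def cone_B_def)
  show a: "cone_A\<^sup>2 = l3 / (l3 - l1)" and b: "cone_B\<^sup>2 = l3 / (l3 - l2)"
    using r by (simp_all add: cone_A_def cone_B_def real_sqrt_pow2)
  show "cone_A\<^sup>2 < 1" "cone_B\<^sup>2 < 1" unfolding a b using r by auto
  show "cone_A\<^sup>2 * (l3 - l1) = l3" "cone_B\<^sup>2 * (l3 - l2) = l3" unfolding a b using l_diff by auto
qed

definition conic_height where
  "conic_height w = sqrt (1 - cone_A\<^sup>2 * (cos w)\<^sup>2 - cone_B\<^sup>2 * (sin w)\<^sup>2)"

definition conic_point :: "real \<Rightarrow> real^3" where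
  "conic_point w = from_axes (vector [cone_A * cos w, cone_B * sin w, conic_height w])"

text \<open>The rate of change of the parameter \<open>w\<close> under the equation \<open>T' = f T \<times> T\<close>.\<close>

definition conic_speed where
  "conic_speed w = \<bar>l3\<bar> * conic_height w / (cone_A * cone_B)"

lemma conic_radicand: "1 - cone_A\<^sup>2 * (cos w)\<^sup>2 - cone_B\<^sup>2 * (sin w)\<^sup>2 > 0"
proof -
  define m where "m = max (cone_A\<^sup>2) (cone_B\<^sup>2)"
  have "cone_A\<^sup>2 * (cos w)\<^sup>2 + cone_B\<^sup>2 * (sin w)\<^sup>2 \<le> m * (cos w)\<^sup>2 + m * (sin w)\<^sup>2"
    by (intro add_mono mult_right_mono) (simp_all add: m_def)
  also have "\<dots> = m * ((sin w)\<^sup>2 + (cos w)\<^sup>2)" by (simp only: distrib_left add.commute)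
  also have "\<dots> < 1" using cone_AB(5,6) by (simp add: m_def)
  finally show ?thesis by simp
qed

lemma conic_height:
  "conic_height w > 0" "(conic_height w)\<^sup>2 = 1 - cone_A\<^sup>2 * (cos w)\<^sup>2 - cone_B\<^sup>2 * (sin w)\<^sup>2"
  "conic_height w \<le> 1"
proof -
  show "conic_height w > 0" and sq: "(conic_height w)\<^sup>2 = 1 - cone_A\<^sup>2 * (cos w)\<^sup>2 - cone_B\<^sup>2 * (sin w)\<^sup>2"
    using conic_radicand[of w] by (simp_all add: conic_height_def)
  have "0 \<le> cone_A\<^sup>2 * (cos w)\<^sup>2" "0 \<le> cone_B\<^sup>2 * (sin w)\<^sup>2" by simp_all
  then have "(conic_height w)\<^sup>2 \<le> 1\<^sup>2" unfolding sq power_one by linarith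
  then show "conic_height w \<le> 1" by (rule power2_le_imp_le) simp
qed

lemma conic_point_axes:
  "e1 \<bullet> conic_point w = cone_A * cos w" "e2 \<bullet> conic_point w = cone_B * sin w"
  "e3 \<bullet> conic_point w = conic_height w"
  by (simp_all add: conic_point_def from_axes_def inner_add_right ortho)

lemma conic_speed_pos: "conic_speed w > 0"
  using conic_height[of w] cone_AB l3_nonzero by (simp add: conic_speed_def)

lemma conic_point_unit: "norm (conic_point w) = 1" and conic_point_isotropic: "f (conic_point w) \<bullet> conic_point w = 0"
proof -
  have "conic_point w \<bullet> conic_point w = 1"
    by (subst inner_axes) (simp add: conic_point_axes conic_height(2) power2_eq_square[symmetric] power_mult_distrib)
  then show "norm (conic_point w) = 1" by (simp add: norm_eq_1)
  have "f (conic_point w) \<bullet> conic_point w =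
      l1 * (cone_A\<^sup>2 * (cos w)\<^sup>2) + l2 * (cone_B\<^sup>2 * (sin w)\<^sup>2) + l3 * (conic_height w)\<^sup>2"
    by (subst inner_axes) (simp add: conic_point_axes f_axes power2_eq_square)
  also have "\<dots> = l3 - (cone_A\<^sup>2 * (l3 - l1)) * (cos w)\<^sup>2 - (cone_B\<^sup>2 * (l3 - l2)) * (sin w)\<^sup>2"
    unfolding conic_height(2) by (simp add: algebra_simps)
  also have "\<dots> = l3 * (1 - ((sin w)\<^sup>2 + (cos w)\<^sup>2))" unfolding cone_AB(7,8) by algebra
  finally show "f (conic_point w) \<bullet> conic_point w = 0" by simp
qed

lemma isotropic_axes:
  assumes "norm x = 1" "f x \<bullet> x = 0"
  shows "(e1 \<bullet> x)\<^sup>2 + (e2 \<bullet> x)\<^sup>2 + (e3 \<bullet> x)\<^sup>2 = 1"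
    "l1 * (e1 \<bullet> x)\<^sup>2 + l2 * (e2 \<bullet> x)\<^sup>2 + l3 * (e3 \<bullet> x)\<^sup>2 = 0"
  using assms inner_axes[of x x] inner_axes[of "f x" x]
  by (simp_all add: f_axes power2_eq_square dot_square_norm mult.assoc)

text \<open>The conic consists of two antipodal ovals; the parameterization covers the one with positive third
coordinate.\<close>

lemma conic_point_surj:
  assumes x: "norm x = 1" "f x \<bullet> x = 0" and pos: "e3 \<bullet> x > 0"
  obtains w where "x = conic_point w"
proof -
  note i = isotropic_axes[OF x]
  have "(l3 - l1) * (e1 \<bullet> x)\<^sup>2 + (l3 - l2) * (e2 \<bullet> x)\<^sup>2 = l3"
    using i by algebra
  moreover have "l3 - l1 = l3 / cone_A\<^sup>2" "l3 - l2 = l3 / cone_B\<^sup>2"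
    using cone_AB l3_nonzero l_diff by simp_all
  ultimately have "l3 * (((e1 \<bullet> x) / cone_A)\<^sup>2 + ((e2 \<bullet> x) / cone_B)\<^sup>2) = l3 * 1"
    by (simp add: power_divide distrib_left)
  then have "((e1 \<bullet> x) / cone_A)\<^sup>2 + ((e2 \<bullet> x) / cone_B)\<^sup>2 = 1" using l3_nonzero by (metis mult_cancel_left)
  then obtain w where w: "(e1 \<bullet> x) / cone_A = cos w" "(e2 \<bullet> x) / cone_B = sin w"
    by (rule sincos_total_2pi) 
  have a: "e1 \<bullet> x = cone_A * cos w" "e2 \<bullet> x = cone_B * sin w"
    using w cone_AB by (simp_all add: field_simps)
  have "(e3 \<bullet> x)\<^sup>2 = (conic_height w)\<^sup>2"
    unfolding conic_height using i(1) unfolding a by (simp add: power_mult_distrib)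
  then have "e3 \<bullet> x = conic_height w" using pos conic_height(1)[of w]
    by (simp add: power2_eq_iff_nonneg)
  then have "x = conic_point w" by (intro eq_axesI) (simp_all add: a conic_point_axes)
  then show ?thesis by (rule that)
qed

text \<open>Consequently a continuous isotropic direction never leaves its oval.\<close>

lemma isotropic_height_nonzero:
  assumes x: "norm x = 1" "f x \<bullet> x = 0"
  shows "e3 \<bullet> x \<noteq> 0"
  by (rule isotropic_odd_coordinate[OF sign1 sign2 isotropic_axes(2)[OF x]])
    (use isotropic_axes(1)[OF x] in auto)

lemma conic_height_derivative:
  "(conic_height has_real_derivative (cone_A\<^sup>2 - cone_B\<^sup>2) * sin w * cos w / conic_height w) (at w)"
proof -
  have "((\<lambda>w. 1 - cone_A\<^sup>2 * (cos w)\<^sup>2 - cone_B\<^sup>2 * (sin w)\<^sup>2) has_real_derivative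
      2 * ((cone_A\<^sup>2 - cone_B\<^sup>2) * sin w * cos w)) (at w)"
    by (auto intro!: derivative_eq_intros simp: algebra_simps)
  from DERIV_chain2[OF DERIV_real_sqrt[OF conic_radicand[of w]] this]
  have "(conic_height has_real_derivative
      inverse (conic_height w) / 2 * (2 * ((cone_A\<^sup>2 - cone_B\<^sup>2) * sin w * cos w))) (at w)"
    unfolding conic_height_def[abs_def] .
  moreover have "inverse r / 2 * (2 * x) = x / r" for r x :: real
    by (cases "r = 0") (simp_all add: field_simps)
  ultimately show ?thesis by (simp only:)
qed

lemma conic_motion:
  assumes W: "(W has_real_derivative conic_speed (W t)) (at t)"
  shows "((\<lambda>t. conic_point (W t)) has_vector_derivative
    cross3 (f (conic_point (W t))) (conic_point (W t))) (at t)"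
proof -
  define w where "w = W t"
  define g where "g = conic_speed w"
  define h where "h = conic_height w"
  have h: "h > 0" unfolding h_def by (rule conic_height)
  have c: "((\<lambda>t. cone_A * cos (W t)) has_real_derivative - (cone_A * sin w * g)) (at t)"
    by (rule derivative_eq_intros W refl)+ (simp add: w_def g_def)
  have s: "((\<lambda>t. cone_B * sin (W t)) has_real_derivative cone_B * cos w * g) (at t)"
    by (rule derivative_eq_intros W refl)+ (simp add: w_def g_def)
  have hh: "((\<lambda>t. conic_height (W t)) has_real_derivative (cone_A\<^sup>2 - cone_B\<^sup>2) * sin w * cos w / h * g) (at t)"
    unfolding w_def g_def h_def by (rule DERIV_chain2[OF conic_height_derivative W])
  let ?d = "(- (cone_A * sin w * g)) *\<^sub>R e1 + (cone_B * cos w * g) *\<^sub>R e2 + ((cone_A\<^sup>2 - cone_B\<^sup>2) * sin w * cos w / h * g) *\<^sub>R e3"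
  have "((\<lambda>t. (cone_A * cos (W t)) *\<^sub>R e1 + (cone_B * sin (W t)) *\<^sub>R e2 + conic_height (W t) *\<^sub>R e3)
      has_vector_derivative ?d) (at t)"
    by (intro has_vector_derivative_add bounded_linear.has_vector_derivative[OF bounded_linear_scaleR_left])
      (use c s hh in \<open>simp_all add: real_derivative_iff\<close>)
  then have "((\<lambda>t. conic_point (W t)) has_vector_derivative ?d) (at t)"
    by (simp add: conic_point_def from_axes_def)
  moreover have "?d = cross3 (f (conic_point w)) (conic_point w)"
  proof (rule eq_axesI)
    have AB: "cone_A \<noteq> 0" "cone_B \<noteq> 0" using cone_AB by auto
    have g: "g * (cone_A * cone_B) = sgn l3 * l3 * h"
      unfolding g_def conic_speed_def h_def using AB by (simp add: sg_square(2))
    have "g * cone_A = - (sgn l3 * (l2 - l3) * cone_B * h)"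
    proof -
      have "g * cone_A * cone_B = - (sgn l3 * (l2 - l3) * cone_B * h) * cone_B"
        using g cone_AB(8) by algebra
      then show ?thesis using AB by (metis mult_cancel_right)
    qed
    then show "e1 \<bullet> ?d = e1 \<bullet> cross3 (f (conic_point w)) (conic_point w)"
      unfolding turning_axes conic_point_axes h_def[symmetric]
      by (simp add: inner_add_right inner_diff_right ortho) algebra
    have "g * cone_B = sgn l3 * (l3 - l1) * cone_A * h"
    proof -
      have "g * cone_B * cone_A = (sgn l3 * (l3 - l1) * cone_A * h) * cone_A"
        using g cone_AB(7) by algebra
      then show ?thesis using AB by (metis mult_cancel_right)
    qed
    then show "e2 \<bullet> ?d = e2 \<bullet> cross3 (f (conic_point w)) (conic_point w)"
      unfolding turning_axes conic_point_axes h_def[symmetric]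
      by (simp add: inner_add_right inner_diff_right ortho) algebra
    have "(cone_A\<^sup>2 - cone_B\<^sup>2) * g = sgn l3 * (l1 - l2) * cone_A * cone_B * h"
    proof -
      have "(cone_A\<^sup>2 - cone_B\<^sup>2) * l3 = (l1 - l2) * cone_A\<^sup>2 * cone_B\<^sup>2"
      proof -
        have "(cone_A\<^sup>2 - cone_B\<^sup>2) * l3 =
            cone_A\<^sup>2 * (cone_B\<^sup>2 * (l3 - l2)) - cone_B\<^sup>2 * (cone_A\<^sup>2 * (l3 - l1))"
          unfolding cone_AB(7,8) by (simp add: algebra_simps)
        then show ?thesis by (simp add: algebra_simps)
      qed
      then have "(cone_A\<^sup>2 - cone_B\<^sup>2) * g * (cone_A * cone_B) =
          (sgn l3 * (l1 - l2) * cone_A * cone_B * h) * (cone_A * cone_B)"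
        using g by algebra
      then show ?thesis using AB by (metis mult_cancel_right no_zero_divisors)
    qed
    moreover have "(cone_A\<^sup>2 - cone_B\<^sup>2) * sin w * cos w / h * g =
        ((cone_A\<^sup>2 - cone_B\<^sup>2) * g) * (sin w * cos w / h)" by simp
    ultimately have "(cone_A\<^sup>2 - cone_B\<^sup>2) * sin w * cos w / h * g =
        sgn l3 * (l1 - l2) * (cone_A * cos w) * (cone_B * sin w)"
      using h by simp
    then show "e3 \<bullet> ?d = e3 \<bullet> cross3 (f (conic_point w)) (conic_point w)"
      unfolding turning_axes conic_point_axes by (simp add: inner_add_right inner_diff_right ortho)
  qed
  ultimately show ?thesis by (simp add: w_def)
qed

text \<open>An angle function running through all reals, so that the flow below is defined for all times and
passes through every point of its oval. That is what allows both generating curves to be cut out of a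
single complete curve.\<close>

definition conic_angle :: "real \<Rightarrow> real" where
  "conic_angle = (SOME W. (\<forall>t. (W has_real_derivative conic_speed (W t)) (at t)) \<and> surj W)"

lemma conic_angle: "(conic_angle has_real_derivative conic_speed (conic_angle t)) (at t)" "surj conic_angle"
proof -
  have "continuous_on UNIV conic_speed"
    unfolding conic_speed_def[abs_def] conic_height_def[abs_def] by (intro continuous_intros) (use cone_AB in auto)
  moreover have "conic_speed w \<le> \<bar>l3\<bar> / (cone_A * cone_B)" for w
    unfolding conic_speed_def using conic_height[of w] cone_AB
    by (intro divide_right_mono) (simp_all add: mult_left_le)
  ultimately obtain W where "\<And>t. (W has_real_derivative conic_speed (W t)) (at t)" "surj W"
    using autonomous_solution_exists[of conic_speed] conic_speed_pos by metis
  then have "\<exists>W. (\<forall>t. (W has_real_derivative conic_speed (W t)) (at t)) \<and> surj W" by blast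
  from someI_ex[OF this] show "(conic_angle has_real_derivative conic_speed (conic_angle t)) (at t)" "surj conic_angle"
    unfolding conic_angle_def by blast+
qed

definition conic_flow :: "real \<Rightarrow> real^3" where
  "conic_flow t = conic_point (conic_angle t)"

lemma conic_flow_unit: "norm (conic_flow t) = 1" "f (conic_flow t) \<bullet> conic_flow t = 0"
  by (simp_all add: conic_flow_def conic_point_unit conic_point_isotropic)

lemma conic_flow_derivative:
  "(conic_flow has_vector_derivative cross3 (f (conic_flow t)) (conic_flow t)) (at t)"
  unfolding conic_flow_def[abs_def] by (rule conic_motion[OF conic_angle(1)])

text \<open>The right-hand side is polynomial in the components, so the polynomials in them are closed under
differentiation.\<close>

lemma autonomous_flow_smooth:
  assumes T: "\<And>t. (T has_vector_derivative cross3 (f (T t)) (T t)) (at t)"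
  shows "smooth_on UNIV T"
proof (rule smooth_on_coinduct[where X = "\<lambda>h. \<forall>i. (\<lambda>t. h t $ i) \<in> generated_functions UNIV (range (\<lambda>i t. T t $ i))"])
  let ?B = "range (\<lambda>i t. T t $ i)"
  let ?G = "generated_functions UNIV ?B"
  have c: "(\<lambda>t. T t $ i) \<in> ?G" for i
    by (rule generated_functions.base) blast
  then show "\<forall>i. (\<lambda>t. T t $ i) \<in> ?G" by blast
  have fc: "(\<lambda>t. f (T t) $ i) \<in> ?G" for i
  proof -
    have "(\<lambda>t. matrix f $ i $ 1 * T t $ 1 + matrix f $ i $ 2 * T t $ 2 + matrix f $ i $ 3 * T t $ 3) \<in> ?G"
      by (intro generated_functions.plus generated_functions.times generated_functions.const c)
    moreover have "f x $ i = matrix f $ i $ 1 * x $ 1 + matrix f $ i $ 2 * x $ 2 + matrix f $ i $ 3 * x $ 3" for x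
    proof -
      have "f x $ i = (matrix f *v x) $ i"
        using matrix_works[OF lin[unfolded linear_matrix_vector_mul_eq[symmetric]], of x] by simp
      then show ?thesis by (simp add: matrix_vector_mult_def sum_3)
    qed
    ultimately show ?thesis by simp
  qed
  have all3: "P 1 \<Longrightarrow> P 2 \<Longrightarrow> P 3 \<Longrightarrow> P i" for P and i :: 3 using exhaust_3 by metis
  have d: "(\<lambda>t. cross3 (f (T t)) (T t) $ i) \<in> ?G" for i
    by (rule all3[of "\<lambda>i. (\<lambda>t. cross3 (f (T t)) (T t) $ i) \<in> ?G"]; unfold cross_components)
      (intro generated_functions_diff generated_functions.times c fc)+
  fix h :: "real \<Rightarrow> real^3" assume h: "\<forall>i. (\<lambda>t. h t $ i) \<in> ?G"
  have "\<exists>g\<in>?G. \<forall>t\<in>UNIV. ((\<lambda>t. h t $ i) has_vector_derivative g t) (at t)" for i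
  proof (rule generated_functions_derivative)
    fix b assume "b \<in> ?B"
    then obtain j where "b = (\<lambda>t. T t $ j)" by blast
    then show "\<exists>g\<in>?G. \<forall>t\<in>UNIV. (b has_vector_derivative g t) (at t)"
      using T[unfolded has_vector_derivative_vec_iff]
      by (intro bexI[OF _ d[of j]]) simp
  qed (use h in blast)
  then obtain g where g: "\<And>i. g i \<in> ?G" "\<And>i t. ((\<lambda>t. h t $ i) has_vector_derivative g i t) (at t)"
    by (metis UNIV_I)
  show "\<exists>g. (\<forall>i. (\<lambda>t. g t $ i) \<in> ?G) \<and> (\<forall>t\<in>UNIV. (h has_vector_derivative g t) (at t))"
    by (rule exI[of _ "\<lambda>t. \<chi> i. g i t"]) (use g in \<open>auto simp: has_vector_derivative_vec_iff\<close>)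
qed simp

text \<open>The difference of two solutions of \<open>T' = v (f T \<times> T)\<close> of unit length satisfies a linear
differential inequality with factor twice the operator norm of \<open>f\<close> times the absolute value of \<open>v\<close>.\<close>

lemma follows_conic_flow:
  assumes T: "turning_direction I v T (\<lambda>s. f (T s))" and s0: "s0 \<in> I" "e3 \<bullet> T s0 > 0"
  obtains \<phi> where "\<And>s. s \<in> I \<Longrightarrow> (\<phi> has_real_derivative v s) (at s)" "\<And>s. s \<in> I \<Longrightarrow> T s = conic_flow (\<phi> s)"
proof -
  note T' = turning_directionD[OF T]
  obtain w where w: "T s0 = conic_point w"
    using conic_point_surj[of "T s0"] T'(4,6)[OF s0(1)] s0(2) by blast
  obtain t0 where t0: "conic_angle t0 = w" using conic_angle(2) by (metis surjD)
  obtain \<phi>0 where \<phi>0: "\<And>s. s \<in> I \<Longrightarrow> (\<phi>0 has_vector_derivative v s) (at s)"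
    using antiderivative_exists[OF T'(1,3)] by blast
  define \<phi> where "\<phi> = (\<lambda>s. \<phi>0 s - \<phi>0 s0 + t0)"
  have \<phi>: "(\<phi> has_real_derivative v s) (at s)" if "s \<in> I" for s
  proof -
    have "(\<phi>0 has_real_derivative v s) (at s)"
      using \<phi>0[OF that] by (simp add: real_derivative_iff)
    then show ?thesis unfolding \<phi>_def by (auto intro!: derivative_eq_intros)
  qed
  define F where "F = onorm f"
  have bl: "bounded_linear f" using lin by (simp add: linear_conv_bounded_linear)
  have F: "norm (f x) \<le> F * norm x" for x unfolding F_def by (rule onorm[OF bl])
  have cr: "norm (cross3 x y) \<le> norm x * norm y" for x y
  proof -
    have "(norm (cross3 x y))\<^sup>2 \<le> (norm x * norm y)\<^sup>2" unfolding norm_cross by (simp add: power_mult_distrib)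
    then show ?thesis by (rule power2_le_imp_le) simp
  qed
  define \<Gamma> where "\<Gamma> = (\<lambda>s. conic_flow (\<phi> s))"
  have "T s - \<Gamma> s = 0" if s: "s \<in> I" for s
  proof (rule linear_differential_inequality_zero[OF T'(1), of "\<lambda>s. \<bar>v s\<bar> * (2 * F)" "\<lambda>s. T s - \<Gamma> s"])
    show "continuous_on I (\<lambda>s. \<bar>v s\<bar> * (2 * F))" by (intro continuous_intros T'(3))
    show "T s0 - \<Gamma> s0 = 0" by (simp add: \<Gamma>_def \<phi>_def conic_flow_def t0 w)
    fix s assume s: "s \<in> I"
    have "(\<Gamma> has_vector_derivative v s *\<^sub>R cross3 (f (\<Gamma> s)) (\<Gamma> s)) (at s)"
      using vector_diff_chain_at[OF \<phi>[OF s, unfolded real_derivative_iff] conic_flow_derivative]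
      unfolding \<Gamma>_def by (simp add: o_def)
    from has_vector_derivative_diff[OF T'(7)[OF s] this]
    show "((\<lambda>s. T s - \<Gamma> s) has_vector_derivative
      v s *\<^sub>R cross3 (f (T s)) (T s) - v s *\<^sub>R cross3 (f (\<Gamma> s)) (\<Gamma> s)) (at s)" .
    define D where "D = T s - \<Gamma> s"
    have n: "norm (T s) = 1" "norm (\<Gamma> s) = 1" using T'(4)[OF s] by (simp_all add: \<Gamma>_def conic_flow_unit)
    have "cross3 (f (T s)) (T s) - cross3 (f (\<Gamma> s)) (\<Gamma> s) = cross3 (f D) (T s) + cross3 (f (\<Gamma> s)) D"
      unfolding D_def linear_diff[OF lin] by (simp add: Cross3.left_diff_distrib Cross3.right_diff_distrib)
    also have "norm \<dots> \<le> norm (cross3 (f D) (T s)) + norm (cross3 (f (\<Gamma> s)) D)" by (rule norm_triangle_ineq)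
    also have "\<dots> \<le> norm (f D) * norm (T s) + norm (f (\<Gamma> s)) * norm D" by (intro add_mono cr)
    also have "\<dots> \<le> F * norm D * 1 + F * 1 * norm D"
      using F[of D] F[of "\<Gamma> s"] unfolding n by (intro add_mono mult_right_mono) auto
    finally have b: "norm (cross3 (f (T s)) (T s) - cross3 (f (\<Gamma> s)) (\<Gamma> s)) \<le> 2 * F * norm D" by simp
    have "norm (v s *\<^sub>R cross3 (f (T s)) (T s) - v s *\<^sub>R cross3 (f (\<Gamma> s)) (\<Gamma> s))
      = \<bar>v s\<bar> * norm (cross3 (f (T s)) (T s) - cross3 (f (\<Gamma> s)) (\<Gamma> s))"
      by (simp add: scaleR_diff_right[symmetric])
    also have "\<dots> \<le> \<bar>v s\<bar> * (2 * F * norm D)" by (rule mult_left_mono[OF b]) simp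
    finally show "norm (v s *\<^sub>R cross3 (f (T s)) (T s) - v s *\<^sub>R cross3 (f (\<Gamma> s)) (\<Gamma> s)) \<le>
        \<bar>v s\<bar> * (2 * F) * norm (T s - \<Gamma> s)" by (simp add: D_def mult.assoc)
  qed (use s s0 in auto)
  then show ?thesis using that[OF \<phi>] by (simp add: \<Gamma>_def)
qed

end

section \<open>Curvature and torsion of the generating curve\<close>

text \<open>With \<open>y = k^2\<close> the hypotheses read \<open>y'^2 = P y\<close> and \<open>y'' = P' y / 2\<close> for the cubic polynomial
\<open>P y = - 4 (y^3 + c3 y^2 + c1 c2 y + c1^2)\<close>. In this form the equations are polynomial, and the second
one carries information also where \<open>y' = 0\<close>. The conclusions are the first-order equation for \<open>k\<close>
itself and, with torsion \<open>c1 / k^2\<close>, the equation for \<open>(k' / k)'\<close>.\<close>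

lemma curvature_ode_consequences:
  fixes k y1 :: "real \<Rightarrow> real"
  assumes I: "open I" and pos: "\<And>u. u \<in> I \<Longrightarrow> k u > 0"
    and d1: "\<And>u. u \<in> I \<Longrightarrow> ((\<lambda>u. (k u)\<^sup>2) has_real_derivative y1 u) (at u)"
    and d2: "\<And>u. u \<in> I \<Longrightarrow>
      (y1 has_real_derivative - 2 * (3 * (k u)^4 + 2 * c3 * (k u)\<^sup>2 + c1 * c2)) (at u)"
    and first: "\<And>u. u \<in> I \<Longrightarrow>
      (y1 u)\<^sup>2 = - 4 * ((k u)^6 + c3 * (k u)^4 + c1 * c2 * (k u)\<^sup>2 + c1\<^sup>2)"
    and s: "s \<in> I"
  shows "(k has_real_derivative y1 s / (2 * k s)) (at s)"
    and "(deriv k s)\<^sup>2 + (k s)^4 + c3 * (k s)\<^sup>2 + c1\<^sup>2 / (k s)\<^sup>2 + c1 * c2 = 0"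
    and "((\<lambda>u. deriv k u / k u) has_real_derivative
      - (k s)\<^sup>2 + c2 * (c1 / (k s)\<^sup>2) + 2 * (c1 / (k s)\<^sup>2)\<^sup>2) (at s)"
proof -
  have k: "(k has_real_derivative y1 u / (2 * k u)) (at u)" if u: "u \<in> I" for u
  proof -
    have "(k u)\<^sup>2 > 0" using pos[OF u] by simp
    from DERIV_chain2[OF DERIV_real_sqrt[OF this] d1[OF u]]
    have "((\<lambda>u. sqrt ((k u)\<^sup>2)) has_real_derivative y1 u / (2 * k u)) (at u)"
      using pos[OF u] by (simp add: field_simps)
    then show ?thesis
      by (rule has_field_derivative_transform_within_open[OF _ I u]) (use pos in \<open>auto simp: less_imp_le\<close>)
  qed
  show "(k has_real_derivative y1 s / (2 * k s)) (at s)" by (rule k[OF s])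
  have dk: "deriv k u = y1 u / (2 * k u)" if "u \<in> I" for u using k[OF that] by (rule DERIV_imp_deriv)
  have p: "k s > 0" by (rule pos[OF s])
  have "(deriv k s)\<^sup>2 = (y1 s)\<^sup>2 / (4 * (k s)\<^sup>2)" by (simp add: dk[OF s] power_divide power_mult_distrib)
  also have "\<dots> = - ((k s)^4 + c3 * (k s)\<^sup>2 + c1 * c2 + c1\<^sup>2 / (k s)\<^sup>2)"
    unfolding first[OF s] using p by (simp add: field_simps power_numeral_reduce)
  finally show "(deriv k s)\<^sup>2 + (k s)^4 + c3 * (k s)\<^sup>2 + c1\<^sup>2 / (k s)\<^sup>2 + c1 * c2 = 0" by simp
  have "((\<lambda>u. y1 u / (2 * (k u)\<^sup>2)) has_real_derivative
      (- 2 * (3 * (k s)^4 + 2 * c3 * (k s)\<^sup>2 + c1 * c2) * (2 * (k s)\<^sup>2) - y1 s * (2 * y1 s)) /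
      (2 * (k s)\<^sup>2 * (2 * (k s)\<^sup>2))) (at s)"
    by (rule DERIV_divide[OF d2[OF s] DERIV_cmult[OF d1[OF s]]]) (use p in simp)
  moreover have "(- 2 * (3 * (k s)^4 + 2 * c3 * (k s)\<^sup>2 + c1 * c2) * (2 * (k s)\<^sup>2) - y1 s * (2 * y1 s)) /
      (2 * (k s)\<^sup>2 * (2 * (k s)\<^sup>2)) = - (k s)\<^sup>2 + c2 * (c1 / (k s)\<^sup>2) + 2 * (c1 / (k s)\<^sup>2)\<^sup>2"
  proof -
    have e: "y1 s * (2 * y1 s) = 2 * (y1 s)\<^sup>2" by (simp add: power2_eq_square)
    show ?thesis unfolding e first[OF s] using p by (simp add: field_simps power_numeral_reduce)
  qed
  ultimately have "((\<lambda>u. y1 u / (2 * (k u)\<^sup>2)) has_real_derivative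
      - (k s)\<^sup>2 + c2 * (c1 / (k s)\<^sup>2) + 2 * (c1 / (k s)\<^sup>2)\<^sup>2) (at s)" by simp
  then show "((\<lambda>u. deriv k u / k u) has_real_derivative
      - (k s)\<^sup>2 + c2 * (c1 / (k s)\<^sup>2) + 2 * (c1 / (k s)\<^sup>2)\<^sup>2) (at s)"
    by (rule has_field_derivative_transform_within_open[OF _ I s])
      (use pos in \<open>auto simp: dk field_simps power2_eq_square\<close>)
qed

text \<open>Here \<open>X1\<close>, \<open>X2\<close>, \<open>X3\<close> are the squared coordinates of an isotropic unit vector, \<open>y\<close> is the squared
curvature and \<open>V\<close> the Vandermonde determinant up to sign. Each \<open>y + li lj\<close> factors because
\<open>(x - li) (x - lj) = x^2 - (li + lj) x + li lj\<close>, summed over the eigenvalues with weights \<open>X1\<close>, \<open>X2\<close>, \<open>X3\<close>,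
has only one nonzero term. The products of these factors give the other identities.\<close>

lemma isotropic_identities:
  fixes l1 l2 l3 :: real
  assumes sum: "X1 + X2 + X3 = 1" and iso: "l1 * X1 + l2 * X2 + l3 * X3 = 0"
  defines "y \<equiv> l1\<^sup>2 * X1 + l2\<^sup>2 * X2 + l3\<^sup>2 * X3"
    and "V \<equiv> l1\<^sup>2 * (l2 - l3) + l2\<^sup>2 * (l3 - l1) + l3\<^sup>2 * (l1 - l2)"
    and "c1 \<equiv> l1 * l2 * l3" and "c2 \<equiv> l1 + l2 + l3" and "c3 \<equiv> l1 * l2 + l1 * l3 + l2 * l3"
  shows "y + l1 * l2 = (l3 - l1) * (l3 - l2) * X3"
    and "4 * V\<^sup>2 * (X1 * X2 * X3) = - 4 * (y^3 + c3 * y\<^sup>2 + c1 * c2 * y + c1\<^sup>2)"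
    and "2 * V * ((l2 - l3) * (X2 * X3) + (l3 - l1) * (X3 * X1) + (l1 - l2) * (X1 * X2)) =
      - 2 * (3 * y\<^sup>2 + 2 * c3 * y + c1 * c2)"
    and "l1 * (l2 - l3)\<^sup>2 * (X2 * X3) + l2 * (l3 - l1)\<^sup>2 * (X3 * X1) + l3 * (l1 - l2)\<^sup>2 * (X1 * X2) = - c1"
proof -
  have y1: "y + l2 * l3 = (l1 - l2) * (l1 - l3) * X1" unfolding y_def using sum iso by algebra
  have y2: "y + l1 * l3 = (l2 - l1) * (l2 - l3) * X2" unfolding y_def using sum iso by algebra
  show y3: "y + l1 * l2 = (l3 - l1) * (l3 - l2) * X3" unfolding y_def using sum iso by algebra
  have V: "V = - ((l1 - l2) * (l2 - l3) * (l3 - l1))" unfolding V_def by algebra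
  have "V\<^sup>2 * (X1 * X2 * X3) = - ((y + l2 * l3) * (y + l1 * l3) * (y + l1 * l2))"
    unfolding V y1 y2 y3 by algebra
  also have "\<dots> = - (y^3 + c3 * y\<^sup>2 + c1 * c2 * y + c1\<^sup>2)" unfolding c1_def c2_def c3_def by algebra
  finally show "4 * V\<^sup>2 * (X1 * X2 * X3) = - 4 * (y^3 + c3 * y\<^sup>2 + c1 * c2 * y + c1\<^sup>2)" by simp
  have "V * ((l2 - l3) * (X2 * X3)) = - ((y + l1 * l3) * (y + l1 * l2))" unfolding V y1 y2 y3 by algebra
  moreover have "V * ((l3 - l1) * (X3 * X1)) = - ((y + l1 * l2) * (y + l2 * l3))" unfolding V y1 y2 y3 by algebra
  moreover have "V * ((l1 - l2) * (X1 * X2)) = - ((y + l2 * l3) * (y + l1 * l3))" unfolding V y1 y2 y3 by algebra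
  ultimately show "2 * V * ((l2 - l3) * (X2 * X3) + (l3 - l1) * (X3 * X1) + (l1 - l2) * (X1 * X2)) =
      - 2 * (3 * y\<^sup>2 + 2 * c3 * y + c1 * c2)"
    unfolding c1_def c2_def c3_def by algebra
  have "l1 * (l2 - l3)\<^sup>2 * (X2 * X3) + l2 * (l3 - l1)\<^sup>2 * (X3 * X1) + l3 * (l1 - l2)\<^sup>2 * (X1 * X2) =
      (l1 * X1 + l2 * X2 + l3 * X3) * (l2 * l3 * X1 + l1 * l3 * X2 + l1 * l2 * X3) - c1 * (X1 + X2 + X3)\<^sup>2"
    unfolding c1_def by algebra
  then show "l1 * (l2 - l3)\<^sup>2 * (X2 * X3) + l2 * (l3 - l1)\<^sup>2 * (X3 * X1) + l3 * (l1 - l2)\<^sup>2 * (X1 * X2) = - c1"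
    unfolding sum iso by simp
qed

lemma cubic_roots_of_symmetric_functions:
  "cubic_roots (l1 * l2 * l3) (l1 + l2 + l3) (l1 * l2 + l1 * l3 + l2 * l3) l1 l2 l3"
  unfolding cubic_roots_def by (intro allI) algebra

context principal_axes
begin

lemma product_sign: "sgn (l1 * l2 * l3) = sgn l3" "l1 * l2 * l3 \<noteq> 0"
proof -
  have "l1 * l2 > 0" using sign1 sign2 by (auto simp: mult_less_0_iff zero_less_mult_iff)
  then show "sgn (l1 * l2 * l3) = sgn l3" "l1 * l2 * l3 \<noteq> 0"
    using l3_nonzero by (auto simp only: sgn_mult[of "l1 * l2"] sgn_pos mult_1_left mult_eq_0_iff)
qed

text \<open>In the Frenet frame the curvature binormal is \<open>\<kappa> b = f T\<close>, so the curvature is the length of \<open>f T\<close>.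
Differentiating \<open>b = f T / \<kappa>\<close> gives \<open>\<kappa>^2 \<tau> = - f T' \<bullet> T'\<close>, which equals the determinant of \<open>f\<close> by
the last of the identities above. Thus \<open>c1\<close>, \<open>c2\<close> and \<open>c3\<close> are the coefficients of the characteristic
polynomial of \<open>f\<close>.\<close>

lemma unit_speed_curve_equations:
  assumes smooth: "smooth_on I \<gamma>"
    and T: "turning_direction I (\<lambda>s. 1) (vderiv \<gamma>) (\<lambda>s. f (vderiv \<gamma> s))"
  defines "c1 \<equiv> l1 * l2 * l3" and "c2 \<equiv> l1 + l2 + l3" and "c3 \<equiv> l1 * l2 + l1 * l3 + l2 * l3"
  shows "arc_length_curve I \<gamma>"
    and "s \<in> I \<Longrightarrow> curvature \<gamma> s > 0"
    and "s \<in> I \<Longrightarrow> (curvature \<gamma> s)\<^sup>2 + l1 * l2 = (l3 - l1) * (l3 - l2) * (e3 \<bullet> vderiv \<gamma> s)\<^sup>2"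
    and "s \<in> I \<Longrightarrow> torsion \<gamma> s = c1 / (curvature \<gamma> s)\<^sup>2"
    and "curvature_torsion_equations c1 c2 I \<gamma>"
    and "ode_solution c1 c2 c3 I (curvature \<gamma>)"
proof -
  note T' = turning_directionD[OF T]
  have op: "open I" by (rule T'(2))
  show "arc_length_curve I \<gamma>" unfolding arc_length_curve_def using T'(1,4) smooth by blast
  define V where "V = l1\<^sup>2 * (l2 - l3) + l2\<^sup>2 * (l3 - l1) + l3\<^sup>2 * (l1 - l2)"
  define x where "x = (\<lambda>s. e1 \<bullet> vderiv \<gamma> s)"
  define y where "y = (\<lambda>s. e2 \<bullet> vderiv \<gamma> s)"
  define z where "z = (\<lambda>s. e3 \<bullet> vderiv \<gamma> s)"
  define N where "N = (\<lambda>s. cross3 (f (vderiv \<gamma> s)) (vderiv \<gamma> s))"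
  define \<kappa> where "\<kappa> = curvature \<gamma>"
  have dT: "(vderiv \<gamma> has_vector_derivative N s) (at s)" if "s \<in> I" for s
    using T'(7)[OF that] by (simp add: N_def)
  have TT: "vderiv (vderiv \<gamma>) s = N s" if "s \<in> I" for s using dT[OF that] by (rule vector_derivative_at)
  have rel: "(x s)\<^sup>2 + (y s)\<^sup>2 + (z s)\<^sup>2 = 1" "l1 * (x s)\<^sup>2 + l2 * (y s)\<^sup>2 + l3 * (z s)\<^sup>2 = 0" if "s \<in> I" for s
    using isotropic_axes[OF T'(4)[OF that] T'(6)[OF that]] by (simp_all add: x_def y_def z_def)
  note ids = isotropic_identities[OF rel, folded c1_def c2_def c3_def V_def]
  have d: "(x has_real_derivative sgn l3 * (l2 - l3) * y s * z s) (at s)"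
    "(y has_real_derivative sgn l3 * (l3 - l1) * z s * x s) (at s)"
    "(z has_real_derivative sgn l3 * (l1 - l2) * x s * y s) (at s)" if "s \<in> I" for s
    unfolding real_derivative_iff x_def y_def z_def turning_axes[symmetric]
    by (rule inner_right_derivative[OF dT[OF that, unfolded N_def]])+
  have k2: "(\<kappa> s)\<^sup>2 = l1\<^sup>2 * (x s)\<^sup>2 + l2\<^sup>2 * (y s)\<^sup>2 + l3\<^sup>2 * (z s)\<^sup>2" if s: "s \<in> I" for s
  proof -
    have "(\<kappa> s)\<^sup>2 = (norm (f (vderiv \<gamma> s)))\<^sup>2"
      unfolding \<kappa>_def curvature_def TT[OF s] N_def norm_cross using T'(4,6)[OF s] by simp
    also have "\<dots> = f (vderiv \<gamma> s) \<bullet> f (vderiv \<gamma> s)" by (simp add: dot_square_norm)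
    finally show ?thesis
      by (simp add: inner_axes[of "f _"] f_axes x_def y_def z_def power2_eq_square)
  qed
  have pos: "\<kappa> s > 0" if s: "s \<in> I" for s
  proof -
    have "z s \<noteq> 0" using isotropic_height_nonzero[OF T'(4)[OF s] T'(6)[OF s]] by (simp add: z_def)
    then have "l3\<^sup>2 * (z s)\<^sup>2 > 0" using l3_nonzero by simp
    moreover have "l1\<^sup>2 * (x s)\<^sup>2 \<ge> 0" "l2\<^sup>2 * (y s)\<^sup>2 \<ge> 0" by simp_all
    ultimately have "(\<kappa> s)\<^sup>2 > 0" unfolding k2[OF s] by linarith
    then show ?thesis by (simp add: \<kappa>_def curvature_def)
  qed
  then show "s \<in> I \<Longrightarrow> curvature \<gamma> s > 0" by (simp add: \<kappa>_def)
  show "s \<in> I \<Longrightarrow> (curvature \<gamma> s)\<^sup>2 + l1 * l2 = (l3 - l1) * (l3 - l2) * (e3 \<bullet> vderiv \<gamma> s)\<^sup>2"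
    using ids(1) k2 by (simp add: \<kappa>_def z_def)
  define y1 where "y1 = (\<lambda>s. 2 * sgn l3 * V * (x s * y s * z s))"
  have d1: "((\<lambda>u. (\<kappa> u)\<^sup>2) has_real_derivative y1 s) (at s)" if s: "s \<in> I" for s
  proof -
    have "((\<lambda>s. l1\<^sup>2 * (x s)\<^sup>2 + l2\<^sup>2 * (y s)\<^sup>2 + l3\<^sup>2 * (z s)\<^sup>2) has_real_derivative y1 s) (at s)"
      by (rule derivative_eq_intros d[OF s] refl)+ (simp add: y1_def V_def algebra_simps power2_eq_square)
    then show ?thesis
      by (rule has_field_derivative_transform_within_open[OF _ op s]) (simp add: k2)
  qed
  have d2: "(y1 has_real_derivative - 2 * (3 * (\<kappa> s)^4 + 2 * c3 * (\<kappa> s)\<^sup>2 + c1 * c2)) (at s)" if s: "s \<in> I" for s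
  proof -
    have "(y1 has_real_derivative (sgn l3 * sgn l3) * (2 * V * ((l2 - l3) * ((y s)\<^sup>2 * (z s)\<^sup>2) +
        (l3 - l1) * ((z s)\<^sup>2 * (x s)\<^sup>2) + (l1 - l2) * ((x s)\<^sup>2 * (y s)\<^sup>2)))) (at s)"
      unfolding y1_def
      by (rule derivative_eq_intros d[OF s] refl)+ (simp add: algebra_simps power2_eq_square)
    moreover have "2 * V * ((l2 - l3) * ((y s)\<^sup>2 * (z s)\<^sup>2) + (l3 - l1) * ((z s)\<^sup>2 * (x s)\<^sup>2) +
        (l1 - l2) * ((x s)\<^sup>2 * (y s)\<^sup>2)) = - 2 * (3 * ((\<kappa> s)\<^sup>2)\<^sup>2 + 2 * c3 * (\<kappa> s)\<^sup>2 + c1 * c2)"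
      using ids(3)[OF s s] unfolding k2[OF s, symmetric] .
    ultimately show ?thesis unfolding sg_square by simp
  qed
  have first: "(y1 s)\<^sup>2 = - 4 * ((\<kappa> s)^6 + c3 * (\<kappa> s)^4 + c1 * c2 * (\<kappa> s)\<^sup>2 + c1\<^sup>2)" if s: "s \<in> I" for s
  proof -
    have "(y1 s)\<^sup>2 = (sgn l3 * sgn l3) * (4 * V\<^sup>2 * ((x s)\<^sup>2 * (y s)\<^sup>2 * (z s)\<^sup>2))"
      by (simp add: y1_def power2_eq_square)
    also have "\<dots> = - 4 * (((\<kappa> s)\<^sup>2)^3 + c3 * ((\<kappa> s)\<^sup>2)\<^sup>2 + c1 * c2 * (\<kappa> s)\<^sup>2 + c1\<^sup>2)"
      unfolding sg_square ids(2)[OF s s] k2[OF s, symmetric] by simp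
    finally show ?thesis by simp
  qed
  note ode = curvature_ode_consequences[OF op pos d1 d2 first, simplified]
  have tau: "torsion \<gamma> s = c1 / (\<kappa> s)\<^sup>2" if s: "s \<in> I" for s
  proof -
    have b: "frenet_b \<gamma> u = (1 / \<kappa> u) *\<^sub>R f (vderiv \<gamma> u)" if u: "u \<in> I" for u
      unfolding frenet_b_def frenet_n_def frenet_t_def TT[OF u] N_def \<kappa>_def
      using T'(5,6)[OF u] by (simp add: cross_mult_right Lagrange inner_commute)
    have dk: "((\<lambda>u. 1 / \<kappa> u) has_real_derivative - (1 / \<kappa> s * (y1 s / (2 * \<kappa> s)) * (1 / \<kappa> s))) (at s)"
      using DERIV_inverse'[OF ode(1)[OF s]] pos[OF s] by (simp add: inverse_eq_divide)
    have df: "((\<lambda>u. f (vderiv \<gamma> u)) has_vector_derivative f (N s)) (at s)"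
      by (rule bounded_linear.has_vector_derivative[OF _ dT[OF s]])
        (simp add: lin linear_conv_bounded_linear[symmetric])
    \<comment> \<open>the derivative \<open>q\<close> of \<open>1 / \<kappa>\<close> multiplies \<open>f T\<close>, which is orthogonal to the normal and drops out of the torsion\<close>
    obtain q where "((\<lambda>u. (1 / \<kappa> u) *\<^sub>R f (vderiv \<gamma> u)) has_vector_derivative
        (1 / \<kappa> s) *\<^sub>R f (N s) + q *\<^sub>R f (vderiv \<gamma> s)) (at s)"
      using has_vector_derivative_scaleR[OF dk df] by blast
    then have "(frenet_b \<gamma> has_vector_derivative (1 / \<kappa> s) *\<^sub>R f (N s) + q *\<^sub>R f (vderiv \<gamma> s)) (at s)"
      by (rule has_vector_derivative_transform_within_open[OF _ op s]) (simp add: b)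
    then have b': "vderiv (frenet_b \<gamma>) s = (1 / \<kappa> s) *\<^sub>R f (N s) + q *\<^sub>R f (vderiv \<gamma> s)"
      by (rule vector_derivative_at)
    have n: "frenet_n \<gamma> s = (1 / \<kappa> s) *\<^sub>R N s"
      unfolding frenet_n_def frenet_t_def[abs_def] \<kappa>_def using TT[OF s] by simp
    have "f (vderiv \<gamma> s) \<bullet> N s = 0" by (simp add: N_def dot_cross_self)
    then have "torsion \<gamma> s = - (f (N s) \<bullet> N s) / (\<kappa> s)\<^sup>2"
      unfolding torsion_def b' n by (simp add: inner_add_left power2_eq_square)
    also have "f (N s) \<bullet> N s = (sgn l3 * sgn l3) * (l1 * (l2 - l3)\<^sup>2 * ((y s)\<^sup>2 * (z s)\<^sup>2) +
        l2 * (l3 - l1)\<^sup>2 * ((z s)\<^sup>2 * (x s)\<^sup>2) + l3 * (l1 - l2)\<^sup>2 * ((x s)\<^sup>2 * (y s)\<^sup>2))"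
      unfolding inner_axes[of "f _"] f_axes N_def turning_axes x_def y_def z_def
      by (simp add: power2_eq_square algebra_simps)
    also have "\<dots> = - c1" unfolding sg_square ids(4)[OF s s] by simp
    finally show ?thesis by simp
  qed
  then show "s \<in> I \<Longrightarrow> torsion \<gamma> s = c1 / (curvature \<gamma> s)\<^sup>2" by (simp add: \<kappa>_def)
  have c1: "c1 \<noteq> 0" unfolding c1_def by (rule product_sign)
  show "curvature_torsion_equations c1 c2 I \<gamma>"
    unfolding curvature_torsion_equations_def \<kappa>_def[symmetric]
  proof (intro ballI conjI)
    fix s assume s: "s \<in> I"
    have p: "\<kappa> s > 0" by (rule pos[OF s])
    show "(\<kappa> s)\<^sup>2 * torsion \<gamma> s = c1" unfolding tau[OF s] using p by simp
    have "deriv (\<lambda>u. deriv \<kappa> u / \<kappa> u) s = - (\<kappa> s)\<^sup>2 + c2 * (c1 / (\<kappa> s)\<^sup>2) + 2 * (c1 / (\<kappa> s)\<^sup>2)\<^sup>2"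
      using DERIV_imp_deriv[OF ode(3)[OF s]] by simp
    then show "1 / torsion \<gamma> s * deriv (\<lambda>u. deriv \<kappa> u / \<kappa> u) s + (\<kappa> s)\<^sup>2 / torsion \<gamma> s - 2 * torsion \<gamma> s = c2"
      unfolding tau[OF s] using p c1 by (simp add: field_simps power2_eq_square)
  qed
  show "ode_solution c1 c2 c3 I (curvature \<gamma>)"
    unfolding ode_solution_def \<kappa>_def[symmetric]
  proof (intro ballI conjI)
    fix s assume s: "s \<in> I"
    show "\<kappa> differentiable at s" using ode(1)[OF s] real_differentiable_def by blast
    show "(deriv \<kappa> s)\<^sup>2 + (\<kappa> s)^4 + c3 * (\<kappa> s)\<^sup>2 + c1\<^sup>2 / (\<kappa> s)\<^sup>2 + c1 * c2 = 0"
      using ode(2)[OF s] by simp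
  qed
qed

lemma unit_speed_curve_explicit_form:
  assumes smooth: "smooth_on I \<gamma>"
    and T: "turning_direction I (\<lambda>s. 1) (vderiv \<gamma>) (\<lambda>s. f (vderiv \<gamma> s))"
    and \<phi>: "\<And>s. s \<in> I \<Longrightarrow> (\<phi> has_real_derivative 1) (at s)"
    and flow: "\<And>s. s \<in> I \<Longrightarrow> vderiv \<gamma> s = conic_flow (\<phi> s)"
  shows "explicit_form (sgn (l1 * l2 * l3)) l1 l2 l3 I \<gamma>"
proof -
  note T' = turning_directionD[OF T]
  define w where "w = (\<lambda>s. conic_angle (\<phi> s))"
  have dw: "(w has_real_derivative conic_speed (w s)) (at s)" if "s \<in> I" for s
    unfolding w_def using DERIV_chain2[OF conic_angle(1) \<phi>[OF that]] by simp
  have point: "vderiv \<gamma> s = conic_point (w s)" if "s \<in> I" for s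
    unfolding flow[OF that] conic_flow_def w_def ..
  have speed: "conic_speed (w s) = sqrt ((curvature \<gamma> s)\<^sup>2 + l1 * l2)" if s: "s \<in> I" for s
  proof -
    have "(conic_speed (w s))\<^sup>2 = l3\<^sup>2 * (conic_height (w s))\<^sup>2 / (cone_A\<^sup>2 * cone_B\<^sup>2)"
      by (simp add: conic_speed_def power_divide power_mult_distrib)
    also have "\<dots> = (l3 - l1) * (l3 - l2) * (conic_height (w s))\<^sup>2"
      unfolding cone_AB(3,4) using l3_nonzero by (simp add: power2_eq_square)
    also have "\<dots> = (curvature \<gamma> s)\<^sup>2 + l1 * l2"
      unfolding unit_speed_curve_equations(3)[OF smooth T s] point[OF s] conic_point_axes ..
    finally show ?thesis using conic_speed_pos[of "w s"] by (simp add: real_sqrt_unique)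
  qed
  have w: "continuous_on I w" using dw by (meson DERIV_isCont continuous_at_imp_continuous_on)
  have anti: "\<exists>F. \<forall>s\<in>I. (F has_real_derivative g s) (at s)" if "continuous_on I g" for g
    using antiderivative_exists[OF T'(1) that] by (metis real_derivative_iff)
  obtain X1 where X1: "\<forall>s\<in>I. (X1 has_real_derivative cos (w s)) (at s)"
    using anti[of "\<lambda>s. cos (w s)"] w by (auto intro: continuous_intros)
  obtain X2 where X2: "\<forall>s\<in>I. (X2 has_real_derivative sin (w s)) (at s)"
    using anti[of "\<lambda>s. sin (w s)"] w by (auto intro: continuous_intros)
  have "continuous_on I (\<lambda>s. conic_height (w s))"
    unfolding conic_height_def by (intro continuous_intros w)
  then obtain X3 where X3: "\<forall>s\<in>I. (X3 has_real_derivative conic_height (w s)) (at s)"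
    using anti by blast
  define Y where "Y = (\<lambda>s. from_axes (vector [cone_A * X1 s, cone_B * X2 s, X3 s]))"
  have Y: "(Y has_vector_derivative vderiv \<gamma> s) (at s)" if s: "s \<in> I" for s
  proof -
    have "((\<lambda>s. (cone_A * X1 s) *\<^sub>R e1 + (cone_B * X2 s) *\<^sub>R e2 + X3 s *\<^sub>R e3) has_vector_derivative
        (cone_A * cos (w s)) *\<^sub>R e1 + (cone_B * sin (w s)) *\<^sub>R e2 + conic_height (w s) *\<^sub>R e3) (at s)"
      by (intro has_vector_derivative_add bounded_linear.has_vector_derivative[OF bounded_linear_scaleR_left]
          has_vector_derivative_mult_right)
        (use X1 X2 X3 s in \<open>simp_all add: real_derivative_iff\<close>)
    then show ?thesis unfolding point[OF s] by (simp add: Y_def conic_point_def from_axes_def)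
  qed
  obtain s0 where s0: "s0 \<in> I" using T'(1) by (auto simp: open_interval_def)
  define p where "p = \<gamma> s0 - Y s0"
  have \<gamma>: "\<gamma> s = p + Y s" if s: "s \<in> I" for s
    unfolding p_def by (rule translate_of_equal_derivative[OF T'(1) smooth_on_has_vderiv[OF smooth] Y s0 s])
  have iso: "isometry_with_det (sgn (l1 * l2 * l3)) (\<lambda>x. p + from_axes x)"
    unfolding isometry_with_det_def product_sign(1)
    using orthogonal_from_axes det_from_axes by blast
  show ?thesis
    unfolding explicit_form_def Let_def cone_A_def[symmetric] cone_B_def[symmetric] conic_height_def[symmetric]
    by (rule exI[of _ w], rule exI[of _ X1], rule exI[of _ X2], rule exI[of _ X3], rule exI[of _ "\<lambda>x. p + from_axes x"])
      (use dw speed X1 X2 X3 iso \<gamma> in \<open>simp add: antiderivative_on_def Y_def\<close>)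
qed

end

section \<open>The Frenet frame\<close>

lemma has_vector_derivative_cross3:
  assumes "(f has_vector_derivative f') (at s)" "(g has_vector_derivative g') (at s)"
  shows "((\<lambda>s. cross3 (f s) (g s)) has_vector_derivative cross3 (f s) g' + cross3 f' (g s)) (at s)"
proof -
  have "bounded_bilinear cross3" using bilinear_cross by (simp add: bilinear_conv_bounded_bilinear)
  from bounded_bilinear.has_vector_derivative[OF this assms] show ?thesis .
qed

lemma has_vector_derivative_inner:
  assumes "(f has_vector_derivative f') (at s)" "(g has_vector_derivative g') (at s)"
  shows "((\<lambda>s. f s \<bullet> g s) has_vector_derivative f s \<bullet> g' + f' \<bullet> g s) (at s)"
  by (rule bounded_bilinear.has_vector_derivative[OF bounded_bilinear_inner assms])

lemma curvature_smooth:
  assumes \<alpha>: "arc_length_curve I \<alpha>" and pos: "\<And>s. s \<in> I \<Longrightarrow> curvature \<alpha> s > 0"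
  shows "smooth_on I (curvature \<alpha>)"
proof -
  have "open I" "smooth_on I \<alpha>" using \<alpha> by (auto simp: arc_length_curve_def open_interval_def)
  moreover have "vderiv (vderiv \<alpha>) s \<noteq> 0" if "s \<in> I" for s
    using pos[OF that] by (auto simp: curvature_def)
  ultimately have "smooth_on I (\<lambda>s. norm (vderiv (vderiv \<alpha>) s))"
    by (intro smooth_on_norm smooth_on_vderiv) auto
  then show ?thesis by (simp add: curvature_def[abs_def])
qed

lemma frenet_frame:
  assumes \<alpha>: "arc_length_curve I \<alpha>" and pos: "\<And>s. s \<in> I \<Longrightarrow> curvature \<alpha> s > 0" and s: "s \<in> I"
  shows "frenet_t \<alpha> s \<bullet> frenet_t \<alpha> s = 1" "frenet_n \<alpha> s \<bullet> frenet_n \<alpha> s = 1"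
    "frenet_b \<alpha> s \<bullet> frenet_b \<alpha> s = 1" "frenet_t \<alpha> s \<bullet> frenet_n \<alpha> s = 0"
    "frenet_t \<alpha> s \<bullet> frenet_b \<alpha> s = 0" "frenet_n \<alpha> s \<bullet> frenet_b \<alpha> s = 0"
    and "x = (frenet_t \<alpha> s \<bullet> x) *\<^sub>R frenet_t \<alpha> s + (frenet_n \<alpha> s \<bullet> x) *\<^sub>R frenet_n \<alpha> s
      + (frenet_b \<alpha> s \<bullet> x) *\<^sub>R frenet_b \<alpha> s"
proof -
  have op: "open I" and sm: "smooth_on I \<alpha>" and unit: "\<And>u. u \<in> I \<Longrightarrow> norm (vderiv \<alpha> u) = 1"
    using \<alpha> by (auto simp: arc_length_curve_def open_interval_def)
  have d: "(vderiv \<alpha> has_vector_derivative vderiv (vderiv \<alpha>) s) (at s)"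
    by (rule smooth_on_has_vderiv[OF smooth_on_vderiv[OF sm] s])
  show tt: "frenet_t \<alpha> s \<bullet> frenet_t \<alpha> s = 1" using unit[OF s] by (simp add: frenet_t_def dot_square_norm)
  have "vderiv \<alpha> s \<bullet> vderiv (vderiv \<alpha>) s + vderiv (vderiv \<alpha>) s \<bullet> vderiv \<alpha> s = 0"
    by (rule zero_derivative_of_constant_on[OF op s has_vector_derivative_inner[OF d d], of 1])
      (simp add: dot_square_norm unit)
  then show tn: "frenet_t \<alpha> s \<bullet> frenet_n \<alpha> s = 0"
    by (simp add: frenet_t_def[abs_def] frenet_n_def inner_commute)
  show nn: "frenet_n \<alpha> s \<bullet> frenet_n \<alpha> s = 1"
    using pos[OF s] by (simp add: frenet_n_def frenet_t_def[abs_def] curvature_def dot_square_norm power2_eq_square)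
  show bb: "frenet_b \<alpha> s \<bullet> frenet_b \<alpha> s = 1" unfolding frenet_b_def dot_cross using tt tn nn by (simp add: inner_commute)
  show tb: "frenet_t \<alpha> s \<bullet> frenet_b \<alpha> s = 0" "frenet_n \<alpha> s \<bullet> frenet_b \<alpha> s = 0"
    by (simp_all add: frenet_b_def dot_cross_self)
  show "x = (frenet_t \<alpha> s \<bullet> x) *\<^sub>R frenet_t \<alpha> s + (frenet_n \<alpha> s \<bullet> x) *\<^sub>R frenet_n \<alpha> s
      + (frenet_b \<alpha> s \<bullet> x) *\<^sub>R frenet_b \<alpha> s"
    by (rule orthonormal_expansion(1)[OF tt nn bb tn tb])
qed

lemma frenet_equations:
  assumes \<alpha>: "arc_length_curve I \<alpha>" and pos: "\<And>s. s \<in> I \<Longrightarrow> curvature \<alpha> s > 0" and s: "s \<in> I"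
  shows "(frenet_t \<alpha> has_vector_derivative curvature \<alpha> s *\<^sub>R frenet_n \<alpha> s) (at s)"
    and "(frenet_n \<alpha> has_vector_derivative
      - curvature \<alpha> s *\<^sub>R frenet_t \<alpha> s + torsion \<alpha> s *\<^sub>R frenet_b \<alpha> s) (at s)"
    and "(frenet_b \<alpha> has_vector_derivative - torsion \<alpha> s *\<^sub>R frenet_n \<alpha> s) (at s)"
proof -
  note frame = frenet_frame[OF \<alpha> pos s]
  have op: "open I" and sm: "smooth_on I \<alpha>"
    using \<alpha> by (auto simp: arc_length_curve_def open_interval_def)
  have "(vderiv \<alpha> has_vector_derivative vderiv (vderiv \<alpha>) s) (at s)"
    by (rule smooth_on_has_vderiv[OF smooth_on_vderiv[OF sm] s])
  then show t': "(frenet_t \<alpha> has_vector_derivative curvature \<alpha> s *\<^sub>R frenet_n \<alpha> s) (at s)"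
    using pos[OF s] by (simp add: frenet_t_def[abs_def] frenet_n_def)
  have d2: "(vderiv (frenet_t \<alpha>) has_vector_derivative vderiv (vderiv (vderiv \<alpha>)) s) (at s)"
    unfolding frenet_t_def[abs_def]
    by (rule smooth_on_has_vderiv[OF smooth_on_vderiv[OF smooth_on_vderiv[OF sm]] s])
  have "(curvature \<alpha> has_real_derivative vderiv (curvature \<alpha>) s) (at s)"
    unfolding real_derivative_iff
    by (rule smooth_on_has_vderiv[OF curvature_smooth[OF \<alpha> pos] s])
  from DERIV_inverse'[OF this] obtain r where
    "((\<lambda>u. 1 / curvature \<alpha> u) has_real_derivative r) (at s)"
    using pos[OF s] by (auto simp: inverse_eq_divide)
  from has_vector_derivative_scaleR[OF this d2] obtain N where
    n': "(frenet_n \<alpha> has_vector_derivative N) (at s)"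
    unfolding frenet_n_def[abs_def] by blast
  have "frenet_n \<alpha> s \<bullet> N + N \<bullet> frenet_n \<alpha> s = 0"
    by (rule zero_derivative_of_constant_on[OF op s has_vector_derivative_inner[OF n' n'], of 1])
      (rule frenet_frame(2)[OF \<alpha> pos])
  then have nN: "frenet_n \<alpha> s \<bullet> N = 0" by (simp add: inner_commute)
  have "frenet_t \<alpha> s \<bullet> N + (curvature \<alpha> s *\<^sub>R frenet_n \<alpha> s) \<bullet> frenet_n \<alpha> s = 0"
    by (rule zero_derivative_of_constant_on[OF op s has_vector_derivative_inner[OF t' n'], of 0])
      (rule frenet_frame(4)[OF \<alpha> pos])
  then have tN: "frenet_t \<alpha> s \<bullet> N = - curvature \<alpha> s" by (simp add: frame)
  have b': "(frenet_b \<alpha> has_vector_derivative cross3 (frenet_t \<alpha> s) N) (at s)"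
    using has_vector_derivative_cross3[OF t' n'] by (simp add: frenet_b_def[abs_def] cross_mult_left)
  have "torsion \<alpha> s = - (cross3 (frenet_t \<alpha> s) N \<bullet> frenet_n \<alpha> s)"
    unfolding torsion_def vector_derivative_at[OF b'] ..
  also have "\<dots> = frenet_b \<alpha> s \<bullet> N" unfolding frenet_b_def by (simp add: cross3_simps)
  finally have bN: "frenet_b \<alpha> s \<bullet> N = torsion \<alpha> s" by simp
  have N: "N = - curvature \<alpha> s *\<^sub>R frenet_t \<alpha> s + torsion \<alpha> s *\<^sub>R frenet_b \<alpha> s"
    using frame(7)[of N] by (simp add: tN nN bN)
  show "(frenet_n \<alpha> has_vector_derivative
      - curvature \<alpha> s *\<^sub>R frenet_t \<alpha> s + torsion \<alpha> s *\<^sub>R frenet_b \<alpha> s) (at s)"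
    using n' unfolding N .
  have "cross3 (frenet_t \<alpha> s) N = - torsion \<alpha> s *\<^sub>R frenet_n \<alpha> s"
    unfolding N frenet_b_def using frame(1,4)
    by (simp add: cross_add_right cross_mult_right Lagrange Cross3.right_diff_distrib)
  then show "(frenet_b \<alpha> has_vector_derivative - torsion \<alpha> s *\<^sub>R frenet_n \<alpha> s) (at s)"
    using b' by simp
qed

lemma plane_curve_torsion_zero:
  assumes \<alpha>: "arc_length_curve I \<alpha>" and pos: "\<And>s. s \<in> I \<Longrightarrow> curvature \<alpha> s > 0" and s: "s \<in> I"
    and plane: "plane_curve I \<alpha>"
  shows "torsion \<alpha> s = 0"
proof -
  obtain p d where p: "p \<noteq> 0" "\<And>u. u \<in> I \<Longrightarrow> p \<bullet> \<alpha> u = d" using plane unfolding plane_curve_def by blast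
  have op: "open I" and sm: "smooth_on I \<alpha>"
    using \<alpha> by (auto simp: arc_length_curve_def open_interval_def)
  have t: "p \<bullet> frenet_t \<alpha> u = 0" if u: "u \<in> I" for u
    unfolding frenet_t_def
    by (rule zero_derivative_of_constant_on[OF op u inner_right_derivative[OF smooth_on_has_vderiv[OF sm u]] p(2)])
  have n: "p \<bullet> frenet_n \<alpha> u = 0" if u: "u \<in> I" for u
  proof -
    have "p \<bullet> (curvature \<alpha> u *\<^sub>R frenet_n \<alpha> u) = 0"
      by (rule zero_derivative_of_constant_on[OF op u inner_right_derivative[OF frenet_equations(1)[OF \<alpha> pos u]] t])
    then show ?thesis using pos[OF u] by simp
  qed
  have "p \<bullet> (- curvature \<alpha> s *\<^sub>R frenet_t \<alpha> s + torsion \<alpha> s *\<^sub>R frenet_b \<alpha> s) = 0"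
    by (rule zero_derivative_of_constant_on[OF op s inner_right_derivative[OF frenet_equations(2)[OF \<alpha> pos s]] n])
  then have "torsion \<alpha> s * (frenet_b \<alpha> s \<bullet> p) = 0" using t[OF s] by (simp add: inner_diff_right inner_commute)
  moreover have "frenet_b \<alpha> s \<bullet> p \<noteq> 0"
    using frenet_frame(7)[OF \<alpha> pos s, of p] t[OF s] n[OF s] p(1) by (auto simp: inner_commute)
  ultimately show ?thesis by simp
qed

section \<open>Curves with prescribed curvature and torsion generate minimal surfaces\<close>

lemma cubic_roots_coefficients:
  assumes "cubic_roots c1 c2 c3 l1 l2 l3"
  shows "c1 = l1 * l2 * l3" "c2 = l1 + l2 + l3" "c3 = l1 * l2 + l1 * l3 + l2 * l3"
proof -
  have 1: "- (x^3) + c2 * x\<^sup>2 - c3 * x + c1 = - ((x - l1) * (x - l2) * (x - l3))" for x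
    using assms unfolding cubic_roots_def by blast
  show c1: "c1 = l1 * l2 * l3" using 1[of 0] by simp
  have "c2 - c3 = l1 + l2 + l3 - (l1 * l2 + l1 * l3 + l2 * l3)" using 1[of 1] c1 by (simp add: algebra_simps)
  moreover have "c2 + c3 = l1 + l2 + l3 + (l1 * l2 + l1 * l3 + l2 * l3)" using 1[of "-1"] c1 by (simp add: algebra_simps)
  ultimately show "c2 = l1 + l2 + l3" "c3 = l1 * l2 + l1 * l3 + l2 * l3" by linarith+
qed

text \<open>A first-order equation \<open>y'^2 = P y\<close> with simple roots also has solutions that rest at a root for a
while and then leave it; for these the surface would fail to be minimal. They are not twice
continuously differentiable. Differentiating the equation gives \<open>y' z = 0\<close> for the defect
\<open>z = y'' - P' y / 2\<close>. Where \<open>z\<close> does not vanish, \<open>y\<close> is locally constant and a root of \<open>P\<close>, so \<open>z\<close> has a finite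
range; being continuous it is constant, and a nonzero constant would make \<open>y\<close> constant everywhere.\<close>

lemma nonconstant_solution_second_derivative:
  fixes \<kappa> k1 k2 :: "real \<Rightarrow> real"
  assumes I: "open_interval I" and pos: "\<And>s. s \<in> I \<Longrightarrow> \<kappa> s > 0"
    and d1: "\<And>s. s \<in> I \<Longrightarrow> (\<kappa> has_real_derivative k1 s) (at s)"
    and d2: "\<And>s. s \<in> I \<Longrightarrow> (k1 has_real_derivative k2 s) (at s)" and cont: "continuous_on I k2"
    and first: "\<And>s. s \<in> I \<Longrightarrow>
      (2 * \<kappa> s * k1 s)\<^sup>2 = - 4 * ((\<kappa> s)^6 + c3 * (\<kappa> s)^4 + c1 * c2 * (\<kappa> s)\<^sup>2 + c1\<^sup>2)"
    and roots: "cubic_roots c1 c2 c3 l1 l2 l3" and nc: "\<not> \<kappa> constant_on I" and s: "s \<in> I"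
  shows "2 * (k1 s)\<^sup>2 + 2 * \<kappa> s * k2 s = - 2 * (3 * (\<kappa> s)^4 + 2 * c3 * (\<kappa> s)\<^sup>2 + c1 * c2)"
proof -
  have op: "open I" and conn: "connected I" using I by (auto simp: open_interval_def is_interval_connected)
  note c = cubic_roots_coefficients[OF roots]
  define y2 where "y2 = (\<lambda>s. 2 * (k1 s)\<^sup>2 + 2 * \<kappa> s * k2 s)"
  define P where "P = (\<lambda>x::real. 3 * x\<^sup>2 + 2 * c3 * x + c1 * c2)"
  define z where "z = (\<lambda>s. y2 s + 2 * P ((\<kappa> s)\<^sup>2))"
  have \<kappa>c: "continuous_on I \<kappa>" using d1 by (meson DERIV_isCont continuous_at_imp_continuous_on)
  have k1c: "continuous_on I k1" using d2 by (meson DERIV_isCont continuous_at_imp_continuous_on)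
  have zc: "continuous_on I z" unfolding z_def y2_def P_def by (intro continuous_intros \<kappa>c k1c cont)
  have y2: "((\<lambda>s. 2 * \<kappa> s * k1 s) has_real_derivative y2 s) (at s)" if s: "s \<in> I" for s
    by (rule derivative_eq_intros d1[OF s] d2[OF s] refl)+ (simp add: y2_def power2_eq_square)
  have prod: "(2 * \<kappa> s * k1 s) * z s = 0" if s: "s \<in> I" for s
  proof -
    have "((\<lambda>s. (2 * \<kappa> s * k1 s)\<^sup>2 + 4 * ((\<kappa> s)^6 + c3 * (\<kappa> s)^4 + c1 * c2 * (\<kappa> s)\<^sup>2 + c1\<^sup>2))
        has_real_derivative 2 * ((2 * \<kappa> s * k1 s) * z s)) (at s)"
      by (rule derivative_eq_intros y2[OF s] d1[OF s] refl)+
        (simp add: z_def P_def algebra_simps power_numeral_reduce)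
    then have "2 * ((2 * \<kappa> s * k1 s) * z s) = 0"
      unfolding real_derivative_iff
      by (rule zero_derivative_of_constant_on[OF op s, of _ _ 0]) (simp add: first)
    then show ?thesis by simp
  qed
  have opz: "open (I \<inter> z -` (- {0}))"
    by (rule continuous_open_preimage[OF zc op]) auto
  have crit: "k1 s = 0 \<and> y2 s = 0" if s: "s \<in> I" "z s \<noteq> 0" for s
  proof -
    have k1: "k1 u = 0" if "u \<in> I \<inter> z -` (- {0})" for u
      using prod[of u] pos[of u] that by auto
    have y2s: "((\<lambda>s. 2 * \<kappa> s * k1 s) has_vector_derivative y2 s) (at s)"
      using y2[OF s(1)] by (simp add: real_derivative_iff)
    have "y2 s = 0"
      by (rule zero_derivative_of_constant_on[OF opz _ y2s, of 0]) (use k1 s in auto)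
    then show ?thesis using k1 s by auto
  qed
  have "z s \<in> {0, 2 * P (- (l1 * l2)), 2 * P (- (l1 * l3)), 2 * P (- (l2 * l3))}" if s: "s \<in> I" for s
  proof (cases "z s = 0")
    case False
    note k = crit[OF s False]
    have "0 = (\<kappa> s)^6 + c3 * (\<kappa> s)^4 + c1 * c2 * (\<kappa> s)\<^sup>2 + c1\<^sup>2"
      using first[OF s] k by simp
    also have "\<dots> = ((\<kappa> s)\<^sup>2 + l1 * l2) * ((\<kappa> s)\<^sup>2 + l1 * l3) * ((\<kappa> s)\<^sup>2 + l2 * l3)"
      unfolding c by algebra
    finally have "(\<kappa> s)\<^sup>2 = - (l1 * l2) \<or> (\<kappa> s)\<^sup>2 = - (l1 * l3) \<or> (\<kappa> s)\<^sup>2 = - (l2 * l3)"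
      by (auto simp: eq_neg_iff_add_eq_0)
    then show ?thesis using k by (auto simp: z_def)
  qed auto
  then have "finite (z ` I)" by (meson finite.simps finite_subset image_subsetI)
  from continuous_finite_range_constant[OF conn zc this] obtain a where a: "\<And>s. s \<in> I \<Longrightarrow> z s = a"
    unfolding constant_on_def by blast
  have "a = 0"
  proof (rule ccontr)
    assume "a \<noteq> 0"
    then have k: "k1 u = 0" if "u \<in> I" for u using crit a that by blast
    have "\<kappa> u = \<kappa> s" if u: "u \<in> I" for u
    proof (rule constant_of_zero_derivative[OF I _ s u])
      fix t assume "t \<in> I"
      then show "(\<kappa> has_vector_derivative 0) (at t)"
        using d1[of t] k[of t] by (simp add: real_derivative_iff)
    qed
    then show False using nc unfolding constant_on_def by blast
  qed
  then have "z s = 0" using a[OF s] by simp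
  then show ?thesis by (simp add: z_def y2_def P_def power_mult[symmetric])
qed

text \<open>The quadratic form of the operator \<open>f\<close> with \<open>f t = \<kappa> b\<close>, written in the Frenet frame: its matrix there
has the rows \<open>(0, 0, \<kappa>)\<close>, \<open>(0, - \<tau>, m)\<close> and \<open>(\<kappa>, m, c2 + \<tau>)\<close> with \<open>m = \<kappa>' / \<kappa>\<close>. The entries are forced by
\<open>f t = \<kappa> b\<close> and its derivative together with trace \<open>c2\<close>, and the curvature and torsion equations say exactly
that the form is the same at all points of the curve.\<close>

lemma frenet_form_constant:
  fixes p q :: "real^3"
  assumes \<alpha>: "arc_length_curve I \<alpha>" and pos: "\<And>s. s \<in> I \<Longrightarrow> curvature \<alpha> s > 0"
    and tau: "\<And>s. s \<in> I \<Longrightarrow> torsion \<alpha> s = c1 / (curvature \<alpha> s)\<^sup>2"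
    and k: "\<And>s. s \<in> I \<Longrightarrow> (curvature \<alpha> has_real_derivative m s * curvature \<alpha> s) (at s)"
    and m: "\<And>s. s \<in> I \<Longrightarrow> (m has_real_derivative
      - (curvature \<alpha> s)\<^sup>2 + c2 * torsion \<alpha> s + 2 * (torsion \<alpha> s)\<^sup>2) (at s)"
    and s: "s \<in> I" and u: "u \<in> I"
  defines "Q \<equiv> \<lambda>s. curvature \<alpha> s * ((frenet_t \<alpha> s \<bullet> p) * (frenet_b \<alpha> s \<bullet> q) + (frenet_b \<alpha> s \<bullet> p) * (frenet_t \<alpha> s \<bullet> q))
      - torsion \<alpha> s * ((frenet_n \<alpha> s \<bullet> p) * (frenet_n \<alpha> s \<bullet> q))
      + m s * ((frenet_n \<alpha> s \<bullet> p) * (frenet_b \<alpha> s \<bullet> q) + (frenet_b \<alpha> s \<bullet> p) * (frenet_n \<alpha> s \<bullet> q))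
      + (c2 + torsion \<alpha> s) * ((frenet_b \<alpha> s \<bullet> p) * (frenet_b \<alpha> s \<bullet> q))"
  shows "Q s = Q u"
proof -
  have I: "open_interval I" and op: "open I" using \<alpha> by (auto simp: arc_length_curve_def open_interval_def)
  show ?thesis
  proof (rule constant_of_zero_derivative[OF I _ u s])
    fix s assume s: "s \<in> I"
    define \<kappa> where "\<kappa> = curvature \<alpha> s"
    define \<tau> where "\<tau> = torsion \<alpha> s"
    have p0: "\<kappa> > 0" using pos[OF s] by (simp add: \<kappa>_def)
    have t': "((\<lambda>u. torsion \<alpha> u) has_real_derivative - 2 * m s * \<tau>) (at s)"
    proof -
      have "((\<lambda>u. c1 / (curvature \<alpha> u)\<^sup>2) has_real_derivative - 2 * m s * \<tau>) (at s)"
        by (rule derivative_eq_intros k[OF s] refl)+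
          (use p0 in \<open>auto simp: \<tau>_def tau[OF s] \<kappa>_def[symmetric] field_simps power_numeral_reduce\<close>)
      then show ?thesis
        by (rule has_field_derivative_transform_within_open[OF _ op s]) (simp add: tau)
    qed
    have fr: "((\<lambda>u. frenet_t \<alpha> u \<bullet> x) has_real_derivative \<kappa> * (frenet_n \<alpha> s \<bullet> x)) (at s)"
      "((\<lambda>u. frenet_n \<alpha> u \<bullet> x) has_real_derivative - \<kappa> * (frenet_t \<alpha> s \<bullet> x) + \<tau> * (frenet_b \<alpha> s \<bullet> x)) (at s)"
      "((\<lambda>u. frenet_b \<alpha> u \<bullet> x) has_real_derivative - \<tau> * (frenet_n \<alpha> s \<bullet> x)) (at s)" for x
      unfolding real_derivative_iff
      using frenet_equations[OF \<alpha> pos s, THEN bounded_linear.has_vector_derivative[OF bounded_linear_inner_left[of x]]]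
      by (simp_all add: \<kappa>_def \<tau>_def inner_add_left inner_diff_left)
    note k' = k[OF s, folded \<kappa>_def] and m' = m[OF s, folded \<kappa>_def \<tau>_def]
    have "(Q has_real_derivative 0) (at s)"
      unfolding Q_def
      by (rule derivative_eq_intros fr k' m' t' refl)+
        (simp add: \<kappa>_def[symmetric] \<tau>_def[symmetric] algebra_simps power2_eq_square)
    then show "(Q has_vector_derivative 0) (at s)" by (simp add: real_derivative_iff)
  qed
qed

text \<open>The constant symmetric form of the previous lemma, evaluated at the tangents of two points, is
\<open>\<kappa> b \<bullet> t\<close> with the frame of either one; that is the orthogonality relation expressing minimality.\<close>

lemma prescribed_curvature_minimal:
  assumes c1: "c1 \<noteq> 0" and roots: "cubic_roots c1 c2 c3 l1 l2 l3" and \<alpha>: "arc_length_curve I \<alpha>"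
    and kpos: "\<And>s. s \<in> I \<Longrightarrow> k s > 0" and nc: "\<not> k constant_on I" and ode: "ode_solution c1 c2 c3 I k"
    and kt: "\<And>s. s \<in> I \<Longrightarrow> curvature \<alpha> s = k s \<and> torsion \<alpha> s = c1 / (k s)\<^sup>2"
    and s: "s \<in> I" and t: "t \<in> I" and reg: "regular_at \<alpha> \<alpha> s t"
  shows "mean_curvature (translation_surface \<alpha> \<alpha>) s t = 0"
proof -
  define \<kappa> where "\<kappa> = curvature \<alpha>"
  have I: "open_interval I" and op: "open I" and sm: "smooth_on I \<alpha>" and unit: "\<And>u. u \<in> I \<Longrightarrow> norm (vderiv \<alpha> u) = 1"
    using \<alpha> by (auto simp: arc_length_curve_def open_interval_def)
  have pos': "\<And>s. s \<in> I \<Longrightarrow> curvature \<alpha> s > 0" using kpos kt by simp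
  then have pos: "\<And>s. s \<in> I \<Longrightarrow> \<kappa> s > 0" by (simp add: \<kappa>_def)
  have tau: "torsion \<alpha> u = c1 / (curvature \<alpha> u)\<^sup>2" if "u \<in> I" for u using kt[OF that] by simp
  have sk: "smooth_on I \<kappa>" unfolding \<kappa>_def by (rule curvature_smooth[OF \<alpha> pos'])
  have d1: "(\<kappa> has_real_derivative vderiv \<kappa> u) (at u)" if "u \<in> I" for u
    unfolding real_derivative_iff by (rule smooth_on_has_vderiv[OF sk that])
  have d2: "(vderiv \<kappa> has_real_derivative vderiv (vderiv \<kappa>) u) (at u)" if "u \<in> I" for u
    unfolding real_derivative_iff
    by (rule smooth_on_has_vderiv[OF smooth_on_vderiv[OF sk] that])
  have first: "(2 * \<kappa> u * vderiv \<kappa> u)\<^sup>2 = - 4 * ((\<kappa> u)^6 + c3 * (\<kappa> u)^4 + c1 * c2 * (\<kappa> u)\<^sup>2 + c1\<^sup>2)"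
    if u: "u \<in> I" for u
  proof -
    have "(k has_real_derivative vderiv \<kappa> u) (at u)"
      by (rule has_field_derivative_transform_within_open[OF d1[OF u] op u]) (simp add: \<kappa>_def kt)
    then have "deriv k u = vderiv \<kappa> u" by (rule DERIV_imp_deriv)
    then have e: "(vderiv \<kappa> u)\<^sup>2 = - ((\<kappa> u)^4 + c3 * (\<kappa> u)\<^sup>2 + c1\<^sup>2 / (\<kappa> u)\<^sup>2 + c1 * c2)"
      using ode u kt[OF u] unfolding ode_solution_def \<kappa>_def by (auto simp: algebra_simps eq_neg_iff_add_eq_0)
    have "(2 * \<kappa> u * vderiv \<kappa> u)\<^sup>2 = 4 * (\<kappa> u)\<^sup>2 * (vderiv \<kappa> u)\<^sup>2" by (simp add: power_mult_distrib)
    also have "\<dots> = - 4 * ((\<kappa> u)^6 + c3 * (\<kappa> u)^4 + c1 * c2 * (\<kappa> u)\<^sup>2 + c1\<^sup>2)"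
      unfolding e using pos[OF u] by (simp add: field_simps power_numeral_reduce)
    finally show ?thesis .
  qed
  have nc': "\<not> \<kappa> constant_on I" using nc kt unfolding constant_on_def \<kappa>_def by metis
  have second: "2 * (vderiv \<kappa> u)\<^sup>2 + 2 * \<kappa> u * vderiv (vderiv \<kappa>) u =
      - 2 * (3 * (\<kappa> u)^4 + 2 * c3 * (\<kappa> u)\<^sup>2 + c1 * c2)" if "u \<in> I" for u
    by (rule nonconstant_solution_second_derivative[OF I pos d1 d2 _ first roots nc' that])
      (auto intro: smooth_on_continuous smooth_on_vderiv sk)
  have y1: "((\<lambda>u. (\<kappa> u)\<^sup>2) has_real_derivative 2 * \<kappa> u * vderiv \<kappa> u) (at u)" if u: "u \<in> I" for u
    by (rule derivative_eq_intros d1[OF u] refl)+ simp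
  have y2: "((\<lambda>u. 2 * \<kappa> u * vderiv \<kappa> u) has_real_derivative
      - 2 * (3 * (\<kappa> u)^4 + 2 * c3 * (\<kappa> u)\<^sup>2 + c1 * c2)) (at u)" if u: "u \<in> I" for u
    by (rule derivative_eq_intros d1[OF u] d2[OF u] refl)+ (use second[OF u] in \<open>simp add: power2_eq_square algebra_simps\<close>)
  have m: "((\<lambda>u. deriv \<kappa> u / \<kappa> u) has_real_derivative
      - (\<kappa> u)\<^sup>2 + c2 * (c1 / (\<kappa> u)\<^sup>2) + 2 * (c1 / (\<kappa> u)\<^sup>2)\<^sup>2) (at u)" if u: "u \<in> I" for u
    by (rule curvature_ode_consequences(3)[OF op pos y1 y2 first u])
  have km: "(curvature \<alpha> has_real_derivative deriv \<kappa> u / \<kappa> u * curvature \<alpha> u) (at u)" if u: "u \<in> I" for u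
    using d1[OF u] DERIV_imp_deriv[OF d1[OF u]] pos[OF u] by (simp add: \<kappa>_def)
  \<comment> \<open>the form at the tangents of both points, evaluated once in the frame at \<open>s\<close> and once in the frame at \<open>t\<close>\<close>
  note form = frenet_form_constant[OF \<alpha> pos' tau km _ s t, of c2 "frenet_t \<alpha> t" "frenet_t \<alpha> s"]
  have sym: "\<kappa> s * (frenet_b \<alpha> s \<bullet> frenet_t \<alpha> t) = \<kappa> t * (frenet_t \<alpha> s \<bullet> frenet_b \<alpha> t)"
    using form m frenet_frame[OF \<alpha> pos' s] frenet_frame[OF \<alpha> pos' t]
    by (simp add: tau \<kappa>_def inner_commute)
  have cb: "curvature_binormal \<alpha> u = \<kappa> u *\<^sub>R frenet_b \<alpha> u" "unit_tangent \<alpha> u = frenet_t \<alpha> u" if u: "u \<in> I" for u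
    using pos[OF u] unit[OF u]
    by (simp_all add: curvature_binormal_def unit_tangent_def frenet_b_def frenet_n_def frenet_t_def[abs_def]
        \<kappa>_def cross_mult_right)
  show ?thesis
    unfolding minimal_iff_orthogonality[OF op op sm sm s t reg] cb[OF s] cb[OF t]
    using sym by simp
qed

section \<open>Assembling the generating curves\<close>

lemma smooth_on_cmult:
  fixes h :: "real \<Rightarrow> real"
  assumes "open I" "smooth_on I h"
  shows "smooth_on I (\<lambda>s. c * h s)"
proof (rule smooth_on_coinduct[where X = "\<lambda>g. \<exists>h. smooth_on I h \<and> g = (\<lambda>s. c * h s)"])
  fix g assume "\<exists>h. smooth_on I h \<and> g = (\<lambda>s. c * h s)"
  then obtain h where h: "smooth_on I h" "g = (\<lambda>s. c * h s)" by blast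
  have "(g has_vector_derivative c * vderiv h s) (at s)" if "s \<in> I" for s
    unfolding h(2) by (rule has_vector_derivative_mult_right[OF smooth_on_has_vderiv[OF h(1) that]])
  then show "\<exists>k. (\<exists>h. smooth_on I h \<and> k = (\<lambda>s. c * h s)) \<and> (\<forall>s\<in>I. (g has_vector_derivative k s) (at s))"
    using smooth_on_vderiv[OF h(1)] by blast
qed (use assms in auto)

lemma turning_direction_cong:
  assumes T: "turning_direction I v T K" and eq: "\<And>s. s \<in> I \<Longrightarrow> v' s = v s" "\<And>s. s \<in> I \<Longrightarrow> T' s = T s"
    "\<And>s. s \<in> I \<Longrightarrow> K' s = K s"
  shows "turning_direction I v' T' K'"
proof -
  note t = turning_directionD[OF T]
  have "(T' has_vector_derivative v' s *\<^sub>R cross3 (K' s) (T' s)) (at s)" if s: "s \<in> I" for s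
    by (rule has_vector_derivative_transform_within_open[OF _ t(2) s, of T])
      (use t(7)[OF s] eq s in auto)
  moreover have "continuous_on I v'" using t(3) eq(1) by (simp cong: continuous_on_cong)
  ultimately show ?thesis using T eq unfolding turning_direction_def by simp
qed

context principal_axes
begin

text \<open>A direction on the opposite oval is the negative of a direction on the parameterized one, and
\<open>- T\<close> solves the equation with the opposite orientation of the parameter: the curve runs backwards
along the flow.\<close>

lemma follows_conic_flow_signed:
  assumes T: "turning_direction I v T (\<lambda>s. f (T s))"
  obtains \<phi> \<epsilon> where "\<epsilon> \<noteq> 0" "\<And>s. s \<in> I \<Longrightarrow> (\<phi> has_real_derivative \<epsilon> * v s) (at s)"
    "\<And>s. s \<in> I \<Longrightarrow> v s *\<^sub>R T s = (\<epsilon> * v s) *\<^sub>R conic_flow (\<phi> s)"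
proof -
  note t = turning_directionD[OF T]
  obtain s0 where s0: "s0 \<in> I" using t(1) by (auto simp: open_interval_def)
  have "e3 \<bullet> T s0 \<noteq> 0" by (rule isotropic_height_nonzero[OF t(4,6)[OF s0]])
  then consider "e3 \<bullet> T s0 > 0" | "e3 \<bullet> - T s0 > 0" by force
  then show ?thesis
  proof cases
    case 1
    obtain \<phi> where "\<And>s. s \<in> I \<Longrightarrow> (\<phi> has_real_derivative v s) (at s)"
      "\<And>s. s \<in> I \<Longrightarrow> T s = conic_flow (\<phi> s)"
      using follows_conic_flow[OF T s0 1] by blast
    then show ?thesis using that[of 1 \<phi>] by simp
  next
    case 2
    have neg: "turning_direction I (\<lambda>s. - v s) (\<lambda>s. - T s) (\<lambda>s. f (- T s))"
      unfolding turning_direction_def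
    proof (intro conjI ballI)
      fix s assume s: "s \<in> I"
      show "norm (- T s) = 1" using t(4)[OF s] by simp
      show "f (- T s) \<bullet> - T s = 0" using t(6)[OF s] by (simp add: linear_neg[OF lin])
      show "((\<lambda>s. - T s) has_vector_derivative - v s *\<^sub>R cross3 (f (- T s)) (- T s)) (at s)"
        using has_vector_derivative_minus[OF t(7)[OF s]] by (simp add: linear_neg[OF lin])
    qed (use t in \<open>auto intro: continuous_intros\<close>)
    obtain \<phi> where \<phi>: "\<And>s. s \<in> I \<Longrightarrow> (\<phi> has_real_derivative - v s) (at s)"
      "\<And>s. s \<in> I \<Longrightarrow> - T s = conic_flow (\<phi> s)"
      using follows_conic_flow[OF neg s0 2] by blast
    show ?thesis
      by (rule that[of "-1" \<phi>]) (simp_all add: \<phi>(1) flip: \<phi>(2))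
  qed
qed

lemma unit_speed_follows_conic_flow:
  assumes T: "turning_direction I (\<lambda>s. 1) T (\<lambda>s. f (T s))" and s0: "s0 \<in> I" "e3 \<bullet> T s0 > 0"
  obtains c where "\<And>s. s \<in> I \<Longrightarrow> T s = conic_flow (s + c)"
proof -
  obtain \<phi> where \<phi>: "\<And>s. s \<in> I \<Longrightarrow> (\<phi> has_real_derivative 1) (at s)"
    "\<And>s. s \<in> I \<Longrightarrow> T s = conic_flow (\<phi> s)"
    using follows_conic_flow[OF T s0] by blast
  have "\<phi> s = (\<phi> s0 - s0) + s" if s: "s \<in> I" for s
    by (rule translate_of_equal_derivative[OF turning_directionD(1)[OF T] _ has_vector_derivative_id s0(1) s])
      (use \<phi>(1) in \<open>simp add: real_derivative_iff\<close>)
  then have "T s = conic_flow (s + (\<phi> s0 - s0))" if "s \<in> I" for s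
    using \<phi>(2)[OF that] that by (metis add.commute)
  then show ?thesis by (rule that)
qed

text \<open>The half turn about \<open>e1\<close> commutes with \<open>f\<close> and preserves orientation, hence preserves the equation,
while it exchanges the two ovals of the conic. For curves whose direction of traversal is fixed by
arc length it takes the place of running backwards.\<close>

definition half_turn :: "real^3 \<Rightarrow> real^3" where
  "half_turn x = (2 * (e1 \<bullet> x)) *\<^sub>R e1 - x"

lemma half_turn_axes: "e1 \<bullet> half_turn x = e1 \<bullet> x" "e2 \<bullet> half_turn x = - (e2 \<bullet> x)" "e3 \<bullet> half_turn x = - (e3 \<bullet> x)"
  by (simp_all add: half_turn_def inner_diff_right ortho)

lemma linear_half_turn: "linear half_turn"
  by (rule linearI) (simp_all add: half_turn_def inner_add_right algebra_simps)

lemma orthogonal_half_turn: "orthogonal_transformation half_turn"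
  unfolding orthogonal_transformation_def
  using linear_half_turn by (simp add: inner_axes[of "half_turn _"] half_turn_axes inner_axes[symmetric])

lemma half_turn_involution: "half_turn (half_turn x) = x"
  by (rule eq_axesI) (simp_all add: half_turn_axes)

lemma half_turn_f: "f (half_turn x) = half_turn (f x)"
  by (rule eq_axesI) (simp_all add: half_turn_axes f_axes)

lemma half_turn_cross: "cross3 (half_turn x) (half_turn y) = half_turn (cross3 x y)"
  by (rule eq_axesI) (simp_all add: half_turn_axes cross_axes algebra_simps)

lemma det_half_turn: "det (matrix half_turn) = 1"
proof -
  have "half_turn e1 = cross3 (half_turn (sgn l3 *\<^sub>R e2)) (half_turn e3)"
    by (simp add: half_turn_cross cross_mult_left orientations sg_square l3_nonzero)
  also have "\<dots> = det (matrix half_turn) *\<^sub>R half_turn e1"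
    unfolding cross_orthogonal_transformation[OF orthogonal_half_turn]
    by (simp add: cross_mult_left orientations sg_square l3_nonzero)
  finally have "half_turn e1 = det (matrix half_turn) *\<^sub>R half_turn e1" .
  then have "e1 \<bullet> half_turn e1 = det (matrix half_turn) * (e1 \<bullet> half_turn e1)" by (metis inner_scaleR_right)
  then show ?thesis by (simp add: half_turn_axes ortho)
qed

lemma unit_speed_follows_conic_flow_rotated:
  assumes T: "turning_direction I (\<lambda>s. 1) T (\<lambda>s. f (T s))"
  obtains c R where "orthogonal_transformation R" "det (matrix R) = 1"
    "\<And>s. s \<in> I \<Longrightarrow> T s = R (conic_flow (s + c))"
proof -
  note t = turning_directionD[OF T]
  obtain s0 where s0: "s0 \<in> I" using t(1) by (auto simp: open_interval_def)
  have "e3 \<bullet> T s0 \<noteq> 0" by (rule isotropic_height_nonzero[OF t(4,6)[OF s0]])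
  then consider "e3 \<bullet> T s0 > 0" | "e3 \<bullet> half_turn (T s0) > 0" by (force simp: half_turn_axes)
  then show ?thesis
  proof cases
    case 1
    obtain c where "\<And>s. s \<in> I \<Longrightarrow> T s = conic_flow (s + c)"
      using unit_speed_follows_conic_flow[OF T s0 1] by blast
    moreover have "det (matrix (\<lambda>x :: real^3. x)) = 1"
    proof -
      have "matrix (\<lambda>x :: real^3. x) = mat 1" using matrix_id_mat_1 by (simp add: id_def)
      then show ?thesis by (simp only: det_I)
    qed
    ultimately show ?thesis using that[of "\<lambda>x. x" c] by (simp add: orthogonal_transformation_id)
  next
    case 2
    have rot: "turning_direction I (\<lambda>s. 1) (\<lambda>s. half_turn (T s)) (\<lambda>s. f (half_turn (T s)))"
      unfolding turning_direction_def
    proof (intro conjI ballI)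
      fix s assume s: "s \<in> I"
      show "norm (half_turn (T s)) = 1"
        using t(4)[OF s] orthogonal_half_turn by (simp add: orthogonal_transformation)
      show "f (half_turn (T s)) \<bullet> half_turn (T s) = 0"
        using t(6)[OF s] orthogonal_half_turn by (simp add: half_turn_f orthogonal_transformation_def)
      show "((\<lambda>s. half_turn (T s)) has_vector_derivative
          1 *\<^sub>R cross3 (f (half_turn (T s))) (half_turn (T s))) (at s)"
        using bounded_linear.has_vector_derivative[OF linear_half_turn[unfolded linear_conv_bounded_linear] t(7)[OF s]]
        by (simp add: half_turn_f half_turn_cross)
    qed (use t in auto)
    obtain c where c: "\<And>s. s \<in> I \<Longrightarrow> half_turn (T s) = conic_flow (s + c)"
      using unit_speed_follows_conic_flow[OF rot s0 2] by blast
    have "T s = half_turn (conic_flow (s + c))" if "s \<in> I" for s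
      using c[OF that] half_turn_involution by metis
    then show ?thesis using that[OF orthogonal_half_turn det_half_turn] by blast
  qed
qed

definition flow_curve :: "real \<Rightarrow> real^3" where
  "flow_curve = (SOME G. \<forall>t. (G has_vector_derivative conic_flow t) (at t))"

lemma flow_curve_derivative: "(flow_curve has_vector_derivative conic_flow t) (at t)"
proof -
  obtain G where "\<And>t. t \<in> UNIV \<Longrightarrow> (G has_vector_derivative conic_flow t) (at t)"
    by (rule antiderivative_exists[of UNIV conic_flow])
      (auto simp: open_interval_def intro: smooth_on_continuous autonomous_flow_smooth conic_flow_derivative)
  then have "\<exists>G. \<forall>t. (G has_vector_derivative conic_flow t) (at t)" by blast
  from someI_ex[OF this] show ?thesis unfolding flow_curve_def by blast
qed

lemma flow_curve_chain:
  assumes "(\<phi> has_real_derivative d) (at s)"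
  shows "((\<lambda>s. flow_curve (\<phi> s)) has_vector_derivative d *\<^sub>R conic_flow (\<phi> s)) (at s)"
  using vector_diff_chain_at[OF assms[unfolded real_derivative_iff] flow_curve_derivative]
  by (simp add: o_def)

lemma translated_flow_curve:
  defines "\<gamma> \<equiv> \<lambda>c p t. p + flow_curve (t + c)"
  shows "vderiv (\<gamma> c p) t = conic_flow (t + c)" "smooth_on UNIV (\<gamma> c p)"
    "turning_direction UNIV (\<lambda>s. 1) (vderiv (\<gamma> c p)) (\<lambda>s. f (vderiv (\<gamma> c p) s))"
proof -
  have shift: "((\<lambda>t. t + c) has_real_derivative 1) (at t)" for t
    by (auto intro!: derivative_eq_intros)
  have d: "(\<gamma> c p has_vector_derivative conic_flow (t + c)) (at t)" for t
    unfolding \<gamma>_def using has_vector_derivative_add[OF has_vector_derivative_const flow_curve_chain[OF shift]] by simp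
  show vd: "vderiv (\<gamma> c p) t = conic_flow (t + c)" for t using d by (rule vector_derivative_at)
  have d2: "((\<lambda>t. conic_flow (t + c)) has_vector_derivative
      cross3 (f (conic_flow (t + c))) (conic_flow (t + c))) (at t)" for t
    using vector_diff_chain_at[OF shift[unfolded real_derivative_iff] conic_flow_derivative]
    by (simp add: o_def)
  show "turning_direction UNIV (\<lambda>s. 1) (vderiv (\<gamma> c p)) (\<lambda>s. f (vderiv (\<gamma> c p) s))"
  proof (rule turning_direction_cong)
    show "turning_direction UNIV (\<lambda>s. 1) (\<lambda>t. conic_flow (t + c)) (\<lambda>t. f (conic_flow (t + c)))"
      unfolding turning_direction_def using d2 by (simp add: open_interval_def conic_flow_unit)
  qed (simp_all only: vd)
  have "smooth_on UNIV (\<lambda>t. conic_flow (t + c))" by (rule autonomous_flow_smooth[OF d2])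
  then show "smooth_on UNIV (\<gamma> c p)" by (intro smooth_on_antiderivative[OF open_UNIV d])
qed

text \<open>With \<open>\<phi>' = \<plusminus> |\<alpha>'|\<close>, the sign depending on the oval, the curves \<open>\<alpha>\<close> and \<open>flow_curve \<circ> \<phi>\<close> have the same velocity.\<close>

lemma curve_along_flow:
  assumes I: "open_interval I" and \<alpha>: "smooth_on I \<alpha>" and nz: "\<And>s. s \<in> I \<Longrightarrow> vderiv \<alpha> s \<noteq> 0"
    and T: "turning_direction I (\<lambda>s. norm (vderiv \<alpha> s)) (unit_tangent \<alpha>) (\<lambda>s. f (unit_tangent \<alpha> s))"
  obtains \<phi> p where "smooth_on I \<phi>" "\<And>s. s \<in> I \<Longrightarrow> vderiv \<phi> s \<noteq> 0" "\<And>s. s \<in> I \<Longrightarrow> \<alpha> s = p + flow_curve (\<phi> s)"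
proof -
  have op: "open I" using I by (simp add: open_interval_def)
  obtain s0 where s0: "s0 \<in> I" using I by (auto simp: open_interval_def)
  obtain \<phi> \<epsilon> where \<phi>: "\<epsilon> \<noteq> 0" "\<And>s. s \<in> I \<Longrightarrow> (\<phi> has_real_derivative \<epsilon> * norm (vderiv \<alpha> s)) (at s)"
    "\<And>s. s \<in> I \<Longrightarrow> norm (vderiv \<alpha> s) *\<^sub>R unit_tangent \<alpha> s = (\<epsilon> * norm (vderiv \<alpha> s)) *\<^sub>R conic_flow (\<phi> s)"
    by (rule follows_conic_flow_signed[OF T]) blast
  have \<phi>': "(\<phi> has_vector_derivative \<epsilon> * norm (vderiv \<alpha> s)) (at s)" if "s \<in> I" for s
    using \<phi>(2)[OF that] by (simp add: real_derivative_iff)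
  have speed: "smooth_on I (\<lambda>s. \<epsilon> * norm (vderiv \<alpha> s))"
    by (rule smooth_on_cmult[OF op smooth_on_norm[OF op smooth_on_vderiv[OF \<alpha>] nz]])
  have sm: "smooth_on I \<phi>" by (rule smooth_on_antiderivative[OF op \<phi>' speed])
  have nz': "vderiv \<phi> s \<noteq> 0" if "s \<in> I" for s
    using vector_derivative_at[OF \<phi>'[OF that]] \<phi>(1) nz[OF that] by simp
  have "(\<alpha> has_vector_derivative (\<epsilon> * norm (vderiv \<alpha> s)) *\<^sub>R conic_flow (\<phi> s)) (at s)" if s: "s \<in> I" for s
    using smooth_on_has_vderiv[OF \<alpha> s] \<phi>(3)[OF s] nz[OF s] by (simp add: unit_tangent_def)
  then have "\<alpha> s = (\<alpha> s0 - flow_curve (\<phi> s0)) + flow_curve (\<phi> s)" if "s \<in> I" for s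
    by (rule translate_of_equal_derivative[OF I _ flow_curve_chain[OF \<phi>(2)] s0 that])
  then show ?thesis using that[OF sm nz'] by blast
qed

end

text \<open>Nonzero torsion makes \<open>\<alpha>\<close> nonplanar. The complete curve \<open>\<gamma>\<close> is an integral of the flow, shifted so that it
extends \<open>\<alpha>\<close>; and \<open>\<beta>\<close> is part of it up to a motion, which involves a half turn when the tangents of
\<open>\<beta>\<close> lie on the other oval.\<close>

lemma minimal_translation_surface_unit_speed:
  assumes \<alpha>: "arc_length_curve I \<alpha>" and \<beta>: "arc_length_curve J \<beta>"
    and min: "minimal_translation_surface I J \<alpha> \<beta>"
    and posa: "\<And>s. s \<in> I \<Longrightarrow> curvature \<alpha> s > 0 \<and> torsion \<alpha> s \<noteq> 0"
  shows "\<exists>c1 c2 c3 l1 l2 l3.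
         c1 \<noteq> 0 \<and>
         curvature_torsion_equations c1 c2 I \<alpha> \<and>
         ode_solution c1 c2 c3 I (curvature \<alpha>) \<and>
         cubic_roots c1 c2 c3 l1 l2 l3 \<and> l1 * l3 < 0 \<and> l2 * l3 < 0 \<and>
         explicit_form (sgn c1) l1 l2 l3 I \<alpha> \<and>
         (\<exists>\<gamma> f t0.
            arc_length_curve UNIV \<gamma> \<and> (\<forall>s. curvature \<gamma> s > 0) \<and>
            curvature_torsion_equations c1 c2 UNIV \<gamma> \<and>
            ode_solution c1 c2 c3 UNIV (curvature \<gamma>) \<and>
            (\<forall>s\<in>I. \<gamma> s = \<alpha> s) \<and>
            rigid_motion f \<and> (\<forall>t\<in>J. \<beta> t = f (\<gamma> (t + t0))))"
proof -
  have I: "open_interval I" and sma: "smooth_on I \<alpha>" and ua: "\<And>s. s \<in> I \<Longrightarrow> norm (vderiv \<alpha> s) = 1"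
    and J: "open_interval J" and smb: "smooth_on J \<beta>" and ub: "\<And>s. s \<in> J \<Longrightarrow> norm (vderiv \<beta> s) = 1"
    using \<alpha> \<beta> unfolding arc_length_curve_def by auto
  obtain s0 where s0: "s0 \<in> I" using I by (auto simp: open_interval_def)
  obtain t1 where t1: "t1 \<in> J" using J by (auto simp: open_interval_def)
  have "\<not> plane_curve I \<alpha>" using plane_curve_torsion_zero[OF \<alpha> _ s0] posa s0 by blast
  then have "\<not> (plane_curve I \<alpha> \<and> plane_curve J \<beta>)" by blast
  note np = this
  obtain f e1 e2 e3 l1 l2 l3 where ax: "principal_axes f e1 e2 e3 l1 l2 l3" "e3 \<bullet> unit_tangent \<alpha> s0 > 0"
    and nz: "\<And>s. s \<in> I \<Longrightarrow> vderiv \<alpha> s \<noteq> 0" "\<And>t. t \<in> J \<Longrightarrow> vderiv \<beta> t \<noteq> 0"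
    and Ta: "turning_direction I (\<lambda>s. norm (vderiv \<alpha> s)) (unit_tangent \<alpha>) (\<lambda>s. f (unit_tangent \<alpha> s))"
    and Tb: "turning_direction J (\<lambda>t. norm (vderiv \<beta> t)) (unit_tangent \<beta>) (\<lambda>t. f (unit_tangent \<beta> t))"
    by (rule minimal_translation_surface_axes[OF min np s0], rule that)
  have Ta': "turning_direction I (\<lambda>s. 1) (vderiv \<alpha>) (\<lambda>s. f (vderiv \<alpha> s))"
    by (rule turning_direction_cong[OF Ta]) (use ua in \<open>auto simp: unit_tangent_def\<close>)
  have Tb': "turning_direction J (\<lambda>s. 1) (vderiv \<beta>) (\<lambda>s. f (vderiv \<beta> s))"
    by (rule turning_direction_cong[OF Tb]) (use ub in \<open>auto simp: unit_tangent_def\<close>)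
  have pos: "e3 \<bullet> vderiv \<alpha> s0 > 0" using ax(2) ua[OF s0] by (simp add: unit_tangent_def)
  interpret principal_axes f e1 e2 e3 l1 l2 l3 by (rule ax)
  obtain c where c: "\<And>s. s \<in> I \<Longrightarrow> vderiv \<alpha> s = conic_flow (s + c)"
    using unit_speed_follows_conic_flow[OF Ta' s0 pos] by blast
  obtain d R where R: "orthogonal_transformation R" "det (matrix R) = 1"
    "\<And>t. t \<in> J \<Longrightarrow> vderiv \<beta> t = R (conic_flow (t + d))"
    using unit_speed_follows_conic_flow_rotated[OF Tb'] by blast
  have linR: "linear R" using R(1) by (simp add: orthogonal_transformation_def)
  have shift: "((\<lambda>t. t + c) has_real_derivative 1) (at t)" for c t
    by (auto intro!: derivative_eq_intros)
  define p where "p = \<alpha> s0 - flow_curve (s0 + c)"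
  define q where "q = \<beta> t1 - R (flow_curve (t1 + d))"
  have "(\<alpha> has_vector_derivative 1 *\<^sub>R conic_flow (s + c)) (at s)" if "s \<in> I" for s
    using smooth_on_has_vderiv[OF sma that] c[OF that] by simp
  then have a: "\<alpha> s = p + flow_curve (s + c)" if "s \<in> I" for s
    unfolding p_def by (rule translate_of_equal_derivative[OF I _ flow_curve_chain[OF shift] s0 that])
  have "(\<beta> has_vector_derivative R (1 *\<^sub>R conic_flow (t + d))) (at t)" if "t \<in> J" for t
    using smooth_on_has_vderiv[OF smb that] R(3)[OF that] by simp
  then have b: "\<beta> t = q + R (flow_curve (t + d))" if "t \<in> J" for t
    unfolding q_def
    by (rule translate_of_equal_derivative[OF J _ bounded_linear.has_vector_derivative[OF
            linR[unfolded linear_conv_bounded_linear] flow_curve_chain[OF shift]] t1 that])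
  define \<gamma> where "\<gamma> = (\<lambda>t. p + flow_curve (t + c))"
  define g where "g = (\<lambda>x. (q - R p) + R x)"
  note \<gamma> = translated_flow_curve[of p c, folded \<gamma>_def]
  note ea = unit_speed_curve_equations[OF sma Ta'] and e\<gamma> = unit_speed_curve_equations[OF \<gamma>(2,3)]
  have rigid: "rigid_motion g" unfolding rigid_motion_def isometry_with_det_def g_def using R by blast
  have partner: "\<beta> t = g (\<gamma> (t + (d - c)))" if "t \<in> J" for t
    using b[OF that] by (simp add: g_def \<gamma>_def linear_add[OF linR])
  let ?c1 = "l1 * l2 * l3" and ?c2 = "l1 + l2 + l3" and ?c3 = "l1 * l2 + l1 * l3 + l2 * l3"
  show ?thesis
  proof (intro exI conjI allI ballI)
    show "?c1 \<noteq> 0" by (rule product_sign)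
    show "curvature_torsion_equations ?c1 ?c2 I \<alpha>" by (rule ea)
    show "ode_solution ?c1 ?c2 ?c3 I (curvature \<alpha>)" by (rule ea)
    show "cubic_roots ?c1 ?c2 ?c3 l1 l2 l3"
      by (rule cubic_roots_of_symmetric_functions)
    show "l1 * l3 < 0" "l2 * l3 < 0" by (rule sign1 sign2)+
    show "explicit_form (sgn ?c1) l1 l2 l3 I \<alpha>"
      by (rule unit_speed_curve_explicit_form[OF sma Ta' shift c])
    show "arc_length_curve UNIV \<gamma>" by (rule e\<gamma>)
    show "curvature \<gamma> s > 0" for s by (rule e\<gamma>) simp
    show "curvature_torsion_equations ?c1 ?c2 UNIV \<gamma>" by (rule e\<gamma>)
    show "ode_solution ?c1 ?c2 ?c3 UNIV (curvature \<gamma>)"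
      by (rule e\<gamma>)
    show "\<gamma> s = \<alpha> s" if "s \<in> I" for s unfolding \<gamma>_def using a[OF that] by simp
    show "rigid_motion g" by (rule rigid)
    show "\<beta> t = g (\<gamma> (t + (d - c)))" if "t \<in> J" for t using that by (rule partner)
  qed
qed

text \<open>No rotation is available here, since the sum of the two curves has to be reproduced exactly. Each
curve is a translate of a reparameterized piece of the integral curve of the flow, and half of the
total translation goes into each copy of \<open>\<gamma>\<close>.\<close>

lemma nonplanar_minimal_translation_surface:
  assumes min: "minimal_translation_surface I J \<alpha> \<beta>" and np: "\<not> (plane_curve I \<alpha> \<and> plane_curve J \<beta>)"
  shows "\<exists>c1 c2 c3 l1 l2 l3 \<gamma> \<phi> \<psi>.
         c1 \<noteq> 0 \<and> cubic_roots c1 c2 c3 l1 l2 l3 \<and>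
         arc_length_curve UNIV \<gamma> \<and> (\<forall>s. curvature \<gamma> s > 0) \<and>
         ode_solution c1 c2 c3 UNIV (curvature \<gamma>) \<and>
         (\<forall>s. torsion \<gamma> s = c1 / (curvature \<gamma> s)\<^sup>2) \<and>
         curvature_torsion_equations c1 c2 UNIV \<gamma> \<and>
         smooth_on I \<phi> \<and> (\<forall>s\<in>I. vderiv \<phi> s \<noteq> 0) \<and>
         smooth_on J \<psi> \<and> (\<forall>t\<in>J. vderiv \<psi> t \<noteq> 0) \<and>
         (\<forall>s\<in>I. \<forall>t\<in>J. translation_surface \<alpha> \<beta> s t =
                         translation_surface \<gamma> \<gamma> (\<phi> s) (\<psi> t))"
proof -
  have I: "open_interval I" and J: "open_interval J" and \<alpha>: "smooth_on I \<alpha>" and \<beta>: "smooth_on J \<beta>"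
    using min unfolding minimal_translation_surface_def by auto
  obtain s0 where s0: "s0 \<in> I" using I by (auto simp: open_interval_def)
  obtain f e1 e2 e3 l1 l2 l3 where ax: "principal_axes f e1 e2 e3 l1 l2 l3" "e3 \<bullet> unit_tangent \<alpha> s0 > 0"
    and nz: "\<And>s. s \<in> I \<Longrightarrow> vderiv \<alpha> s \<noteq> 0" "\<And>t. t \<in> J \<Longrightarrow> vderiv \<beta> t \<noteq> 0"
    and Ta: "turning_direction I (\<lambda>s. norm (vderiv \<alpha> s)) (unit_tangent \<alpha>) (\<lambda>s. f (unit_tangent \<alpha> s))"
    and Tb: "turning_direction J (\<lambda>t. norm (vderiv \<beta> t)) (unit_tangent \<beta>) (\<lambda>t. f (unit_tangent \<beta> t))"
    by (rule minimal_translation_surface_axes[OF min np s0], rule that)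
  interpret principal_axes f e1 e2 e3 l1 l2 l3 by (rule ax)
  obtain \<phi> p where \<phi>: "smooth_on I \<phi>" "\<And>s. s \<in> I \<Longrightarrow> vderiv \<phi> s \<noteq> 0" "\<And>s. s \<in> I \<Longrightarrow> \<alpha> s = p + flow_curve (\<phi> s)"
    using curve_along_flow[OF I \<alpha> nz(1) Ta] by blast
  obtain \<psi> q where \<psi>: "smooth_on J \<psi>" "\<And>t. t \<in> J \<Longrightarrow> vderiv \<psi> t \<noteq> 0" "\<And>t. t \<in> J \<Longrightarrow> \<beta> t = q + flow_curve (\<psi> t)"
    using curve_along_flow[OF J \<beta> nz(2) Tb] by blast
  define \<gamma> where "\<gamma> = (\<lambda>t. (1 / 2) *\<^sub>R (p + q) + flow_curve (t + 0))"
  note \<gamma> = translated_flow_curve[of "(1 / 2) *\<^sub>R (p + q)" 0, folded \<gamma>_def]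
  note e\<gamma> = unit_speed_curve_equations[OF \<gamma>(2,3)]
  have "translation_surface \<alpha> \<beta> s t = translation_surface \<gamma> \<gamma> (\<phi> s) (\<psi> t)" if "s \<in> I" "t \<in> J" for s t
  proof -
    have half: "(1 / 2) *\<^sub>R x + (1 / 2) *\<^sub>R x = x" for x :: "real^3"
      by (simp add: scaleR_add_left[symmetric])
    have "translation_surface \<gamma> \<gamma> (\<phi> s) (\<psi> t) =
        ((1 / 2) *\<^sub>R (p + q) + (1 / 2) *\<^sub>R (p + q)) + (flow_curve (\<phi> s) + flow_curve (\<psi> t))"
      by (simp add: translation_surface_def \<gamma>_def)
    also have "\<dots> = \<alpha> s + \<beta> t" unfolding half using \<phi>(3) \<psi>(3) that by simp
    finally show ?thesis by (simp add: translation_surface_def)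
  qed
  note surface = this
  let ?c1 = "l1 * l2 * l3" and ?c2 = "l1 + l2 + l3" and ?c3 = "l1 * l2 + l1 * l3 + l2 * l3"
  show ?thesis
  proof (intro exI conjI allI ballI)
    show "?c1 \<noteq> 0" by (rule product_sign)
    show "cubic_roots ?c1 ?c2 ?c3 l1 l2 l3"
      by (rule cubic_roots_of_symmetric_functions)
    show "arc_length_curve UNIV \<gamma>" by (rule e\<gamma>)
    show "curvature \<gamma> s > 0" for s by (rule e\<gamma>) simp
    show "ode_solution ?c1 ?c2 ?c3 UNIV (curvature \<gamma>)"
      by (rule e\<gamma>)
    show "torsion \<gamma> s = ?c1 / (curvature \<gamma> s)\<^sup>2" for s by (rule e\<gamma>) simp
    show "curvature_torsion_equations ?c1 ?c2 UNIV \<gamma>" by (rule e\<gamma>)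
    show "smooth_on I \<phi>" "smooth_on J \<psi>" by (rule \<phi> \<psi>)+
    show "vderiv \<phi> s \<noteq> 0" if "s \<in> I" for s using that by (rule \<phi>)
    show "vderiv \<psi> t \<noteq> 0" if "t \<in> J" for t using that by (rule \<psi>)
    show "translation_surface \<alpha> \<beta> s t = translation_surface \<gamma> \<gamma> (\<phi> s) (\<psi> t)"
      if "s \<in> I" "t \<in> J" for s t using that by (rule surface)
  qed
qed

theorem theorem1p2:
  shows
  "(\<forall>(\<alpha> :: real \<Rightarrow> real^3) (\<beta> :: real \<Rightarrow> real^3) I J.
      arc_length_curve I \<alpha> \<and> arc_length_curve J \<beta> \<and>
      minimal_translation_surface I J \<alpha> \<beta> \<and>
      (\<forall>s\<in>I. curvature \<alpha> s > 0 \<and> torsion \<alpha> s \<noteq> 0) \<and>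
      (\<forall>t\<in>J. curvature \<beta> t > 0 \<and> torsion \<beta> t \<noteq> 0)
    \<longrightarrow>
      (\<exists>c1 c2 c3 l1 l2 l3.
         c1 \<noteq> 0 \<and>
         curvature_torsion_equations c1 c2 I \<alpha> \<and>
         ode_solution c1 c2 c3 I (curvature \<alpha>) \<and>
         cubic_roots c1 c2 c3 l1 l2 l3 \<and> l1 * l3 < 0 \<and> l2 * l3 < 0 \<and>
         explicit_form (sgn c1) l1 l2 l3 I \<alpha> \<and>
         (\<exists>\<gamma> f t0.
            arc_length_curve UNIV \<gamma> \<and> (\<forall>s. curvature \<gamma> s > 0) \<and>
            curvature_torsion_equations c1 c2 UNIV \<gamma> \<and>
            ode_solution c1 c2 c3 UNIV (curvature \<gamma>) \<and>
            (\<forall>s\<in>I. \<gamma> s = \<alpha> s) \<and>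
            rigid_motion f \<and> (\<forall>t\<in>J. \<beta> t = f (\<gamma> (t + t0))))))
   \<and>
   (\<forall>(\<alpha> :: real \<Rightarrow> real^3) (\<beta> :: real \<Rightarrow> real^3) I J.
      minimal_translation_surface I J \<alpha> \<beta> \<and> \<not> (plane_curve I \<alpha> \<and> plane_curve J \<beta>)
    \<longrightarrow>
      (\<exists>c1 c2 c3 l1 l2 l3 \<gamma> \<phi> \<psi>.
         c1 \<noteq> 0 \<and> cubic_roots c1 c2 c3 l1 l2 l3 \<and>
         arc_length_curve UNIV \<gamma> \<and> (\<forall>s. curvature \<gamma> s > 0) \<and>
         ode_solution c1 c2 c3 UNIV (curvature \<gamma>) \<and>
         (\<forall>s. torsion \<gamma> s = c1 / (curvature \<gamma> s)\<^sup>2) \<and>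
         curvature_torsion_equations c1 c2 UNIV \<gamma> \<and>
         smooth_on I \<phi> \<and> (\<forall>s\<in>I. vderiv \<phi> s \<noteq> 0) \<and>
         smooth_on J \<psi> \<and> (\<forall>t\<in>J. vderiv \<psi> t \<noteq> 0) \<and>
         (\<forall>s\<in>I. \<forall>t\<in>J. translation_surface \<alpha> \<beta> s t =
                         translation_surface \<gamma> \<gamma> (\<phi> s) (\<psi> t))))
   \<and>
   (\<forall>c1 c2 c3 l1 l2 l3 I (\<kappa> :: real \<Rightarrow> real) (\<alpha> :: real \<Rightarrow> real^3).
      c1 \<noteq> 0 \<and> cubic_roots c1 c2 c3 l1 l2 l3 \<and>
      arc_length_curve I \<alpha> \<and>
      (\<forall>s\<in>I. \<kappa> s > 0) \<and> \<not> \<kappa> constant_on I \<and> ode_solution c1 c2 c3 I \<kappa> \<and>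
      (\<forall>s\<in>I. curvature \<alpha> s = \<kappa> s \<and> torsion \<alpha> s = c1 / (\<kappa> s)\<^sup>2)
    \<longrightarrow>
      (\<forall>s\<in>I. \<forall>t\<in>I. regular_at \<alpha> \<alpha> s t \<longrightarrow>
         mean_curvature (translation_surface \<alpha> \<alpha>) s t = 0))"
proof (intro conjI allI impI ballI, goal_cases)
  case (1 \<alpha> \<beta> I J)
  then show ?case by (intro minimal_translation_surface_unit_speed) auto
next
  case (2 \<alpha> \<beta> I J)
  then show ?case by (intro nonplanar_minimal_translation_surface) auto
next
  case (3 c1 c2 c3 l1 l2 l3 I \<kappa> \<alpha> s t)
  then show ?case by (intro prescribed_curvature_minimal[of c1 c2 c3 l1 l2 l3 I \<alpha> \<kappa> s t]) auto
qed

end
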